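(* Let $X(t)$, $t=(\theta,\varphi)\in S_2$, be a zero-mean vector random field on the unit sphere $S_2\subset\mathbb R^3$, and let $(X_\varphi(\theta,\varphi),X_\theta(\theta,\varphi),X_r(\theta,\varphi))$ be its components in the spherical coordinate system. Represent the field by three random functions on the rotation group $SO(3)$: for $g=g(\varphi_1,\theta,\varphi_2)$ and $\varphi=\frac{\pi}{2}-\varphi_1$, $$X_+(g)=e^{i\varphi_2}\left[-X_\varphi(\theta,\varphi)+iX_\theta(\theta,\varphi)\right],\qquad X_-(g)=e^{-i\varphi_2}\left[-X_\varphi(\theta,\varphi)-iX_\theta(\theta,\varphi)\right],\qquad X_r(g)=X_r(\theta,\varphi).$$ Suppose that each of the random functions $X_+(g)$, $X_-(g)$, $X_r(g)$ is weakly (second-order) isotropic and mean square continuous. Then there exist constants $F_l^{+},F_l^{-}$ and random variables $Z_{lm}^{+},Z_{lm}^{-}$ ($l=0,1,2,\dots$, $m=-l,\dots,l$) with $$E\left(Z_{lm}^{+}\overline{Z_{l'm'}^{+}}\right)=\delta_{ll'}\delta_{mm'},\qquad E\left(Z_{lm}^{-}\overline{Z_{l'm'}^{-}}\right)=\delta_{ll'}\delta_{mm'},$$ such that $$X_+(g)=\sum_{l=0}^{\infty}\sum_{m=-l}^{l}F_l^{+}\,T^l_{1m}(g^{-1})\,Z_{lm}^{+},\qquad X_-(g)=\sum_{l=0}^{\infty}\sum_{m=-l}^{l}F_l^{-}\,T^l_{-1,m}(g^{-1})\,Z_{lm}^{-},$$ where the series converge in $L^2(P(d\omega))$ for every $g\in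 SO(3)$ (pointwise in $g$). The corresponding covariance functions have the series representations $$E\left(X_+(g_1)\overline{X_+(g_2)}\right)=\sum_{l=0}^\infty |F_l^{+}|^2\,T^l_{11}(g_1^{-1}g_2),\qquad E\left(X_-(g_1)\overline{X_-(g_2)}\right)=\sum_{l=0}^\infty |F_l^{-}|^2\,T^l_{-1,-1}(g_1^{-1}g_2).$$ The normal component is expanded as a scalar random field on the sphere: there are constants $F_l$ and random variables $Z_l^m$ with $E(Z_l^m\overline{Z_{l'}^{m'}})=\delta_{ll'}\delta_{mm'}$ such that $X_r(\theta,\varphi)=\sum_{l=0}^\infty\sum_{m=-l}^{l}F_l\,Y_l^m(\theta,\varphi)\,Z_l^m$ in $L^2(P(d\omega))$ at every point of the sphere, where $Y_l^m$ are the usual spherical harmonics.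
   Context: All random variables live on a probability space $(\Omega,\mathcal F,P)$; $L^2(P(d\omega))$ is the Hilbert space of complex random variables $Y$ with $E|Y|^2<\infty$ and inner product $(Y_1,Y_2)=E(Y_1\overline{Y_2})$. Euler angles: $g=g(\varphi_1,\theta,\varphi_2)\in SO(3)$ is the product of three successive rotations: by $\varphi_1$ around the $z$ axis, by $\theta$ around the new $x$ axis, and by $\varphi_2$ around the new $z$ axis. Generalized spherical functions: for each integer $l\ge 0$, $T^l(g)=\{T^l_{mn}(g)\}_{m,n=-l,\dots,l}$ denotes the matrix of the irreducible unitary representation of $SO(3)$ of weight $l$ (dimension $2l+1$) in the canonical basis, i.e. an orthonormal basis of eigenvectors of the rotations about the $z$ axis, the rotation by angle $\varphi$ having eigenvalue $e^{-in\varphi}$ on the $n$-th vector. Thus $T^l_{mn}(g(\varphi_1,\theta,\varphi_2))=e^{-im\varphi_1}P^l_{mn}(\cos\theta)e^{-in\varphi_2}$ and $T^l_{mn}(g_1g_2)=\sum_{s=-l}^l T^l_{ms}(g_1)T^l_{sn}(g_2)$. By convention $T^l_{mn}=0$ if $|m|>l$ or $|n|>l$. Local coordinate system: with $(e_r,e_\theta,e_\varphi)$ the unit vectors of the spherical coordinate system at the point $(\theta,\varphi)$, to the rotation $g(\varphi_1,\theta,\varphi_2)$ corresponds the triad $e_1=-e_\varphi\cos\varphi_2-e_\theta\sin\varphi_2$, $e_2=-e_\varphi\sin\varphi_2+e_\theta\cos\varphi_2$, $e_3=e_r$ at the point $(\theta,\varphi)$ with $\varphi=\frac{\pi}{2}-\varphi_1$;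 if $X_1(g),X_2(g),X_3(g)$ are the components of $X$ in this triad, then $X_\pm(g)=X_1(g)\pm iX_2(g)$ and $X_r(g)=X_3(g)$. (The formulas in terms of $X_\varphi,X_\theta$ are for $0<\theta<\pi$; at the poles, where the spherical basis is undefined, the values of the random functions on $SO(3)$ are those determined by mean square continuity.) A random function $Y(g)$, $g\in SO(3)$, is weakly (second-order) isotropic if its covariance function $R(g_1,g_2)=E(Y(g_1)\overline{Y(g_2)})$ satisfies $R(gg_1,gg_2)=R(g_1,g_2)$ for all $g,g_1,g_2\in SO(3)$. It is mean square continuous if $g\mapsto Y(g)$ is continuous as a map into $L^2(P(d\omega))$.
   Formalization: The random variables Z may live on Ω enlarged by an independent uniform variable, since a small Ω (e.g. one point, X=0) carries no infinite orthonormal family; every Z_lm with F_l ≠ 0 is still an L² random variable on Ω itself. *)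

theory Defs
  imports "HOL-Probability.Probability" "HOL-Computational_Algebra.Polynomial"
begin

section \<open>The rotation group and Euler angles\<close>

definition SO3 :: "(real^3^3) set" where
  "SO3 = {g. rotation_matrix g}"

definition rot_x :: "real \<Rightarrow> real^3^3" where
  "rot_x a = vector [vector [1, 0, 0],
                     vector [0, cos a, - sin a],
                     vector [0, sin a, cos a]]"

definition rot_z :: "real \<Rightarrow> real^3^3" where
  "rot_z a = vector [vector [cos a, - sin a, 0],
                     vector [sin a, cos a, 0],
                     vector [0, 0, 1]]"

text \<open>Successive rotations about the moved axes multiply on the right.\<close>

definition euler :: "real \<Rightarrow> real \<Rightarrow> real \<Rightarrow> real^3^3" where
  "euler \<phi>1 \<theta> \<phi>2 = rot_z \<phi>1 ** rot_x \<theta> ** rot_z \<phi>2"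


section \<open>Generalized spherical functions\<close>

text \<open>A vector of the representation space of weight \<open>l\<close> is a function on \<open>{-l..l}\<close>,
  extended by zero to all integers.\<close>

definition weight_space :: "nat \<Rightarrow> (int \<Rightarrow> complex) set" where
  "weight_space l = {v. \<forall>m. \<bar>m\<bar> > int l \<longrightarrow> v m = 0}"

definition rep_apply ::
  "nat \<Rightarrow> (int \<Rightarrow> int \<Rightarrow> real^3^3 \<Rightarrow> complex) \<Rightarrow> real^3^3 \<Rightarrow> (int \<Rightarrow> complex) \<Rightarrow> int \<Rightarrow> complex" where
  "rep_apply l T g v = (\<lambda>m. \<Sum>n = - int l..int l. T m n g * v n)"

definition invariant_subspace ::
  "nat \<Rightarrow> (int \<Rightarrow> int \<Rightarrow> real^3^3 \<Rightarrow> complex) \<Rightarrow> (int \<Rightarrow> complex) set \<Rightarrow> bool" where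
  "invariant_subspace l T V \<longleftrightarrow>
     V \<subseteq> weight_space l \<and> (\<lambda>_. 0) \<in> V \<and>
     (\<forall>u\<in>V. \<forall>v\<in>V. (\<lambda>m. u m + v m) \<in> V) \<and>
     (\<forall>c. \<forall>v\<in>V. (\<lambda>m. c * v m) \<in> V) \<and>
     (\<forall>g\<in>SO3. \<forall>v\<in>V. rep_apply l T g v \<in> V)"

definition irreducible_rep :: "nat \<Rightarrow> (int \<Rightarrow> int \<Rightarrow> real^3^3 \<Rightarrow> complex) \<Rightarrow> bool" where
  "irreducible_rep l T \<longleftrightarrow>
     (\<forall>V. invariant_subspace l T V \<longrightarrow> V = {\<lambda>_. 0} \<or> V = weight_space l)"

text \<open>The matrix \<open>T m n\<close> (\<open>-l \<le> m, n \<le> l\<close>, zero outside this range) of the irreducible unitary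
  representation of weight \<open>l\<close> in a canonical basis. Such a basis is determined only up to a
  phase factor for each basis vector, so this is a predicate on \<open>T\<close> and not a definition of
  a single matrix. The factorization
  \<open>T m n (euler \<phi>1 \<theta> \<phi>2) = cis (- m \<phi>1) * T m n (rot_x \<theta>) * cis (- n \<phi>2)\<close> is a consequence of the
  second and the last clause.\<close>

definition canonical_irrep :: "nat \<Rightarrow> (int \<Rightarrow> int \<Rightarrow> real^3^3 \<Rightarrow> complex) \<Rightarrow> bool" where
  "canonical_irrep l T \<longleftrightarrow>
     (\<forall>m n g. \<bar>m\<bar> > int l \<or> \<bar>n\<bar> > int l \<longrightarrow> T m n g = 0) \<and>
     (\<forall>g\<in>SO3. \<forall>h\<in>SO3. \<forall>m n.
        T m n (g ** h) = (\<Sum>s = - int l..int l. T m s g * T s n h)) \<and>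
     (\<forall>g\<in>SO3. \<forall>m\<in>{- int l..int l}. \<forall>n\<in>{- int l..int l}.
        (\<Sum>s = - int l..int l. T m s g * cnj (T n s g)) = (if m = n then 1 else 0)) \<and>
     (\<forall>m n. continuous_on SO3 (T m n)) \<and>
     irreducible_rep l T \<and>
     (\<forall>\<phi>. \<forall>m\<in>{- int l..int l}. \<forall>n\<in>{- int l..int l}.
        T m n (rot_z \<phi>) = (if m = n then cis (- (of_int n * \<phi>)) else 0))"


section \<open>Spherical harmonics\<close>

text \<open>Rodrigues' formula, with the Condon--Shortley phase, for \<open>m \<ge> 0\<close>.\<close>

definition assoc_legendre :: "nat \<Rightarrow> nat \<Rightarrow> real \<Rightarrow> real" where
  "assoc_legendre l m x =
     (-1) ^ m * sqrt (1 - x\<^sup>2) ^ m * poly ((pderiv ^^ (l + m)) ([:-1, 0, 1:] ^ l)) x / (2 ^ l * fact l)"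

text \<open>For \<open>m < 0\<close> this is \<open>Y l m = (-1) ^ m * cnj (Y l (- m))\<close>.\<close>

definition sph_harmonic :: "nat \<Rightarrow> int \<Rightarrow> real \<Rightarrow> real \<Rightarrow> complex" where
  "sph_harmonic l m \<theta> \<phi> =
     (let k = nat \<bar>m\<bar> in
       (if m < 0 then (-1) ^ k else 1) *
       complex_of_real (sqrt ((2 * real l + 1) / (4 * pi) * (fact (l - k) / fact (l + k)))
         * assoc_legendre l k (cos \<theta>)) *
       cis (of_int m * \<phi>))"


section \<open>The spherical coordinate system\<close>

definition e_r :: "real \<Rightarrow> real \<Rightarrow> real^3" where
  "e_r \<theta> \<phi> = vector [sin \<theta> * cos \<phi>, sin \<theta> * sin \<phi>, cos \<theta>]"

definition e_\<theta> :: "real \<Rightarrow> real \<Rightarrow> real^3" where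
  "e_\<theta> \<theta> \<phi> = vector [cos \<theta> * cos \<phi>, cos \<theta> * sin \<phi>, - sin \<theta>]"

definition e_\<phi> :: "real \<Rightarrow> real \<Rightarrow> real^3" where
  "e_\<phi> \<theta> \<phi> = vector [- sin \<phi>, cos \<phi>, 0]"

text \<open>Component, along a real unit vector, of a vector with possibly complex coordinates.\<close>

definition component :: "complex^3 \<Rightarrow> real^3 \<Rightarrow> complex" where
  "component v e = (\<Sum>i\<in>UNIV. v $ i * complex_of_real (e $ i))"

text \<open>The point with spherical coordinates \<open>(\<theta>, \<phi>)\<close> of the unit sphere is \<open>e_r \<theta> \<phi>\<close>.\<close>

definition field_\<phi> :: "(real^3 \<Rightarrow> 'w \<Rightarrow> complex^3) \<Rightarrow> real \<Rightarrow> real \<Rightarrow> 'w \<Rightarrow> complex" where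
  "field_\<phi> X \<theta> \<phi> \<omega> = component (X (e_r \<theta> \<phi>) \<omega>) (e_\<phi> \<theta> \<phi>)"

definition field_\<theta> :: "(real^3 \<Rightarrow> 'w \<Rightarrow> complex^3) \<Rightarrow> real \<Rightarrow> real \<Rightarrow> 'w \<Rightarrow> complex" where
  "field_\<theta> X \<theta> \<phi> \<omega> = component (X (e_r \<theta> \<phi>) \<omega>) (e_\<theta> \<theta> \<phi>)"

definition field_r :: "(real^3 \<Rightarrow> 'w \<Rightarrow> complex^3) \<Rightarrow> real \<Rightarrow> real \<Rightarrow> 'w \<Rightarrow> complex" where
  "field_r X \<theta> \<phi> \<omega> = component (X (e_r \<theta> \<phi>) \<omega>) (e_r \<theta> \<phi>)"


section \<open>Second-order random variables and random functions\<close>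

definition L2_var :: "'w measure \<Rightarrow> ('w \<Rightarrow> complex) \<Rightarrow> bool" where
  "L2_var M Y \<longleftrightarrow> Y \<in> borel_measurable M \<and> integrable M (\<lambda>\<omega>. (cmod (Y \<omega>))\<^sup>2)"

definition L2_inner :: "'w measure \<Rightarrow> ('w \<Rightarrow> complex) \<Rightarrow> ('w \<Rightarrow> complex) \<Rightarrow> complex" where
  "L2_inner M Y1 Y2 = (LINT \<omega>|M. Y1 \<omega> * cnj (Y2 \<omega>))"

definition L2_sums :: "'w measure \<Rightarrow> (nat \<Rightarrow> 'w \<Rightarrow> complex) \<Rightarrow> ('w \<Rightarrow> complex) \<Rightarrow> bool" where
  "L2_sums M f Y \<longleftrightarrow>
     (\<forall>l. L2_var M (f l)) \<and> L2_var M Y \<and>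
     (\<lambda>L. LINT \<omega>|M. (cmod (Y \<omega> - (\<Sum>l<L. f l \<omega>)))\<^sup>2) \<longlonglongrightarrow> 0"

definition zero_mean_field :: "'w measure \<Rightarrow> (real^3 \<Rightarrow> 'w \<Rightarrow> complex^3) \<Rightarrow> bool" where
  "zero_mean_field M X \<longleftrightarrow>
     (\<forall>t\<in>sphere 0 1. integrable M (X t) \<and> integral\<^sup>L M (X t) = 0)"

definition weakly_isotropic :: "'w measure \<Rightarrow> (real^3^3 \<Rightarrow> 'w \<Rightarrow> complex) \<Rightarrow> bool" where
  "weakly_isotropic M Y \<longleftrightarrow>
     (\<forall>g\<in>SO3. L2_var M (Y g)) \<and>
     (\<forall>g\<in>SO3. \<forall>g1\<in>SO3. \<forall>g2\<in>SO3.
        L2_inner M (Y (g ** g1)) (Y (g ** g2)) = L2_inner M (Y g1) (Y g2))"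

definition mean_square_continuous :: "'w measure \<Rightarrow> (real^3^3 \<Rightarrow> 'w \<Rightarrow> complex) \<Rightarrow> bool" where
  "mean_square_continuous M Y \<longleftrightarrow>
     (\<forall>g\<in>SO3. L2_var M (Y g)) \<and>
     (\<forall>g\<in>SO3. ((\<lambda>h. LINT \<omega>|M. (cmod (Y h \<omega> - Y g \<omega>))\<^sup>2) \<longlongrightarrow> 0) (at g within SO3))"

definition orthonormal_family :: "'w measure \<Rightarrow> (nat \<Rightarrow> int \<Rightarrow> 'w \<Rightarrow> complex) \<Rightarrow> bool" where
  "orthonormal_family M Z \<longleftrightarrow>
     (\<forall>l. \<forall>m\<in>{- int l..int l}. L2_var M (Z l m)) \<and>
     (\<forall>l l'. \<forall>m\<in>{- int l..int l}. \<forall>m'\<in>{- int l'..int l'}.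
        L2_inner M (Z l m) (Z l' m') = (if l = l' \<and> m = m' then 1 else 0))"

text \<open>A given probability space may be too small to carry the required infinite orthonormal
  families: over a one-point space \<open>L\<^sup>2\<close> has dimension one. The random variables \<open>Z l m\<close> with
  \<open>F l \<noteq> 0\<close> always exist on the given space; those with \<open>F l = 0\<close>, which do not contribute to
  the expansion, may need additional randomness. As usual the space is therefore enlarged by an
  independent uniform variable; a random variable \<open>Y\<close> on the given space is identified with
  \<open>\<lambda>\<omega>. Y (fst \<omega>)\<close>.\<close>

definition enlarged :: "'w measure \<Rightarrow> ('w \<times> real) measure" where
  "enlarged M = M \<Otimes>\<^sub>M uniform_measure lborel {0..1}"

definition on_original_space ::
  "'w measure \<Rightarrow> (nat \<Rightarrow> complex) \<Rightarrow> (nat \<Rightarrow> int \<Rightarrow> 'w \<times> real \<Rightarrow> complex) \<Rightarrow> bool" where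
  "on_original_space M F Z \<longleftrightarrow>
     (\<forall>l. \<forall>m\<in>{- int l..int l}. F l \<noteq> 0 \<longrightarrow>
        (\<exists>W. L2_var M W \<and> (\<forall>\<omega>. Z l m \<omega> = W (fst \<omega>))))"

end

theory Submission
  imports Defs
begin

text \<open>Covariances of isotropic random functions on \<open>SO3\<close> are functions of \<open>g1\<inverse> g2\<close>; equivariance under
  rotations about the \<open>z\<close> axis makes them functions of a single angle. The random variable
  \<open>Z l m\<close> is, up to normalization, the weak integral of \<open>X g * T l m n g\<close> against Haar measure, where
  \<open>n\<close> is 1, -1 or 0. Schur orthogonality makes these variables orthogonal, with \<open>E \<bar>Z l m\<bar>\<^sup>2\<close> equal to the
  Fourier coefficient \<open>c l\<close> of the covariance, so that \<open>c l \<ge> 0\<close> and, by Bessel's inequality, the series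
  of the \<open>c l\<close> converges. For \<open>\<bar>n\<bar> \<le> 1\<close> the functions \<open>T l n n (rot_x t)\<close>, \<open>l \<le> L\<close>, span all polynomials in
  \<open>cos t\<close> of degree at most \<open>L\<close> that vanish at \<open>cos t = -1\<close> if \<open>n \<noteq> 0\<close>: they are linearly independent by Schur,
  and the dimensions agree. Hence the Fourier series of the covariance converges to the covariance, which
  means that the Bessel inequality is an equality and the expansion of \<open>X g\<close> converges.

  For the normal component, \<open>T l m 0\<close> is identified with the spherical harmonics. The matrix element
  \<open>T l 0 0 (rot_x (- b) ** rot_z a ** rot_x t)\<close> is a polynomial \<open>P\<close> in
  \<open>cos b * cos t + sin b * sin t * cos a\<close>. Its Fourier coefficients in \<open>a\<close> are the products
  \<open>cnj (T l m 0 (rot_x b)) * T l m 0 (rot_x t)\<close>. At second order in \<open>b\<close>, the coefficient \<open>m = 0\<close> yields Legendre's equation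
  for \<open>P\<close>; the lowest order in \<open>b\<close> of the others yields \<open>T l m 0 (rot_x t)\<close> as a multiple of
  \<open>sin t ^ m\<close> times the \<open>m\<close>-th derivative of \<open>P\<close>.\<close>

section \<open>Square integrable random variables\<close>

text \<open>No formula for \<open>T\<close> is given: \<open>canonical_irrep\<close> leaves a phase
  open for every basis vector. Whatever is needed about \<open>T\<close> comes from the group law,
  unitarity, irreducibility and the eigenvalues of \<open>rot_z\<close>, and the identification with
  spherical harmonics can only hold up to unimodular factors, which the random variables absorb.

  The hard point is completeness. Equivariance on both sides lowers it to one variable, so that
  Weierstrass approximation in cos t takes the place of the Peter-Weyl theorem. The restriction at
  cos t = -1 costs nothing: the commutation relation between \<open>rot_x pi\<close> and
  \<open>rot_z\<close> that makes the zonal functions vanish there makes the covariance vanish as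
  well.

  Convergence at every single g, and not merely in the mean over the group, comes from the residual
  of a partial sum having the same norm at all g.

  At the poles the tangential components are undefined, so equivariance is carried there by mean
  square continuity and holds only almost surely. This is why it is expressed by the vanishing of an
  \<open>L2_norm\<close>.\<close>

definition L2_norm :: "'w measure \<Rightarrow> ('w \<Rightarrow> complex) \<Rightarrow> real" where
  "L2_norm M Y = sqrt (LINT \<omega>|M. (cmod (Y \<omega>))\<^sup>2)"

lemma L2_norm_nonneg [simp]: "0 \<le> L2_norm M Y"
  by (simp add: L2_norm_def)

lemma L2_norm_square: "(L2_norm M Y)\<^sup>2 = (LINT \<omega>|M. (cmod (Y \<omega>))\<^sup>2)"
  by (simp add: L2_norm_def)

lemma L2_inner_self: "L2_inner M Y Y = complex_of_real ((L2_norm M Y)\<^sup>2)"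
  unfolding L2_inner_def L2_norm_square complex_norm_square[symmetric]
  using integral_complex_of_real[of M "\<lambda>\<omega>. (cmod (Y \<omega>))\<^sup>2"] by simp

lemma L2_var_mult_integrable:
  assumes "L2_var M Y" "L2_var M Z"
  shows "integrable M (\<lambda>\<omega>. Y \<omega> * cnj (Z \<omega>))"
proof (rule Bochner_Integration.integrable_bound)
  show "integrable M (\<lambda>\<omega>. (cmod (Y \<omega>))\<^sup>2 + (cmod (Z \<omega>))\<^sup>2)"
    using assms by (auto simp: L2_var_def)
  show "(\<lambda>\<omega>. Y \<omega> * cnj (Z \<omega>)) \<in> borel_measurable M"
    using assms by (auto simp: L2_var_def intro!: borel_measurable_times borel_measurable_continuous_on[OF continuous_on_cnj[OF continuous_on_id], simplified])
  show "AE \<omega> in M. norm (Y \<omega> * cnj (Z \<omega>)) \<le> norm ((cmod (Y \<omega>))\<^sup>2 + (cmod (Z \<omega>))\<^sup>2)"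
  proof (rule AE_I2)
    fix \<omega>
    have "2 * (cmod (Y \<omega>) * cmod (Z \<omega>)) \<le> (cmod (Y \<omega>))\<^sup>2 + (cmod (Z \<omega>))\<^sup>2"
      using sum_squares_bound[of "cmod (Y \<omega>)" "cmod (Z \<omega>)"] by (simp add: ac_simps)
    moreover have "0 \<le> cmod (Y \<omega>) * cmod (Z \<omega>)" by simp
    ultimately show "norm (Y \<omega> * cnj (Z \<omega>)) \<le> norm ((cmod (Y \<omega>))\<^sup>2 + (cmod (Z \<omega>))\<^sup>2)"
      unfolding norm_mult complex_mod_cnj real_norm_def by linarith
  qed
qed

lemma L2_var_cmult [intro]:
  "L2_var M Y \<Longrightarrow> L2_var M (\<lambda>\<omega>. c * Y \<omega>)"
  by (auto simp: L2_var_def norm_mult power_mult_distrib)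

lemma L2_var_add [intro]:
  assumes "L2_var M Y" "L2_var M Z"
  shows "L2_var M (\<lambda>\<omega>. Y \<omega> + Z \<omega>)"
  unfolding L2_var_def
proof
  show "(\<lambda>\<omega>. Y \<omega> + Z \<omega>) \<in> borel_measurable M"
    using assms by (auto simp: L2_var_def)
  have "integrable M (\<lambda>\<omega>. (cmod (Y \<omega>))\<^sup>2 + (cmod (Z \<omega>))\<^sup>2 + 2 * Re (Y \<omega> * cnj (Z \<omega>)))"
    using assms integrable_Re[OF L2_var_mult_integrable[OF assms]]
    by (intro Bochner_Integration.integrable_add integrable_mult_right) (auto simp: L2_var_def)
  then show "integrable M (\<lambda>\<omega>. (cmod (Y \<omega> + Z \<omega>))\<^sup>2)"
    by (rule back_subst[of "integrable M"])
      (auto simp: cmod_power2 power2_sum algebra_simps fun_eq_iff)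
qed

lemma L2_var_zero [intro, simp]: "L2_var M (\<lambda>\<omega>. 0)"
  by (simp add: L2_var_def)

lemma L2_var_uminus [intro]: "L2_var M Y \<Longrightarrow> L2_var M (\<lambda>\<omega>. - Y \<omega>)"
  using L2_var_cmult[of M Y "-1"] by simp

lemma L2_var_diff [intro]:
  "L2_var M Y \<Longrightarrow> L2_var M Z \<Longrightarrow> L2_var M (\<lambda>\<omega>. Y \<omega> - Z \<omega>)"
  using L2_var_add[OF _ L2_var_uminus, of M Y Z] by simp

lemma L2_var_sum [intro]:
  "(\<And>i. i \<in> I \<Longrightarrow> L2_var M (Y i)) \<Longrightarrow> L2_var M (\<lambda>\<omega>. \<Sum>i\<in>I. Y i \<omega>)"
  by (induction I rule: infinite_finite_induct) auto

lemma L2_inner_commute: "L2_inner M Z Y = cnj (L2_inner M Y Z)"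
  unfolding L2_inner_def
  using Bochner_Integration.integral_cnj[of M "\<lambda>\<omega>. Y \<omega> * cnj (Z \<omega>)"] by (simp add: mult.commute)

lemma L2_inner_diff_left:
  assumes "L2_var M Y" "L2_var M Y'" "L2_var M Z"
  shows "L2_inner M (\<lambda>\<omega>. Y \<omega> - Y' \<omega>) Z = L2_inner M Y Z - L2_inner M Y' Z"
  using assms by (simp add: L2_inner_def left_diff_distrib L2_var_mult_integrable)

lemma L2_inner_cmult_left: "L2_inner M (\<lambda>\<omega>. c * Y \<omega>) Z = c * L2_inner M Y Z"
  by (simp add: L2_inner_def mult.assoc)

lemma L2_inner_sum_left:
  assumes "\<And>i. i \<in> I \<Longrightarrow> L2_var M (Y i)" "L2_var M Z"
  shows "L2_inner M (\<lambda>\<omega>. \<Sum>i\<in>I. Y i \<omega>) Z = (\<Sum>i\<in>I. L2_inner M (Y i) Z)"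
  using assms by (simp add: L2_inner_def sum_distrib_right L2_var_mult_integrable)

lemma L2_inner_diff_right:
  assumes "L2_var M Y" "L2_var M Y'" "L2_var M Z"
  shows "L2_inner M Z (\<lambda>\<omega>. Y \<omega> - Y' \<omega>) = L2_inner M Z Y - L2_inner M Z Y'"
  using L2_inner_diff_left[OF assms] by (metis L2_inner_commute complex_cnj_diff)

lemma L2_inner_cmult_right: "L2_inner M Z (\<lambda>\<omega>. c * Y \<omega>) = cnj c * L2_inner M Z Y"
  by (metis L2_inner_commute L2_inner_cmult_left complex_cnj_mult)

lemma L2_inner_sum_right:
  assumes "\<And>i. i \<in> I \<Longrightarrow> L2_var M (Y i)" "L2_var M Z"
  shows "L2_inner M Z (\<lambda>\<omega>. \<Sum>i\<in>I. Y i \<omega>) = (\<Sum>i\<in>I. L2_inner M Z (Y i))"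
  using assms by (simp add: L2_inner_def sum_distrib_left L2_var_mult_integrable)

lemma L2_norm_diff_square:
  assumes "L2_var M Y" "L2_var M Z"
  shows "(L2_norm M (\<lambda>\<omega>. Y \<omega> - Z \<omega>))\<^sup>2 =
    (L2_norm M Y)\<^sup>2 - 2 * Re (L2_inner M Y Z) + (L2_norm M Z)\<^sup>2"
proof -
  have "complex_of_real ((L2_norm M (\<lambda>\<omega>. Y \<omega> - Z \<omega>))\<^sup>2) =
      of_real ((L2_norm M Y)\<^sup>2) - (L2_inner M Y Z + cnj (L2_inner M Y Z)) + of_real ((L2_norm M Z)\<^sup>2)"
    using assms unfolding L2_inner_self[symmetric] L2_inner_commute[of M Z Y, symmetric]
    by (simp add: L2_inner_diff_left L2_inner_diff_right L2_var_diff)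
  then show ?thesis
    by (simp add: complex_eq_iff)
qed

lemma L2_Cauchy_Schwarz:
  assumes "L2_var M Y" "L2_var M Z"
  shows "cmod (L2_inner M Y Z) \<le> L2_norm M Y * L2_norm M Z"
proof -
  define A where "A = (L2_norm M Y)\<^sup>2"
  define B where "B = (L2_norm M Z)\<^sup>2"
  define C where "C = L2_inner M Y Z"
  have pos: "0 \<le> A - 2 * t * (cmod C)\<^sup>2 + t\<^sup>2 * (cmod C)\<^sup>2 * B" for t :: real
  proof -
    have "(L2_norm M (\<lambda>\<omega>. of_real t * C * Z \<omega>))\<^sup>2 = t\<^sup>2 * (cmod C)\<^sup>2 * B"
      by (simp add: L2_norm_square B_def norm_mult power_mult_distrib mult.assoc)
    moreover have "L2_inner M Y (\<lambda>\<omega>. of_real t * C * Z \<omega>) = of_real t * of_real ((cmod C)\<^sup>2)"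
      unfolding L2_inner_cmult_right complex_norm_square by (simp add: C_def mult.commute)
    ultimately show ?thesis
      using L2_norm_diff_square[OF assms(1) L2_var_cmult[OF assms(2)], of "of_real t * C"]
        zero_le_power2[of "L2_norm M (\<lambda>\<omega>. Y \<omega> - of_real t * C * Z \<omega>)"]
      by (simp add: A_def)
  qed
  have "(cmod C)\<^sup>2 \<le> A * B"
  proof (cases "C = 0 \<or> B = 0")
    case True
    show ?thesis
    proof (cases "C = 0")
      case False
      with True have "B = 0" by simp
      \<comment> \<open>For B = 0 the expression in \<open>pos\<close> is affine in t; at this t it
        equals - A - 2.\<close>
      with pos[of "(A + 1) / (cmod C)\<^sup>2"] False have False
        using zero_le_power2[of "L2_norm M Y"] by (simp add: A_def)
      then show ?thesis ..
    qed (simp add: A_def B_def)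
  next
    case False
    then have "0 < B" by (simp add: B_def)
    then show ?thesis using pos[of "1 / B"]
      by (simp add: field_simps power2_eq_square)
  qed
  then have "(cmod C)\<^sup>2 \<le> (L2_norm M Y * L2_norm M Z)\<^sup>2"
    by (simp add: A_def B_def power_mult_distrib)
  then show ?thesis
    unfolding C_def by (rule power2_le_imp_le) simp
qed

lemma L2_norm_triangle_diff:
  assumes "L2_var M Y" "L2_var M Z"
  shows "L2_norm M (\<lambda>\<omega>. Y \<omega> - Z \<omega>) \<le> L2_norm M Y + L2_norm M Z"
proof (rule power2_le_imp_le)
  have "- Re (L2_inner M Y Z) \<le> L2_norm M Y * L2_norm M Z"
    using L2_Cauchy_Schwarz[OF assms] abs_Re_le_cmod[of "L2_inner M Y Z"] by linarith
  then show "(L2_norm M (\<lambda>\<omega>. Y \<omega> - Z \<omega>))\<^sup>2 \<le> (L2_norm M Y + L2_norm M Z)\<^sup>2"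
    unfolding L2_norm_diff_square[OF assms] by (simp add: power2_sum)
qed simp

section \<open>Completeness of L2 and weak integrals of random functions\<close>

lemma L2_complete:
  assumes W: "\<And>n. L2_var M (W n)"
    and Cauchy: "\<And>e. 0 < e \<Longrightarrow> \<exists>N. \<forall>m\<ge>N. \<forall>n\<ge>N. L2_norm M (\<lambda>\<omega>. W m \<omega> - W n \<omega>) \<le> e"
  obtains V where "L2_var M V" "(\<lambda>n. L2_norm M (\<lambda>\<omega>. W n \<omega> - V \<omega>)) \<longlonglongrightarrow> 0"
proof -
  have meas [measurable]: "W n \<in> borel_measurable M" for n
    using W by (simp add: L2_var_def)
  have nn: "(\<integral>\<^sup>+\<omega>. ennreal ((cmod (W m \<omega> - W n \<omega>))\<^sup>2) \<partial>M) = ennreal ((L2_norm M (\<lambda>\<omega>. W m \<omega> - W n \<omega>))\<^sup>2)" for m n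
    using L2_var_diff[OF W W, of m n]
    by (simp add: L2_norm_square L2_var_def nn_integral_eq_integral)
  have "\<exists>N. \<forall>k. \<forall>m\<ge>N k. \<forall>n\<ge>N k. L2_norm M (\<lambda>\<omega>. W m \<omega> - W n \<omega>) \<le> (1/2)^k"
    using Cauchy by (intro choice) (auto intro!: Cauchy)
  then obtain N where N: "\<And>k m n. m \<ge> N k \<Longrightarrow> n \<ge> N k \<Longrightarrow> L2_norm M (\<lambda>\<omega>. W m \<omega> - W n \<omega>) \<le> (1/2)^k"
    by blast
  \<comment> \<open>Summing all \<open>N i\<close> up to k puts both \<open>r k\<close> and
    \<open>r (Suc k)\<close> beyond \<open>N k\<close> although \<open>N\<close> need not be
    monotone; the summand \<open>k\<close> makes \<open>r\<close> tend to infinity.\<close>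
  define r where "r k = (\<Sum>i\<le>k. N i) + k" for k
  have r_ge: "r k \<ge> N k" "r k \<ge> k" for k
    by (auto simp: r_def intro!: trans_le_add1 member_le_sum)
  have r_Suc: "r (Suc k) \<ge> N k" for k
    using member_le_sum[of k "{..Suc k}" N] by (simp add: r_def)
  \<comment> \<open>With the weight 2^k the integrals of the \<open>D k\<close> still form a
    convergent series, and finiteness of the weighted sum at a point forces the increments there to
    decay geometrically with ratio sqrt (1/2).\<close>
  define D where "D k \<omega> = (cmod (W (r (Suc k)) \<omega> - W (r k) \<omega>))\<^sup>2" for k \<omega>
  have D_meas [measurable]: "D k \<in> borel_measurable M" for k
    unfolding D_def by measurable
  have "(\<integral>\<^sup>+\<omega>. (\<Sum>k. ennreal (2^k * D k \<omega>)) \<partial>M) = (\<Sum>k. \<integral>\<^sup>+\<omega>. ennreal (2^k * D k \<omega>) \<partial>M)"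
    by (rule nn_integral_suminf) simp
  also have "\<dots> \<le> (\<Sum>k. ennreal ((1/2)^k))"
  proof (intro suminf_le allI)
    fix k
    have "(\<integral>\<^sup>+\<omega>. ennreal (2^k * D k \<omega>) \<partial>M) = ennreal (2^k) * (\<integral>\<^sup>+\<omega>. ennreal (D k \<omega>) \<partial>M)"
      by (subst nn_integral_cmult[symmetric]) (auto simp: ennreal_mult D_def)
    also have "\<dots> = ennreal (2^k * (L2_norm M (\<lambda>\<omega>. W (r (Suc k)) \<omega> - W (r k) \<omega>))\<^sup>2)"
      by (simp add: D_def nn ennreal_mult)
    also have "\<dots> \<le> ennreal (2^k * ((1/2)^k)\<^sup>2)"
      by (intro ennreal_leI mult_left_mono power_mono N r_ge r_Suc) auto
    also have "2^k * ((1/2)^k)\<^sup>2 = (1/2 :: real)^k"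
      by (simp add: power2_eq_square power_mult_distrib[symmetric] flip: mult.assoc)
    finally show "(\<integral>\<^sup>+\<omega>. ennreal (2^k * D k \<omega>) \<partial>M) \<le> ennreal ((1/2)^k)" .
  qed auto
  also have "\<dots> < \<infinity>"
    by (subst suminf_ennreal2) (auto simp: summable_geometric)
  finally have "AE \<omega> in M. (\<Sum>k. ennreal (2^k * D k \<omega>)) \<noteq> \<infinity>"
    by (intro nn_integral_noteq_infinite) auto
  then have AE_conv: "AE \<omega> in M. convergent (\<lambda>k. W (r k) \<omega>)"
  proof eventually_elim
    case (elim \<omega>)
    define C where "C = enn2real (\<Sum>k. ennreal (2^k * D k \<omega>))"
    have "ennreal (2^k * D k \<omega>) \<le> ennreal C" for k
      using sum_le_suminf[of "\<lambda>k. ennreal (2^k * D k \<omega>)" "{k}"] elim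
      by (simp add: C_def less_top)
    moreover have "0 \<le> C" by (simp add: C_def)
    ultimately have le: "2^k * D k \<omega> \<le> C" for k
      by (simp add: ennreal_le_iff)
    have bd: "cmod (W (r (Suc k)) \<omega> - W (r k) \<omega>) \<le> sqrt C * (sqrt (1/2))^k" for k
    proof -
      have "(cmod (W (r (Suc k)) \<omega> - W (r k) \<omega>))\<^sup>2 \<le> C * (1/2)^k"
        using le[of k] by (simp add: D_def field_simps)
      then have "cmod (W (r (Suc k)) \<omega> - W (r k) \<omega>) \<le> sqrt (C * (1/2)^k)"
        using real_le_rsqrt by blast
      then show ?thesis by (simp add: real_sqrt_mult real_sqrt_power)
    qed
    have "summable (\<lambda>k. sqrt C * (sqrt (1/2))^k)"
      by (intro summable_mult summable_geometric) (simp add: real_sqrt_lt_1_iff)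
    then have "summable (\<lambda>k. W (r (Suc k)) \<omega> - W (r k) \<omega>)"
      by (rule summable_comparison_test'[where N=0]) (use bd in auto)
    then have "convergent (\<lambda>n. \<Sum>k<n. W (r (Suc k)) \<omega> - W (r k) \<omega>)"
      by (simp add: summable_iff_convergent)
    then have "convergent (\<lambda>n. W (r n) \<omega> - W (r 0) \<omega>)"
      unfolding sum_lessThan_telescope[of "\<lambda>n. W (r n) \<omega>"] .
    then show ?case
      using convergent_add[OF _ convergent_const[of "W (r 0) \<omega>"], of "\<lambda>n. W (r n) \<omega> - W (r 0) \<omega>"]
      by simp
  qed
  define V where "V \<omega> = lim (\<lambda>k. W (r k) \<omega>)" for \<omega>
  have V_meas [measurable]: "V \<in> borel_measurable M"
    unfolding V_def by (rule borel_measurable_lim_metric) simp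
  have AE_V: "AE \<omega> in M. (\<lambda>k. W (r k) \<omega>) \<longlonglongrightarrow> V \<omega>"
    using AE_conv by eventually_elim (simp add: V_def convergent_LIMSEQ_iff)
  \<comment> \<open>Fatou's lemma along the subsequence bounds the distance from every late
    \<open>W n\<close> to the limit, so the whole sequence converges in norm.\<close>
  have nnV: "(\<integral>\<^sup>+\<omega>. ennreal ((cmod (W n \<omega> - V \<omega>))\<^sup>2) \<partial>M) \<le> ennreal (((1/2)^k)\<^sup>2)"
    if "n \<ge> N k" for n k
  proof -
    have "(\<integral>\<^sup>+\<omega>. ennreal ((cmod (W n \<omega> - V \<omega>))\<^sup>2) \<partial>M) =
        (\<integral>\<^sup>+\<omega>. liminf (\<lambda>j. ennreal ((cmod (W n \<omega> - W (r j) \<omega>))\<^sup>2)) \<partial>M)"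
    proof (rule nn_integral_cong_AE, use AE_V in eventually_elim)
      case (elim \<omega>)
      have "(\<lambda>j. ennreal ((cmod (W n \<omega> - W (r j) \<omega>))\<^sup>2)) \<longlonglongrightarrow> ennreal ((cmod (W n \<omega> - V \<omega>))\<^sup>2)"
        by (intro tendsto_ennrealI tendsto_intros elim)
      then show ?case
        using lim_imp_Liminf[OF sequentially_bot] by metis
    qed
    also have "\<dots> \<le> liminf (\<lambda>j. \<integral>\<^sup>+\<omega>. ennreal ((cmod (W n \<omega> - W (r j) \<omega>))\<^sup>2) \<partial>M)"
      by (rule nn_integral_liminf) measurable
    also have "\<dots> \<le> liminf (\<lambda>j. ennreal (((1/2)^k)\<^sup>2))"
    proof (rule Liminf_mono)
      show "\<forall>\<^sub>F j in sequentially. (\<integral>\<^sup>+\<omega>. ennreal ((cmod (W n \<omega> - W (r j) \<omega>))\<^sup>2) \<partial>M) \<le> ennreal (((1/2)^k)\<^sup>2)"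
        using eventually_ge_at_top[of "N k"]
      proof eventually_elim
        case (elim j)
        then have "r j \<ge> N k" using r_ge(2)[of j] by linarith
        then show ?case
          unfolding nn by (intro ennreal_leI power_mono N that) auto
      qed
    qed
    also have "\<dots> = ennreal (((1/2)^k)\<^sup>2)"
      by (simp add: Liminf_const)
    finally show ?thesis .
  qed
  have diff_L2: "L2_var M (\<lambda>\<omega>. W n \<omega> - V \<omega>)" if "n \<ge> N k" for n k
    unfolding L2_var_def
  proof
    show "integrable M (\<lambda>\<omega>. (cmod (W n \<omega> - V \<omega>))\<^sup>2)"
      by (rule integrableI_bounded) (use nnV[OF that] in \<open>auto simp: le_less_trans\<close>)
  qed simp
  have norm_le: "L2_norm M (\<lambda>\<omega>. W n \<omega> - V \<omega>) \<le> (1/2)^k" if "n \<ge> N k" for n k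
  proof -
    have "ennreal ((L2_norm M (\<lambda>\<omega>. W n \<omega> - V \<omega>))\<^sup>2) \<le> ennreal (((1/2)^k)\<^sup>2)"
      using nnV[OF that] diff_L2[OF that]
      by (simp add: L2_norm_square L2_var_def nn_integral_eq_integral)
    then have "(L2_norm M (\<lambda>\<omega>. W n \<omega> - V \<omega>))\<^sup>2 \<le> ((1/2)^k)\<^sup>2"
      by (subst (asm) ennreal_le_iff) auto
    then show ?thesis by (rule power2_le_imp_le) simp
  qed
  have "L2_var M V"
    using L2_var_diff[OF W diff_L2[OF order_refl], of "N 0" 0] by simp
  moreover have "(\<lambda>n. L2_norm M (\<lambda>\<omega>. W n \<omega> - V \<omega>)) \<longlonglongrightarrow> 0"
  proof (rule LIMSEQ_I)
    fix e :: real assume "0 < e"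
    then obtain k where "(1/2)^k < e" using real_arch_pow_inv[of e "1/2"] by auto
    then show "\<exists>no. \<forall>n\<ge>no. norm (L2_norm M (\<lambda>\<omega>. W n \<omega> - V \<omega>) - 0) < e"
      using norm_le[where k=k] by (intro exI[of _ "N k"]) (auto intro: le_less_trans)
  qed
  ultimately show ?thesis by (rule that)
qed

text \<open>Stands in for uniform continuity, which has no meaning on a mere topological space.
  Neighbourhoods of small oscillation are reduced to a finite cover and made disjoint one after the
  other; thereafter \<open>c j\<close> need not lie in \<open>A j\<close>, but the oscillation
  relative to it remains controlled.\<close>

lemma compact_step_partition:
  fixes K :: "'g::topological_space set" and Y :: "'g \<Rightarrow> 'w \<Rightarrow> complex"
  assumes K: "compact K" and e: "0 < e"
    and Y: "\<And>g. g \<in> K \<Longrightarrow> ((\<lambda>h. L2_norm M (\<lambda>\<omega>. Y h \<omega> - Y g \<omega>)) \<longlongrightarrow> 0) (at g within K)"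
  obtains n :: nat and c and A where "\<And>j. j < n \<Longrightarrow> c j \<in> K"
    "\<And>j. j < n \<Longrightarrow> A j \<in> sets (restrict_space borel K)"
    "disjoint_family_on A {..<n}" "(\<Union>j<n. A j) = K"
    "\<And>j h. j < n \<Longrightarrow> h \<in> A j \<Longrightarrow> L2_norm M (\<lambda>\<omega>. Y h \<omega> - Y (c j) \<omega>) \<le> e"
proof -
  have "\<exists>U. open U \<and> g \<in> U \<and> (\<forall>h\<in>U \<inter> K. L2_norm M (\<lambda>\<omega>. Y h \<omega> - Y g \<omega>) \<le> e)" if "g \<in> K" for g
  proof -
    have "eventually (\<lambda>h. L2_norm M (\<lambda>\<omega>. Y h \<omega> - Y g \<omega>) < e) (at g within K)"
      using Y[OF that] e by (rule order_tendstoD)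
    then obtain U where "open U" "g \<in> U"
      and U: "\<And>h. h \<in> U \<Longrightarrow> h \<noteq> g \<Longrightarrow> h \<in> K \<Longrightarrow> L2_norm M (\<lambda>\<omega>. Y h \<omega> - Y g \<omega>) < e"
      unfolding eventually_at_topological by blast
    moreover have "L2_norm M (\<lambda>\<omega>. Y g \<omega> - Y g \<omega>) = 0"
      by (simp add: L2_norm_def)
    ultimately show ?thesis
      using e by (intro exI[of _ U]) (metis IntE less_imp_le)
  qed
  then obtain U where U: "\<And>g. g \<in> K \<Longrightarrow> open (U g) \<and> g \<in> U g"
    "\<And>g h. g \<in> K \<Longrightarrow> h \<in> U g \<Longrightarrow> h \<in> K \<Longrightarrow> L2_norm M (\<lambda>\<omega>. Y h \<omega> - Y g \<omega>) \<le> e"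
    by (metis Int_iff)
  obtain D where D: "D \<subseteq> K" "finite D" "K \<subseteq> (\<Union>g\<in>D. U g)"
    using compactE_image[OF K, of K U] U(1) by blast
  obtain c where c: "bij_betw c {..<card D} D"
    using ex_bij_betw_nat_finite[OF D(2)] by (auto simp: atLeast0LessThan)
  have cD: "c j \<in> D" if "j < card D" for j
    using c that by (auto simp: bij_betw_def)
  show ?thesis
  proof (rule that[of "card D" c "disjointed (\<lambda>j. K \<inter> U (c j))"])
    fix j assume j: "j < card D"
    show "c j \<in> K" using cD[OF j] D(1) by blast
    have "K \<inter> U (c i) \<in> sets (restrict_space borel K)" if "i \<le> j" for i
      unfolding sets_restrict_space using that j U(1)[of "c i"] cD[of i] D(1)
      by (intro imageI) auto
    then show "disjointed (\<lambda>j. K \<inter> U (c j)) j \<in> sets (restrict_space borel K)"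
      unfolding disjointed_def by (intro sets.Diff sets.finite_UN) auto
  next
    show "disjoint_family_on (disjointed (\<lambda>j. K \<inter> U (c j))) {..<card D}"
      using disjoint_family_disjointed by (rule disjoint_family_on_mono[rotated]) simp
    have "(\<Union>j\<in>{0..<card D}. disjointed (\<lambda>j. K \<inter> U (c j)) j) = (\<Union>j\<in>{0..<card D}. K \<inter> U (c j))"
      by (rule finite_UN_disjointed_eq)
    also have "\<dots> = K \<inter> (\<Union>g\<in>c ` {..<card D}. U g)"
      by (auto simp: atLeast0LessThan)
    also have "\<dots> = K"
      using D(3) by (auto simp: bij_betw_imp_surj_on[OF c])
    finally show "(\<Union>j<card D. disjointed (\<lambda>j. K \<inter> U (c j)) j) = K"
      by (simp add: atLeast0LessThan)
  next
    fix j h assume "j < card D" "h \<in> disjointed (\<lambda>j. K \<inter> U (c j)) j"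
    then show "L2_norm M (\<lambda>\<omega>. Y h \<omega> - Y (c j) \<omega>) \<le> e"
      using disjointed_subset[of "\<lambda>j. K \<inter> U (c j)" j] cD D(1) by (intro U(2)) blast+
  qed
qed

lemma continuous_on_compact_integrable:
  fixes f :: "'g::topological_space \<Rightarrow> 'b::{banach, second_countable_topology}"
  assumes "finite_measure \<nu>" "sets \<nu> = sets (restrict_space borel K)" "space \<nu> = K" "compact K"
    "continuous_on K f"
  shows "integrable \<nu> f"
proof -
  interpret finite_measure \<nu> by fact
  obtain B where "\<And>x. x \<in> K \<Longrightarrow> norm (f x) \<le> B"
    using compact_imp_bounded[OF compact_continuous_image[OF assms(5,4)]]
    by (auto simp: bounded_iff)
  moreover have "f \<in> borel_measurable \<nu>"
    using borel_measurable_continuous_on_restrict[OF assms(5)] measurable_cong_sets[OF assms(2) refl]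
    by blast
  ultimately show ?thesis
    using assms(3) by (intro integrable_const_bound[of _ B]) auto
qed

lemma L2_inner_continuous_on:
  assumes V: "L2_var M V" and Y: "\<And>g. g \<in> K \<Longrightarrow> L2_var M (Y g)"
    and cont: "\<And>g. g \<in> K \<Longrightarrow> ((\<lambda>h. L2_norm M (\<lambda>\<omega>. Y h \<omega> - Y g \<omega>)) \<longlongrightarrow> 0) (at g within K)"
  shows "continuous_on K (\<lambda>g. L2_inner M V (Y g))"
  unfolding continuous_on_def
proof
  fix g assume g: "g \<in> K"
  show "((\<lambda>h. L2_inner M V (Y h)) \<longlongrightarrow> L2_inner M V (Y g)) (at g within K)"
  proof (rule Lim_null_comparison[THEN LIM_zero_cancel])
    show "\<forall>\<^sub>F h in at g within K. norm (L2_inner M V (Y h) - L2_inner M V (Y g))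
        \<le> L2_norm M V * L2_norm M (\<lambda>\<omega>. Y h \<omega> - Y g \<omega>)"
      unfolding eventually_at_topological
      by (intro exI[of _ UNIV])
        (auto simp flip: L2_inner_diff_right[OF Y Y[OF g] V] intro!: L2_Cauchy_Schwarz V L2_var_diff Y g)
    show "((\<lambda>h. L2_norm M V * L2_norm M (\<lambda>\<omega>. Y h \<omega> - Y g \<omega>)) \<longlongrightarrow> 0) (at g within K)"
      using tendsto_mult_right_zero[OF cont[OF g]] by simp
  qed
qed

text \<open>The Riemann sums over finer and finer partitions form a Cauchy sequence because testing the difference of two of
  them against itself bounds its norm by the oscillations of the random function on the parts.\<close>

lemma L2_weak_integral:
  fixes K :: "'g::topological_space set" and Y :: "'g \<Rightarrow> 'w \<Rightarrow> complex"
  assumes \<nu>: "prob_space \<nu>" "sets \<nu> = sets (restrict_space borel K)" "space \<nu> = K" and K: "compact K"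
    and Y: "\<And>g. g \<in> K \<Longrightarrow> L2_var M (Y g)"
    and cont: "\<And>g. g \<in> K \<Longrightarrow> ((\<lambda>h. L2_norm M (\<lambda>\<omega>. Y h \<omega> - Y g \<omega>)) \<longlongrightarrow> 0) (at g within K)"
  obtains W where "L2_var M W" "\<And>V. L2_var M V \<Longrightarrow> L2_inner M V W = (LINT g|\<nu>. L2_inner M V (Y g))"
proof -
  interpret prob_space \<nu> by fact
  have int: "integrable \<nu> (\<lambda>g. L2_inner M V (Y g))" if "L2_var M V" for V
    by (rule continuous_on_compact_integrable[OF finite_measure_axioms \<nu>(2,3) K L2_inner_continuous_on])
      (use that Y cont in auto)
  \<comment> \<open>The error bound is uniform over the unit ball of test variables, so V may later
    be taken to be the difference of two of the approximations.\<close>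
  have "\<exists>W. L2_var M W \<and> (\<forall>V. L2_var M V \<longrightarrow>
    cmod (L2_inner M V W - (LINT g|\<nu>. L2_inner M V (Y g))) \<le> L2_norm M V * e)" if e: "0 < e" for e
  proof -
    obtain n :: nat and c and A where c: "\<And>j. j < n \<Longrightarrow> c j \<in> K"
      and A: "\<And>j. j < n \<Longrightarrow> A j \<in> sets (restrict_space borel K)"
      and disj: "disjoint_family_on A {..<n}" and un: "(\<Union>j<n. A j) = K"
      and osc: "\<And>j h. j < n \<Longrightarrow> h \<in> A j \<Longrightarrow> L2_norm M (\<lambda>\<omega>. Y h \<omega> - Y (c j) \<omega>) \<le> e"
      using compact_step_partition[OF K e cont] by blast
    define W where "W \<omega> = (\<Sum>j<n. of_real (measure \<nu> (A j)) * Y (c j) \<omega>)" for \<omega>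
    have W: "L2_var M W"
      unfolding W_def using c by (intro L2_var_sum L2_var_cmult Y) auto
    moreover have "cmod (L2_inner M V W - (LINT g|\<nu>. L2_inner M V (Y g))) \<le> L2_norm M V * e"
      if V: "L2_var M V" for V
    proof -
      have A': "A j \<in> sets \<nu>" if "j < n" for j using A \<nu>(2) that by auto
      define s where "s h = (\<Sum>j<n. indicator (A j) h *\<^sub>R L2_inner M V (Y (c j)))" for h
      have s_int: "integrable \<nu> s"
        unfolding s_def using A'
        by (intro Bochner_Integration.integrable_sum integrable_scaleR_left integrable_real_indicator)
          (auto simp: emeasure_eq_measure)
      have s_eq: "s h = L2_inner M V (Y (c j))" if "h \<in> A j" "j < n" for h j
      proof -
        have "s h = (\<Sum>i<n. if i = j then L2_inner M V (Y (c j)) else 0)"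
          unfolding s_def using that disj
          by (intro sum.cong) (auto simp: disjoint_family_on_def indicator_def)
        then show ?thesis using that by simp
      qed
      have "L2_inner M V W = (\<Sum>j<n. of_real (measure \<nu> (A j)) * L2_inner M V (Y (c j)))"
        unfolding W_def using c V
        by (subst L2_inner_sum_right) (auto simp: L2_inner_cmult_right intro!: Y)
      also have "\<dots> = (LINT h|\<nu>. s h)"
        unfolding s_def using A'
        by (subst Bochner_Integration.integral_sum)
          (auto simp: emeasure_eq_measure scaleR_conv_of_real sets.Int_space_eq2
            intro!: integrable_scaleR_left)
      finally have "L2_inner M V W - (LINT g|\<nu>. L2_inner M V (Y g)) = (LINT h|\<nu>. s h - L2_inner M V (Y h))"
        using s_int int[OF V] by simp
      also have "cmod \<dots> \<le> (LINT h|\<nu>. cmod (s h - L2_inner M V (Y h)))"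
        by (rule integral_norm_bound)
      also have "\<dots> \<le> (LINT h|\<nu>. L2_norm M V * e)"
      proof (rule integral_mono)
        show "integrable \<nu> (\<lambda>h. cmod (s h - L2_inner M V (Y h)))"
          using s_int int[OF V] by auto
        fix h assume "h \<in> space \<nu>"
        then obtain j where j: "j < n" "h \<in> A j" "h \<in> K" using un \<nu>(3) by auto
        have "cmod (s h - L2_inner M V (Y h)) = cmod (L2_inner M V (\<lambda>\<omega>. Y h \<omega> - Y (c j) \<omega>))"
          using j c by (simp add: s_eq[OF j(2,1)] L2_inner_diff_right[OF Y Y V] norm_minus_commute)
        also have "\<dots> \<le> L2_norm M V * L2_norm M (\<lambda>\<omega>. Y h \<omega> - Y (c j) \<omega>)"
          using j c V by (intro L2_Cauchy_Schwarz L2_var_diff Y) auto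
        also have "\<dots> \<le> L2_norm M V * e"
          using osc[OF j(1,2)] by (rule mult_left_mono) simp
        finally show "cmod (s h - L2_inner M V (Y h)) \<le> L2_norm M V * e" .
      qed simp
      finally show ?thesis by (simp add: prob_space)
    qed
    ultimately show ?thesis by blast
  qed
  then have "\<exists>W. \<forall>n::nat. L2_var M (W n) \<and> (\<forall>V. L2_var M V \<longrightarrow>
    cmod (L2_inner M V (W n) - (LINT g|\<nu>. L2_inner M V (Y g))) \<le> L2_norm M V * inverse (Suc n))"
    by (intro choice) simp
  then obtain W where W: "\<And>n::nat. L2_var M (W n)"
    and WV: "\<And>n V. L2_var M V \<Longrightarrow>
      cmod (L2_inner M V (W n) - (LINT g|\<nu>. L2_inner M V (Y g))) \<le> L2_norm M V * inverse (Suc n)"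
    by blast
  have diff: "L2_norm M (\<lambda>\<omega>. W m \<omega> - W n \<omega>) \<le> inverse (Suc m) + inverse (Suc n)" for m n
  proof -
    define V where "V = (\<lambda>\<omega>. W m \<omega> - W n \<omega>)"
    have V: "L2_var M V" unfolding V_def by (intro L2_var_diff W)
    have "(L2_norm M V)\<^sup>2 = cmod (L2_inner M V V)"
      by (simp add: L2_inner_self norm_power)
    also have "L2_inner M V V = L2_inner M V (W m) - L2_inner M V (W n)"
      using L2_inner_diff_right[OF W W V, of m n] unfolding V_def .
    also have "cmod \<dots> \<le> L2_norm M V * inverse (Suc m) + L2_norm M V * inverse (Suc n)"
      using norm_triangle_ineq4[of "L2_inner M V (W m) - (LINT g|\<nu>. L2_inner M V (Y g))"
        "L2_inner M V (W n) - (LINT g|\<nu>. L2_inner M V (Y g))"] WV[OF V, of m] WV[OF V, of n]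
      by simp
    finally have "L2_norm M V * L2_norm M V \<le> L2_norm M V * (inverse (Suc m) + inverse (Suc n))"
      by (simp add: power2_eq_square distrib_left)
    then have "L2_norm M V \<le> inverse (Suc m) + inverse (Suc n)"
      by (cases "L2_norm M V = 0") (auto simp: mult_le_cancel_left less_le intro!: add_nonneg_nonneg)
    then show ?thesis by (simp add: V_def)
  qed
  obtain W' where W': "L2_var M W'" and lim: "(\<lambda>n. L2_norm M (\<lambda>\<omega>. W n \<omega> - W' \<omega>)) \<longlonglongrightarrow> 0"
  proof (rule L2_complete[of M W])
    fix e :: real assume "0 < e"
    then obtain N where N: "inverse (Suc N) < e / 2"
      using reals_Archimedean[of "e/2"] by auto
    have "L2_norm M (\<lambda>\<omega>. W m \<omega> - W n \<omega>) \<le> e" if "m \<ge> N" "n \<ge> N" for m n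
    proof -
      have "inverse (Suc m) \<le> inverse (Suc N)" "inverse (Suc n) \<le> inverse (Suc N)"
        using that by (auto intro!: le_imp_inverse_le)
      then show ?thesis using diff[of m n] N by linarith
    qed
    then show "\<exists>N. \<forall>m\<ge>N. \<forall>n\<ge>N. L2_norm M (\<lambda>\<omega>. W m \<omega> - W n \<omega>) \<le> e" by blast
  qed (use W in auto)
  have "L2_inner M V W' = (LINT g|\<nu>. L2_inner M V (Y g))" if V: "L2_var M V" for V
  proof (rule LIMSEQ_unique)
    show "(\<lambda>n. L2_inner M V (W n)) \<longlonglongrightarrow> (LINT g|\<nu>. L2_inner M V (Y g))"
    proof (rule Lim_null_comparison[THEN LIM_zero_cancel])
      show "(\<lambda>n. L2_norm M V * inverse (real (Suc n))) \<longlonglongrightarrow> 0"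
        using tendsto_mult_right_zero[OF LIMSEQ_inverse_real_of_nat] by simp
    qed (use WV[OF V] in auto)
    show "(\<lambda>n. L2_inner M V (W n)) \<longlonglongrightarrow> L2_inner M V W'"
    proof (rule Lim_null_comparison[THEN LIM_zero_cancel])
      show "(\<lambda>n. L2_norm M V * L2_norm M (\<lambda>\<omega>. W n \<omega> - W' \<omega>)) \<longlonglongrightarrow> 0"
        using tendsto_mult_right_zero[OF lim] by simp
      show "\<forall>\<^sub>F n in sequentially. norm (L2_inner M V (W n) - L2_inner M V W')
          \<le> L2_norm M V * L2_norm M (\<lambda>\<omega>. W n \<omega> - W' \<omega>)"
        unfolding L2_inner_diff_right[OF W W' V, symmetric]
        by (intro always_eventually allI L2_Cauchy_Schwarz V L2_var_diff W W')
    qed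
  qed
  then show ?thesis using W' that by blast
qed

section \<open>The rotation group\<close>

lemma vector_3_lambda: "(vector [x, y, z] :: 'a::zero^3) = (\<chi> i. if i = 1 then x else if i = 2 then y else z)"
  by (simp add: vec_eq_iff forall_3)

lemma continuous_on_vector_3 [continuous_intros]:
  fixes f g h :: "'a::topological_space \<Rightarrow> 'b::{zero, topological_space}"
  assumes "continuous_on S f" "continuous_on S g" "continuous_on S h"
  shows "continuous_on S (\<lambda>x. vector [f x, g x, h x] :: 'b^3)"
  unfolding vector_3_lambda
proof (rule continuous_on_vec_lambda)
  show "continuous_on S (\<lambda>x. if i = 1 then f x else if i = 2 then g x else h x)" for i :: 3
    using assms by (cases "i = 1"; cases "i = 2") auto
qed

lemma rot_z_nth:
  "rot_z a $ 1 $ 1 = cos a" "rot_z a $ 1 $ 2 = - sin a" "rot_z a $ 1 $ 3 = 0"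
  "rot_z a $ 2 $ 1 = sin a" "rot_z a $ 2 $ 2 = cos a" "rot_z a $ 2 $ 3 = 0"
  "rot_z a $ 3 $ 1 = 0" "rot_z a $ 3 $ 2 = 0" "rot_z a $ 3 $ 3 = 1"
  by (simp_all add: rot_z_def)

lemma rot_x_nth:
  "rot_x a $ 1 $ 1 = 1" "rot_x a $ 1 $ 2 = 0" "rot_x a $ 1 $ 3 = 0"
  "rot_x a $ 2 $ 1 = 0" "rot_x a $ 2 $ 2 = cos a" "rot_x a $ 2 $ 3 = - sin a"
  "rot_x a $ 3 $ 1 = 0" "rot_x a $ 3 $ 2 = sin a" "rot_x a $ 3 $ 3 = cos a"
  by (simp_all add: rot_x_def)

lemmas matrix_3_simps = vec_eq_iff forall_3 matrix_matrix_mult_def sum_3 mat_def transpose_def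

lemma matrix_inv_unique:
  fixes A B :: "'a::semiring_1^'n^'n"
  assumes "A ** B = mat 1" "B ** A = mat 1"
  shows "matrix_inv A = B"
proof -
  let ?C = "matrix_inv A"
  have C: "A ** ?C = mat 1 \<and> ?C ** A = mat 1"
    unfolding matrix_inv_def by (rule someI[of _ B]) (use assms in simp)
  have "?C = ?C ** (A ** B)" using assms by simp
  also have "\<dots> = B" using C by (simp add: matrix_mul_assoc)
  finally show ?thesis .
qed

lemma SO3_iff: "g \<in> SO3 \<longleftrightarrow> transpose g ** g = mat 1 \<and> det g = 1"
  by (simp add: SO3_def rotation_matrix_def orthogonal_matrix)

lemma SO3_mult [intro]: "g \<in> SO3 \<Longrightarrow> h \<in> SO3 \<Longrightarrow> g ** h \<in> SO3"
  by (simp add: SO3_def rotation_matrix_def orthogonal_matrix_mul det_mul)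

lemma SO3_one [simp, intro]: "mat 1 \<in> SO3"
  by (simp add: SO3_def rotation_matrix_def orthogonal_matrix_id)

lemma SO3_transpose: "g \<in> SO3 \<Longrightarrow> transpose g \<in> SO3"
  by (simp add: SO3_def rotation_matrix_def)

lemma SO3_transpose_mult: "g \<in> SO3 \<Longrightarrow> transpose g ** g = mat 1" "g \<in> SO3 \<Longrightarrow> g ** transpose g = mat 1"
  by (simp_all add: SO3_def rotation_matrix_def orthogonal_matrix_def)

lemma SO3_matrix_inv: "g \<in> SO3 \<Longrightarrow> matrix_inv g = transpose g"
  by (rule matrix_inv_unique) (simp_all add: SO3_transpose_mult)

lemma SO3_inv [intro]: "g \<in> SO3 \<Longrightarrow> matrix_inv g \<in> SO3"
  by (simp add: SO3_matrix_inv SO3_transpose)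

lemma SO3_inv_mult [simp]:
  "g \<in> SO3 \<Longrightarrow> matrix_inv g ** g = mat 1" "g \<in> SO3 \<Longrightarrow> g ** matrix_inv g = mat 1"
  by (simp_all add: SO3_matrix_inv SO3_transpose_mult)

lemma rot_z_SO3 [simp, intro]: "rot_z a \<in> SO3"
  unfolding SO3_iff
  by (simp add: matrix_3_simps det_3 rot_z_nth flip: power2_eq_square)

lemma rot_x_SO3 [simp, intro]: "rot_x a \<in> SO3"
  unfolding SO3_iff
  by (simp add: matrix_3_simps det_3 rot_x_nth flip: power2_eq_square)

lemma euler_SO3 [simp, intro]: "euler a b c \<in> SO3"
  unfolding euler_def by (intro SO3_mult rot_z_SO3 rot_x_SO3)

lemma rot_z_add: "rot_z (a + b) = rot_z a ** rot_z b"
  by (simp add: matrix_3_simps rot_z_nth cos_add sin_add)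

lemma rot_x_add: "rot_x (a + b) = rot_x a ** rot_x b"
  by (simp add: matrix_3_simps rot_x_nth cos_add sin_add)

lemma rot_z_0 [simp]: "rot_z 0 = mat 1"
  by (simp add: matrix_3_simps rot_z_nth)

lemma rot_x_0 [simp]: "rot_x 0 = mat 1"
  by (simp add: matrix_3_simps rot_x_nth)

lemma rot_z_inv [simp]: "matrix_inv (rot_z a) = rot_z (- a)"
  by (rule matrix_inv_unique) (simp_all flip: rot_z_add)

lemma rot_x_inv [simp]: "matrix_inv (rot_x a) = rot_x (- a)"
  by (rule matrix_inv_unique) (simp_all flip: rot_x_add)

text \<open>This relation will make the diagonal matrix entries even in the angle; the next one will
  make those with nonzero index vanish at angle pi.\<close>

lemma rot_z_pi_rot_x: "rot_z pi ** rot_x a ** rot_z pi = rot_x (- a)"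
  by (simp add: matrix_3_simps rot_x_nth rot_z_nth)

lemma rot_x_pi_rot_z: "rot_x pi ** rot_z a = rot_z (- a) ** rot_x pi"
  by (simp add: matrix_3_simps rot_x_nth rot_z_nth)

lemma continuous_on_rot_x [continuous_intros]:
  fixes f :: "'a::t2_space \<Rightarrow> real"
  shows "continuous_on S f \<Longrightarrow> continuous_on S (\<lambda>t. rot_x (f t))"
  unfolding rot_x_def by (intro continuous_intros)

lemma continuous_on_rot_z [continuous_intros]:
  fixes f :: "'a::t2_space \<Rightarrow> real"
  shows "continuous_on S f \<Longrightarrow> continuous_on S (\<lambda>t. rot_z (f t))"
  unfolding rot_z_def by (intro continuous_intros)

lemma SO3_fixing_pole:
  assumes h: "h \<in> SO3" and "h $ 1 $ 3 = 0" "h $ 2 $ 3 = 0" "h $ 3 $ 3 = 1"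
  obtains b where "h = rot_z b"
proof -
  have c: "transpose h ** h = mat 1" and r: "h ** transpose h = mat 1" and d: "det h = 1"
    using h SO3_transpose_mult by (auto simp: SO3_iff)
  have "(h $ 3 $ 1)\<^sup>2 + (h $ 3 $ 2)\<^sup>2 + (h $ 3 $ 3)\<^sup>2 = 1"
    using r by (simp add: matrix_3_simps power2_eq_square)
  then have "(h $ 3 $ 1)\<^sup>2 + (h $ 3 $ 2)\<^sup>2 = 0"
    using assms by simp
  then have 3: "h $ 3 $ 1 = 0" "h $ 3 $ 2 = 0"
    by (simp_all add: sum_power2_eq_zero_iff)
  have 1: "(h $ 1 $ 1)\<^sup>2 + (h $ 2 $ 1)\<^sup>2 = 1" and 2: "h $ 1 $ 1 * h $ 1 $ 2 + h $ 2 $ 1 * h $ 2 $ 2 = 0"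
    using c 3 by (auto simp: matrix_3_simps power2_eq_square)
  have 4: "h $ 1 $ 1 * h $ 2 $ 2 - h $ 1 $ 2 * h $ 2 $ 1 = 1"
    using d assms 3 by (simp add: det_3)
  \<comment> \<open>In the upper left block the second column is orthogonal to the unit first
    column, hence a multiple of it turned by a right angle; the determinant makes the multiple
    1.\<close>
  have 5: "h $ 1 $ 1 = h $ 2 $ 2"
    using 1 2 4 by algebra
  have 6: "h $ 1 $ 2 = - h $ 2 $ 1"
    using 1 2 4 by algebra
  obtain b where "h $ 1 $ 1 = cos b" "h $ 2 $ 1 = sin b"
    using sincos_total_2pi[OF 1] by metis
  then have "h = rot_z b"
    using assms 3 5 6 by (simp add: matrix_3_simps rot_z_nth)
  then show ?thesis by (rule that)
qed

text \<open>The third column of \<open>euler a t b\<close>, the image of the pole, is (sin t sin a,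
  - sin t cos a, cos t). It determines t and, away from the poles, a. Undoing these two rotations
  leaves one that fixes the pole.\<close>

lemma SO3_euler:
  assumes g: "g \<in> SO3"
  obtains a t b where "0 \<le> t" "t \<le> pi" "g = euler a t b"
proof -
  have "transpose g ** g = mat 1" using g by (simp add: SO3_iff)
  then have unit: "(g $ 1 $ 3)\<^sup>2 + (g $ 2 $ 3)\<^sup>2 + (g $ 3 $ 3)\<^sup>2 = 1"
    by (simp add: matrix_3_simps power2_eq_square)
  then have "(g $ 3 $ 3)\<^sup>2 \<le> 1"
    by (smt (verit) zero_le_power2)
  then have bd: "-1 \<le> g $ 3 $ 3" "g $ 3 $ 3 \<le> 1"
    by (auto simp: abs_square_le_1 abs_le_iff)
  define t where "t = arccos (g $ 3 $ 3)"
  have t: "0 \<le> t" "t \<le> pi" "cos t = g $ 3 $ 3" "0 \<le> sin t"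
    using bd by (auto simp: t_def arccos_lbound arccos_ubound cos_arccos intro!: sin_ge_zero)
  have st: "(g $ 1 $ 3)\<^sup>2 + (g $ 2 $ 3)\<^sup>2 = (sin t)\<^sup>2"
    using unit t(3) sin_squared_eq[of t] by simp
  obtain a where a: "g $ 1 $ 3 = sin t * sin a" "g $ 2 $ 3 = - sin t * cos a"
  proof (cases "sin t = 0")
    case True
    with st have "g $ 1 $ 3 = 0" "g $ 2 $ 3 = 0"
      by (simp_all add: sum_power2_eq_zero_iff)
    with True that show ?thesis by simp
  next
    case False
    have "(- g $ 2 $ 3 / sin t)\<^sup>2 + (g $ 1 $ 3 / sin t)\<^sup>2 = 1"
      using st False by (simp add: power_divide add_divide_distrib[symmetric] add.commute)
    then obtain a where "- g $ 2 $ 3 / sin t = cos a" "g $ 1 $ 3 / sin t = sin a"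
      using sincos_total_2pi by metis
    with False show ?thesis by (intro that[of a]) (auto simp: field_simps)
  qed
  define h where "h = rot_x (- t) ** (rot_z (- a) ** g)"
  have hS: "h \<in> SO3" unfolding h_def by (intro SO3_mult rot_x_SO3 rot_z_SO3 g)
  have sc: "(sin t)\<^sup>2 + (cos t)\<^sup>2 = 1" "(sin a)\<^sup>2 + (cos a)\<^sup>2 = 1" by simp_all
  obtain b where "h = rot_z b"
  proof (rule SO3_fixing_pole[OF hS])
    show "h $ 1 $ 3 = 0"
      unfolding h_def by (simp add: matrix_matrix_mult_def sum_3 rot_x_nth rot_z_nth a)
    show "h $ 2 $ 3 = 0"
      unfolding h_def
      apply (simp add: matrix_matrix_mult_def sum_3 rot_x_nth rot_z_nth a t(3)[symmetric])
      using sc by algebra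
    show "h $ 3 $ 3 = 1"
      unfolding h_def
      apply (simp add: matrix_matrix_mult_def sum_3 rot_x_nth rot_z_nth a t(3)[symmetric])
      using sc by algebra
  qed
  moreover have "g = rot_z a ** (rot_x t ** h)"
  proof -
    have "rot_x t ** h = rot_z (- a) ** g"
      unfolding h_def matrix_mul_assoc by (simp flip: rot_x_add)
    then show ?thesis
      by (simp add: matrix_mul_assoc flip: rot_z_add)
  qed
  ultimately have "g = euler a t b" by (simp add: euler_def matrix_mul_assoc)
  with t show ?thesis by (intro that)
qed

section \<open>Haar measure on the rotation group\<close>

lemma vector_4_nth:
  "(vector [w, x, y, z] :: 'a::zero^4) $ 1 = w" "(vector [w, x, y, z] :: 'a::zero^4) $ 2 = x"
  "(vector [w, x, y, z] :: 'a::zero^4) $ 3 = y" "(vector [w, x, y, z] :: 'a::zero^4) $ 4 = z"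
  by (simp_all add: vector_def)

text \<open>\<open>quat_matrix q\<close> is the matrix of \<open>v \<mapsto> q v q'\<close>, \<open>q'\<close> the conjugate of \<open>q\<close>, on purely imaginary
  quaternions. Haar measure is the image of the uniform distribution on the unit ball of quaternions, on
  which left multiplication by a unit quaternion is an orthogonal map.\<close>

definition quat_mult :: "real^4 \<Rightarrow> real^4 \<Rightarrow> real^4" where
  "quat_mult p q = vector
    [p$1 * q$1 - p$2 * q$2 - p$3 * q$3 - p$4 * q$4,
     p$1 * q$2 + p$2 * q$1 + p$3 * q$4 - p$4 * q$3,
     p$1 * q$3 - p$2 * q$4 + p$3 * q$1 + p$4 * q$2,
     p$1 * q$4 + p$2 * q$3 - p$3 * q$2 + p$4 * q$1]"

definition quat_matrix :: "real^4 \<Rightarrow> real^3^3" where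
  "quat_matrix q = vector
    [vector [(q$1)\<^sup>2 + (q$2)\<^sup>2 - (q$3)\<^sup>2 - (q$4)\<^sup>2, 2 * (q$2 * q$3 - q$1 * q$4), 2 * (q$2 * q$4 + q$1 * q$3)],
     vector [2 * (q$2 * q$3 + q$1 * q$4), (q$1)\<^sup>2 - (q$2)\<^sup>2 + (q$3)\<^sup>2 - (q$4)\<^sup>2, 2 * (q$3 * q$4 - q$1 * q$2)],
     vector [2 * (q$2 * q$4 - q$1 * q$3), 2 * (q$3 * q$4 + q$1 * q$2), (q$1)\<^sup>2 - (q$2)\<^sup>2 - (q$3)\<^sup>2 + (q$4)\<^sup>2]]"

lemma norm_square_4: "(norm q)\<^sup>2 = (q$1)\<^sup>2 + (q$2)\<^sup>2 + (q$3)\<^sup>2 + (q$4)\<^sup>2" for q :: "real^4"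
  unfolding power2_norm_eq_inner by (simp add: inner_vec_def sum_4 power2_eq_square)

lemma quat_matrix_mult: "quat_matrix (quat_mult p q) = quat_matrix p ** quat_matrix q"
  by (simp add: matrix_3_simps quat_matrix_def quat_mult_def vector_4_nth)
    (intro conjI; algebra)

lemma norm_quat_mult: "norm (quat_mult p q) = norm p * norm q"
proof (rule power2_eq_imp_eq)
  show "(norm (quat_mult p q))\<^sup>2 = (norm p * norm q)\<^sup>2"
    unfolding power_mult_distrib norm_square_4 by (simp add: quat_mult_def vector_4_nth) algebra
qed auto

lemma linear_quat_mult: "linear (quat_mult p)"
  by (rule linearI)
    (simp_all add: vec_eq_iff forall_4 quat_mult_def vector_4_nth algebra_simps)

lemma quat_matrix_SO3:
  assumes "norm q = 1" shows "quat_matrix q \<in> SO3"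
proof -
  have n: "(q$1)\<^sup>2 + (q$2)\<^sup>2 + (q$3)\<^sup>2 + (q$4)\<^sup>2 = 1" using assms norm_square_4[of q] by simp
  have "transpose (quat_matrix q) ** quat_matrix q = mat (((q$1)\<^sup>2 + (q$2)\<^sup>2 + (q$3)\<^sup>2 + (q$4)\<^sup>2)\<^sup>2)"
    by (simp add: matrix_3_simps quat_matrix_def) (intro conjI; algebra)
  then have "transpose (quat_matrix q) ** quat_matrix q = mat 1"
    by (simp add: n)
  moreover have "det (quat_matrix q) = ((q$1)\<^sup>2 + (q$2)\<^sup>2 + (q$3)\<^sup>2 + (q$4)\<^sup>2)^3"
    by (simp add: det_3 quat_matrix_def) algebra
  then have "det (quat_matrix q) = 1"
    by (simp add: n)
  ultimately show ?thesis by (simp add: SO3_iff)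
qed

text \<open>Euler angles reduce surjectivity to rotations about a coordinate axis, which come from
  quaternions of half the angle.\<close>

lemma SO3_quat_matrix:
  assumes "g \<in> SO3"
  obtains q where "norm q = 1" "quat_matrix q = g"
proof -
  have z: "\<exists>q. norm q = 1 \<and> quat_matrix q = rot_z a" for a
  proof (intro exI conjI)
    let ?q = "vector [cos (a/2), 0, 0, sin (a/2)] :: real^4"
    have "(norm ?q)\<^sup>2 = 1" unfolding norm_square_4 by (simp add: vector_4_nth)
    then show "norm ?q = 1" by (simp add: power2_eq_1_iff) (smt (verit) norm_ge_zero)
    have "cos a = (cos (a/2))\<^sup>2 - (sin (a/2))\<^sup>2" "sin a = 2 * sin (a/2) * cos (a/2)" "(sin (a/2))\<^sup>2 + (cos (a/2))\<^sup>2 = 1"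
      using cos_double[of "a/2"] sin_double[of "a/2"] by simp_all
    then show "quat_matrix ?q = rot_z a"
      by (simp add: matrix_3_simps quat_matrix_def rot_z_nth vector_4_nth)
  qed
  have x: "\<exists>q. norm q = 1 \<and> quat_matrix q = rot_x a" for a
  proof (intro exI conjI)
    let ?q = "vector [cos (a/2), sin (a/2), 0, 0] :: real^4"
    have "(norm ?q)\<^sup>2 = 1" unfolding norm_square_4 by (simp add: vector_4_nth)
    then show "norm ?q = 1" by (simp add: power2_eq_1_iff) (smt (verit) norm_ge_zero)
    have "cos a = (cos (a/2))\<^sup>2 - (sin (a/2))\<^sup>2" "sin a = 2 * sin (a/2) * cos (a/2)" "(sin (a/2))\<^sup>2 + (cos (a/2))\<^sup>2 = 1"
      using cos_double[of "a/2"] sin_double[of "a/2"] by simp_all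
    then show "quat_matrix ?q = rot_x a"
      by (simp add: matrix_3_simps quat_matrix_def rot_x_nth vector_4_nth)
  qed
  obtain a t b where "g = euler a t b" by (rule SO3_euler[OF assms])
  moreover obtain p q r where "norm p = 1" "quat_matrix p = rot_z a" "norm q = 1" "quat_matrix q = rot_x t"
    "norm r = 1" "quat_matrix r = rot_z b" using x z by metis
  ultimately show ?thesis
    by (intro that[of "quat_mult (quat_mult p q) r"]) (simp_all add: norm_quat_mult quat_matrix_mult euler_def)
qed

lemma continuous_on_quat_matrix: "continuous_on S quat_matrix"
  unfolding quat_matrix_def by (intro continuous_intros)

lemma compact_SO3: "compact SO3"
proof -
  have "SO3 = quat_matrix ` sphere 0 1"
  proof (intro set_eqI iffI)
    fix g assume "g \<in> SO3"
    then obtain q where "norm q = 1" "quat_matrix q = g" by (rule SO3_quat_matrix)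
    then show "g \<in> quat_matrix ` sphere 0 1" by auto
  qed (auto intro: quat_matrix_SO3)
  then show ?thesis
    using compact_continuous_image[OF continuous_on_quat_matrix compact_sphere] by metis
qed

text \<open>The rotation of the normalized quaternion. Working on the ball instead of the sphere
  allows Lebesgue measure to be used in place of surface measure; the value at 0 keeps the map total
  with values in \<open>SO3\<close>.\<close>

definition quat_rotation :: "real^4 \<Rightarrow> real^3^3" where
  "quat_rotation q = (if q = 0 then mat 1 else (1 / (norm q)\<^sup>2) *\<^sub>R quat_matrix q)"

definition haar :: "(real^3^3) measure" where
  "haar = distr (uniform_measure lborel (ball 0 1)) (restrict_space borel SO3) quat_rotation"

lemma quat_rotation_SO3: "quat_rotation q \<in> SO3"
proof (cases "q = 0")
  case False
  have "quat_rotation q = quat_matrix ((1 / norm q) *\<^sub>R q)"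
    using False unfolding quat_rotation_def quat_matrix_def
    by (simp add: vec_eq_iff forall_3 power2_eq_square field_simps)
  then show ?thesis
    using False by (simp add: quat_matrix_SO3)
qed (simp add: quat_rotation_def)

lemma quat_rotation_mult:
  assumes "norm p = 1" "q \<noteq> 0"
  shows "quat_rotation (quat_mult p q) = quat_matrix p ** quat_rotation q"
proof -
  have "norm (quat_mult p q) = norm q" "quat_mult p q \<noteq> 0"
    using norm_quat_mult[of p q] assms by auto
  then have "quat_rotation (quat_mult p q) = (1 / (norm q)\<^sup>2) *\<^sub>R (quat_matrix p ** quat_matrix q)"
    by (simp add: quat_rotation_def quat_matrix_mult)
  also have "\<dots> = quat_matrix p ** ((1 / (norm q)\<^sup>2) *\<^sub>R quat_matrix q)"
    by (simp add: vec_eq_iff matrix_matrix_mult_def sum_divide_distrib)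
  finally show ?thesis
    using assms by (simp add: quat_rotation_def)
qed

lemma quat_rotation_measurable [measurable]: "quat_rotation \<in> borel \<rightarrow>\<^sub>M restrict_space borel SO3"
proof (rule measurable_restrict_space2)
  have [measurable]: "quat_matrix \<in> borel \<rightarrow>\<^sub>M borel"
    by (intro borel_measurable_continuous_onI continuous_on_quat_matrix)
  show "quat_rotation \<in> borel \<rightarrow>\<^sub>M borel"
    unfolding quat_rotation_def by measurable
qed (simp add: quat_rotation_SO3)

lemma space_haar [simp]: "space haar = SO3"
  by (simp add: haar_def space_restrict_space)

lemma sets_haar: "sets haar = sets (restrict_space borel SO3)"
  by (simp add: haar_def)

section \<open>Invariance and strict positivity of Haar measure\<close>

lemma prob_space_unit_ball: "prob_space (uniform_measure lborel (ball (0::real^4) 1))"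
  using content_ball_pos[of 1 "0::real^4"] emeasure_lborel_ball_finite[of "0::real^4" 1]
  by (intro prob_space_uniform_measure) (auto simp: emeasure_eq_measure2 measure_def less_top)

lemma prob_space_haar: "prob_space haar"
  unfolding haar_def by (intro prob_space.prob_space_distr prob_space_unit_ball) simp

lemma distr_quat_mult_unit_ball:
  assumes "norm p = 1"
  shows "distr (uniform_measure lborel (ball 0 1)) borel (quat_mult p) = uniform_measure lborel (ball 0 1)"
proof (rule measure_eqI)
  have orth: "orthogonal_transformation (quat_mult p)"
    using assms by (simp add: orthogonal_transformation linear_quat_mult norm_quat_mult)
  have m [measurable]: "quat_mult p \<in> borel \<rightarrow>\<^sub>M borel"
    by (intro borel_measurable_continuous_onI linear_continuous_on linear_conv_bounded_linear[THEN iffD1] linear_quat_mult)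
  fix A assume "A \<in> sets (distr (uniform_measure lborel (ball (0::real^4) 1)) borel (quat_mult p))"
  then have A [measurable]: "A \<in> sets borel" by simp
  define B where "B = ball 0 1 \<inter> quat_mult p -` A"
  have B: "B \<in> sets borel" unfolding B_def using measurable_sets_borel[OF m A] by auto
  have im: "quat_mult p ` B = ball 0 1 \<inter> A"
  proof (intro set_eqI iffI)
    fix x assume x: "x \<in> ball 0 1 \<inter> A"
    obtain y where "x = quat_mult p y"
      using orthogonal_transformation_surj[OF orth] by (metis surjD)
    with x show "x \<in> quat_mult p ` B"
      using norm_quat_mult[of p y] assms by (auto simp: B_def)
  qed (use assms in \<open>auto simp: B_def norm_quat_mult\<close>)
  \<comment> \<open>The theorem on orthogonal images concerns sets of finite Lebesgue measure, hence
    the intersection with the ball.\<close>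
  have BL: "B \<in> lmeasurable"
  proof (rule bounded_set_imp_lmeasurable)
    show "bounded B" by (rule bounded_subset[OF bounded_ball]) (auto simp: B_def)
  qed (use B in auto)
  have bd: "emeasure lborel S < \<infinity>" if "S \<subseteq> ball (0::real^4) 1" "S \<in> sets borel" for S
    using emeasure_mono[of S "ball (0::real^4) 1" lborel] that emeasure_lborel_ball_finite[of "0::real^4" 1]
    by (auto simp: less_top[symmetric] top_unique)
  have "measure lborel B = measure lborel (ball 0 1 \<inter> A)"
    using measure_orthogonal_image[OF orth BL] B A unfolding im by (simp add: measure_completion)
  then have "emeasure lborel B = emeasure lborel (ball 0 1 \<inter> A)"
    using bd[of B] bd[of "ball 0 1 \<inter> A"] B A
    by (subst (1 2) emeasure_eq_ennreal_measure) (auto simp: B_def)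
  then show "emeasure (distr (uniform_measure lborel (ball 0 1)) borel (quat_mult p)) A =
      emeasure (uniform_measure lborel (ball 0 1)) A"
    using measurable_sets_borel[OF m A]
    by (simp add: emeasure_distr B_def)
qed simp

lemma continuous_on_matrix_mult_left: "continuous_on S (\<lambda>g. h ** g)" for h :: "real^'n^'m"
  unfolding matrix_matrix_mult_def by (intro continuous_intros)

lemma SO3_mult_measurable:
  assumes "h \<in> SO3"
  shows "(\<lambda>g. h ** g) \<in> restrict_space borel SO3 \<rightarrow>\<^sub>M restrict_space borel SO3"
proof (rule measurable_restrict_space2)
  show "(\<lambda>g. h ** g) \<in> restrict_space borel SO3 \<rightarrow>\<^sub>M borel"
    by (intro borel_measurable_continuous_on_restrict continuous_on_matrix_mult_left)
qed (use assms in \<open>auto simp: space_restrict_space\<close>)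

lemma distr_haar_mult:
  assumes "h \<in> SO3"
  shows "distr haar (restrict_space borel SO3) (\<lambda>g. h ** g) = haar"
proof -
  let ?U = "uniform_measure lborel (ball (0::real^4) 1)" and ?G = "restrict_space borel SO3"
  obtain p where p: "norm p = 1" "quat_matrix p = h" using assms by (rule SO3_quat_matrix)
  have m [measurable]: "quat_mult p \<in> borel \<rightarrow>\<^sub>M borel"
    by (intro borel_measurable_continuous_onI linear_continuous_on linear_conv_bounded_linear[THEN iffD1] linear_quat_mult)
  have [measurable]: "quat_rotation \<in> ?U \<rightarrow>\<^sub>M ?G"
    using quat_rotation_measurable by (simp cong: measurable_cong_sets)
  note [measurable] = SO3_mult_measurable[OF assms]
  \<comment> \<open>\<open>quat_rotation\<close> is multiplicative only away from the origin, which
    is a null set.\<close>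
  have "AE q in lborel. q \<noteq> (0 :: real^4)" by (rule AE_lborel_singleton)
  then have ae: "AE q in ?U. q \<noteq> 0"
    by (intro AE_uniform_measureI) auto
  have "distr haar ?G (\<lambda>g. h ** g) = distr ?U ?G (\<lambda>q. h ** quat_rotation q)"
    unfolding haar_def by (subst distr_distr) (auto simp: comp_def)
  also have "\<dots> = distr ?U ?G (quat_rotation \<circ> quat_mult p)"
  proof (rule distr_cong_AE)
    show "AE q in ?U. h ** quat_rotation q = (quat_rotation \<circ> quat_mult p) q"
      using ae by eventually_elim (simp add: quat_rotation_mult p)
  qed auto
  also have "\<dots> = distr (distr ?U borel (quat_mult p)) ?G quat_rotation"
    by (subst distr_distr) auto
  also have "\<dots> = haar"
    unfolding distr_quat_mult_unit_ball[OF p(1)] haar_def ..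
  finally show ?thesis .
qed

lemma haar_integral_mult_left:
  fixes f :: "real^3^3 \<Rightarrow> 'b::{banach, second_countable_topology}"
  assumes "h \<in> SO3" "f \<in> borel_measurable haar"
  shows "(LINT g|haar. f (h ** g)) = (LINT g|haar. f g)"
proof -
  have "(LINT g|haar. f g) = (LINT g|distr haar (restrict_space borel SO3) (\<lambda>g. h ** g). f g)"
    using distr_haar_mult[OF assms(1)] by simp
  also have "\<dots> = (LINT g|haar. f (h ** g))"
    using SO3_mult_measurable[OF assms(1)] assms(2)
    by (intro integral_distr) (auto simp: sets_haar cong: measurable_cong_sets)
  finally show ?thesis ..
qed

lemma haar_integrable:
  fixes f :: "real^3^3 \<Rightarrow> 'b::{banach, second_countable_topology}"
  shows "continuous_on SO3 f \<Longrightarrow> integrable haar f"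
  using prob_space_haar
  by (intro continuous_on_compact_integrable[OF _ sets_haar space_haar compact_SO3])
    (simp_all add: prob_space_def)

lemma haar_integral_left:
  fixes f :: "real^3^3 \<Rightarrow> 'b::{banach, second_countable_topology}"
  assumes "h \<in> SO3" "continuous_on SO3 f"
  shows "(LINT g|haar. f (h ** g)) = (LINT g|haar. f g)"
  by (rule haar_integral_mult_left[OF assms(1) borel_measurable_integrable[OF haar_integrable[OF assms(2)]]])

lemma haar_integral_cong:
  "(\<And>g. g \<in> SO3 \<Longrightarrow> f g = f' g) \<Longrightarrow> (LINT g|haar. f g) = (LINT g|haar. f' g)"
  by (rule Bochner_Integration.integral_cong) simp_all

lemma measure_haar_SO3 [simp]: "measure haar SO3 = 1"
  using prob_space.prob_space[OF prob_space_haar] by simp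

lemma continuous_on_SO3_translate:
  assumes "h \<in> SO3" "continuous_on SO3 f"
  shows "continuous_on SO3 (\<lambda>g. f (h ** g))"
  using assms by (intro continuous_on_compose2[OF assms(2) continuous_on_matrix_mult_left]) auto

text \<open>If \<open>f\<close> is positive somewhere, then the sum of finitely many translates of \<open>f\<close> is bounded
  below by a positive constant, by compactness.\<close>

lemma haar_integral_eq_0:
  fixes f :: "real^3^3 \<Rightarrow> real" and g0 :: "real^3^3"
  assumes f: "continuous_on SO3 f" "\<And>g. g \<in> SO3 \<Longrightarrow> 0 \<le> f g" and 0: "(LINT g|haar. f g) = 0"
    and g0: "g0 \<in> SO3"
  shows "f g0 = 0"
proof (rule ccontr)
  assume "f g0 \<noteq> 0"
  with f(2)[OF g0] have pos: "0 < f g0" by simp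
  \<comment> \<open>Left multiplication by \<open>h g\<close> moves g to g0, so the translate of f
    by it takes the positive value f g0 at g.\<close>
  define h where "h g = g0 ** transpose g" for g :: "real^3^3"
  have h: "h g \<in> SO3" if "g \<in> SO3" for g
    using that g0 by (auto simp: h_def SO3_transpose)
  have "\<exists>U. open U \<and> (\<forall>x\<in>SO3. x \<in> U \<longleftrightarrow> f (h g ** x) > f g0 / 2)" if "g \<in> SO3" for g
  proof -
    have "openin (top_of_set SO3) (SO3 \<inter> (\<lambda>x. f (h g ** x)) -` {f g0 / 2<..})"
      by (intro continuous_openin_preimage_gen continuous_on_SO3_translate h that f) simp
    then obtain U where "open U" "SO3 \<inter> (\<lambda>x. f (h g ** x)) -` {f g0 / 2<..} = SO3 \<inter> U"
      unfolding openin_open by blast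
    then show ?thesis by (intro exI[of _ U]) auto
  qed
  then obtain U where U: "\<And>g. g \<in> SO3 \<Longrightarrow> open (U g)"
    "\<And>g x. g \<in> SO3 \<Longrightarrow> x \<in> SO3 \<Longrightarrow> x \<in> U g \<longleftrightarrow> f (h g ** x) > f g0 / 2"
    by metis
  have "x \<in> U x" if "x \<in> SO3" for x
    using pos that by (simp add: U(2)[OF that that] h_def SO3_transpose_mult flip: matrix_mul_assoc)
  then have "SO3 \<subseteq> (\<Union>g\<in>SO3. U g)" by blast
  from compactE_image[OF compact_SO3 U(1) this]
  obtain D where D: "D \<subseteq> SO3" "finite D" "SO3 \<subseteq> (\<Union>g\<in>D. U g)"
    by metis
  have int: "integrable haar (\<lambda>x. f (h g ** x))" if "g \<in> D" for g
    using that D(1) by (intro haar_integrable continuous_on_SO3_translate h f) auto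
  have "f g0 / 2 = (LINT x|haar. f g0 / 2)" by simp
  also have "\<dots> \<le> (LINT x|haar. (\<Sum>g\<in>D. f (h g ** x)))"
  proof (rule integral_mono)
    fix x assume "x \<in> space haar"
    then have x: "x \<in> SO3" by simp
    then obtain g where g: "g \<in> D" "x \<in> U g" using D(3) by blast
    have "f g0 / 2 \<le> f (h g ** x)" using U(2)[of g x] g D(1) x by auto
    also have "\<dots> \<le> (\<Sum>g\<in>D. f (h g ** x))"
      using g D x h by (intro member_le_sum f(2)) auto
    finally show "f g0 / 2 \<le> (\<Sum>g\<in>D. f (h g ** x))" .
  qed (use int prob_space_haar in \<open>auto intro!: haar_integrable\<close>)
  also have "\<dots> = (\<Sum>g\<in>D. LINT x|haar. f (h g ** x))"
    using int by (rule Bochner_Integration.integral_sum)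
  also have "\<dots> = 0"
    using D(1) h by (intro sum.neutral ballI) (simp add: haar_integral_left[OF _ f(1)] subset_iff 0)
  finally show False using pos by simp
qed

section \<open>Schur orthogonality\<close>

lemma double_plus_1_neq_0: "2 * of_nat l + 1 \<noteq> (0 :: complex)"
  using of_nat_neq_0[of "2 * l", where 'a=complex] by (simp add: add.commute)

locale irrep =
  fixes l :: nat and T :: "int \<Rightarrow> int \<Rightarrow> real^3^3 \<Rightarrow> complex"
  assumes canonical: "canonical_irrep l T"
begin

lemma outside: "int l < \<bar>m\<bar> \<or> int l < \<bar>n\<bar> \<Longrightarrow> T m n g = 0"
  using canonical by (auto simp: canonical_irrep_def)

lemma mult: "g \<in> SO3 \<Longrightarrow> h \<in> SO3 \<Longrightarrow> T m n (g ** h) = (\<Sum>s = - int l..int l. T m s g * T s n h)"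
  using canonical by (simp add: canonical_irrep_def)

lemma rows_orthonormal: "g \<in> SO3 \<Longrightarrow> \<bar>m\<bar> \<le> int l \<Longrightarrow> \<bar>n\<bar> \<le> int l \<Longrightarrow>
    (\<Sum>s = - int l..int l. T m s g * cnj (T n s g)) = (if m = n then 1 else 0)"
  using canonical by (auto simp: canonical_irrep_def abs_le_iff)

lemma cont: "continuous_on SO3 (T m n)"
  using canonical by (simp add: canonical_irrep_def)

lemma irreducible: "invariant_subspace l T V \<Longrightarrow> V = {\<lambda>_. 0} \<or> V = weight_space l"
  using canonical by (simp add: canonical_irrep_def irreducible_rep_def)

lemma rot_z: "T m n (rot_z a) = (if m = n \<and> \<bar>m\<bar> \<le> int l then cis (- (of_int n * a)) else 0)"
proof (cases "\<bar>m\<bar> \<le> int l \<and> \<bar>n\<bar> \<le> int l")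
  case True
  then have "m \<in> {- int l..int l}" "n \<in> {- int l..int l}" by auto
  then show ?thesis using True canonical by (simp add: canonical_irrep_def)
qed (auto simp: outside not_le)

lemma one: "T m n (mat 1) = (if m = n \<and> \<bar>m\<bar> \<le> int l then 1 else 0)"
  using rot_z[of m n 0] by auto

lemma rot_z_mult_left:
  assumes "g \<in> SO3" shows "T m n (rot_z a ** g) = cis (- (of_int m * a)) * T m n g"
proof (cases "\<bar>m\<bar> \<le> int l")
  case True
  then have "T m n (rot_z a ** g) = (\<Sum>s = - int l..int l. if s = m then cis (- (of_int m * a)) * T m n g else 0)"
    unfolding mult[OF rot_z_SO3 assms] by (intro sum.cong) (auto simp: rot_z)
  then show ?thesis using True by auto
qed (simp add: outside)

lemma rot_z_mult_right:
  assumes "g \<in> SO3" shows "T m n (g ** rot_z a) = T m n g * cis (- (of_int n * a))"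
proof (cases "\<bar>n\<bar> \<le> int l")
  case True
  then have "T m n (g ** rot_z a) = (\<Sum>s = - int l..int l. if s = n then T m n g * cis (- (of_int n * a)) else 0)"
    unfolding mult[OF assms rot_z_SO3] by (intro sum.cong) (auto simp: rot_z)
  then show ?thesis using True by auto
qed (simp add: outside)

lemma euler: "T m n (euler a t b) = cis (- (of_int m * a)) * T m n (rot_x t) * cis (- (of_int n * b))"
  unfolding euler_def by (simp add: rot_z_mult_left rot_z_mult_right SO3_mult)

lemma inv:
  assumes g: "g \<in> SO3" shows "T m n (matrix_inv g) = cnj (T n m g)"
proof (cases "\<bar>m\<bar> \<le> int l \<and> \<bar>n\<bar> \<le> int l")
  case True
  let ?I = "{- int l..int l}"
  \<comment> \<open>Insert the identity matrix as T(g) times its adjoint on the right, then let the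
    inverse cancel T(g); only the adjoint remains.\<close>
  have "T m n (matrix_inv g) = (\<Sum>k\<in>?I. if k = n then T m n (matrix_inv g) else 0)"
    using True by auto
  also have "\<dots> = (\<Sum>k\<in>?I. T m k (matrix_inv g) * (\<Sum>s\<in>?I. T k s g * cnj (T n s g)))"
    using True by (intro sum.cong) (auto simp: rows_orthonormal[OF g] abs_le_iff)
  also have "\<dots> = (\<Sum>s\<in>?I. (\<Sum>k\<in>?I. T m k (matrix_inv g) * T k s g) * cnj (T n s g))"
    unfolding sum_distrib_left sum_distrib_right by (subst sum.swap) (simp add: mult.assoc)
  also have "\<dots> = (\<Sum>s\<in>?I. T m s (mat 1) * cnj (T n s g))"
    using g by (simp flip: mult add: SO3_inv)
  also have "\<dots> = (\<Sum>s\<in>?I. if s = m then cnj (T n m g) else 0)"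
    using True by (intro sum.cong) (auto simp: one)
  also have "\<dots> = cnj (T n m g)" using True by auto
  finally show ?thesis .
qed (auto simp: outside not_le)

lemma columns_normalized:
  assumes g: "g \<in> SO3" and n: "\<bar>n\<bar> \<le> int l"
  shows "(\<Sum>s = - int l..int l. T s n g * cnj (T s n g)) = 1"
  using rows_orthonormal[OF SO3_inv[OF g] n n] by (simp add: inv[OF g] mult.commute)

lemma norm_le_1:
  assumes g: "g \<in> SO3" shows "cmod (T m n g) \<le> 1"
proof (cases "\<bar>m\<bar> \<le> int l \<and> \<bar>n\<bar> \<le> int l")
  case True
  have "complex_of_real (\<Sum>s = - int l..int l. (cmod (T m s g))\<^sup>2) = 1"
    using rows_orthonormal[OF g, of m m] True by (simp add: complex_norm_square[symmetric])
  then have "(\<Sum>s = - int l..int l. (cmod (T m s g))\<^sup>2) = 1"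
    using of_real_eq_1_iff by blast
  moreover have "(cmod (T m n g))\<^sup>2 \<le> (\<Sum>s = - int l..int l. (cmod (T m s g))\<^sup>2)"
    using True by (intro member_le_sum) auto
  ultimately show ?thesis by (simp add: abs_square_le_1)
qed (auto simp: outside not_le)

lemma unit_vector_weight_space: "\<bar>k\<bar> \<le> int l \<Longrightarrow> (\<lambda>m. if m = k then 1 else 0) \<in> weight_space l"
  by (auto simp: weight_space_def)

text \<open>The vectors supported off \<open>P\<close> form an invariant subspace, nonzero because
  of k. Irreducibility enters Schur's lemma only in this form: the intertwiners met below are
  diagonal, so their eigenspaces are coordinate subspaces.\<close>

lemma coordinate_subspace_trivial:
  assumes P: "\<And>m n g. g \<in> SO3 \<Longrightarrow> P m \<Longrightarrow> \<not> P n \<Longrightarrow> T m n g = 0"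
    and k: "\<bar>k\<bar> \<le> int l" "\<not> P k" and m: "\<bar>m\<bar> \<le> int l"
  shows "\<not> P m"
proof -
  define V where "V = {v \<in> weight_space l. \<forall>m. P m \<longrightarrow> v m = 0}"
  have "invariant_subspace l T V"
    unfolding invariant_subspace_def
  proof (intro conjI ballI allI)
    fix g v assume g: "g \<in> SO3" and v: "v \<in> V"
    have "rep_apply l T g v m = 0" if "P m" for m
      unfolding rep_apply_def
    proof (intro sum.neutral ballI)
      fix n show "T m n g * v n = 0"
        using P[OF g that, of n] v by (cases "P n") (auto simp: V_def)
    qed
    moreover have "rep_apply l T g v \<in> weight_space l"
      by (auto simp: weight_space_def rep_apply_def outside)
    ultimately show "rep_apply l T g v \<in> V" by (simp add: V_def)
  qed (auto simp: V_def weight_space_def)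
  moreover have "(\<lambda>m. if m = k then 1 else 0) \<in> V"
    using k unit_vector_weight_space[OF k(1)] by (auto simp: V_def)
  then have "V \<noteq> {\<lambda>_. 0}" by (auto dest: fun_cong[of _ _ k])
  ultimately have "V = weight_space l" using irreducible by blast
  then have "(\<lambda>k. if k = m then 1 else 0) \<in> V" using unit_vector_weight_space[OF m] by simp
  then show ?thesis by (auto simp: V_def split: if_splits)
qed

end

text \<open>These integrals are the entries of the Haar average of T(g) E T'(g)^-1, where E has a
  single 1 at the place (n, n). Averaging makes this matrix an intertwiner of the two
  representations, and invariance under \<open>rot_z\<close> alone already makes it diagonal, with
  entries \<open>\<sigma>\<close>.\<close>

lemma haar_matrix_coefficients:
  fixes n :: int
  assumes "irrep l T" "irrep l' T'"
  defines "\<sigma> \<equiv> \<lambda>i. LINT g|haar. T i n g * cnj (T' i n g)"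
  shows "i \<noteq> k \<Longrightarrow> (LINT g|haar. T i n g * cnj (T' k n g)) = 0"
    and "h \<in> SO3 \<Longrightarrow> T i k h * \<sigma> k = \<sigma> i * T' i k h"
proof -
  interpret T: irrep l T by fact
  interpret T': irrep l' T' by fact
  define A where "A i k = (LINT g|haar. T i n g * cnj (T' k n g))" for i k
  have c: "continuous_on SO3 (\<lambda>g. T i n g * cnj (T' k n g))" for i k
    by (intro continuous_intros T.cont T'.cont)
  show off: "(LINT g|haar. T i n g * cnj (T' k n g)) = 0" if "i \<noteq> k" for i k
  proof -
    \<comment> \<open>For this angle the factor picked up under left translation is cis pi =
      -1.\<close>
    define a where "a = - pi / of_int (i - k)"
    have "A i k = (LINT g|haar. T i n (rot_z a ** g) * cnj (T' k n (rot_z a ** g)))"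
      unfolding A_def using haar_integral_left[OF rot_z_SO3 c] by simp
    also have "\<dots> = (LINT g|haar. cis (- (of_int (i - k) * a)) * (T i n g * cnj (T' k n g)))"
    proof (rule haar_integral_cong)
      fix g assume g: "g \<in> SO3"
      have "cis (- (of_int (i - k) * a)) = cis (- (of_int i * a)) * cis (of_int k * a)"
        by (simp add: cis_mult algebra_simps)
      then show "T i n (rot_z a ** g) * cnj (T' k n (rot_z a ** g)) =
          cis (- (of_int (i - k) * a)) * (T i n g * cnj (T' k n g))"
        by (simp add: T.rot_z_mult_left[OF g] T'.rot_z_mult_left[OF g] cis_cnj)
    qed
    also have "\<dots> = - A i k"
      using that by (simp add: A_def a_def)
    finally show ?thesis by (simp add: A_def)
  qed
  show "T i k h * \<sigma> k = \<sigma> i * T' i k h" if h: "h \<in> SO3"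
  proof -
    \<comment> \<open>One integral is evaluated twice: by expanding T at h g, and, after the
      substitution of the inverse of h times g, by expanding T'. The two values are the two sides of
      the intertwining relation.\<close>
    have "(LINT g|haar. T i n (h ** g) * cnj (T' k n g)) =
        (LINT g|haar. (\<Sum>s = - int l..int l. T i s h * (T s n g * cnj (T' k n g))))"
      by (rule haar_integral_cong) (simp add: T.mult[OF h] sum_distrib_right mult.assoc)
    also have "\<dots> = (\<Sum>s = - int l..int l. T i s h * A s k)"
      unfolding A_def using haar_integrable[OF c]
      by (subst Bochner_Integration.integral_sum) auto
    also have "\<dots> = (\<Sum>s = - int l..int l. if s = k then T i k h * \<sigma> k else 0)"
      by (intro sum.cong) (auto simp: A_def off \<sigma>_def)
    also have "\<dots> = T i k h * \<sigma> k"
      using T.outside[of i k] by auto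
    finally have 1: "(LINT g|haar. T i n (h ** g) * cnj (T' k n g)) = T i k h * \<sigma> k" .
    have "(LINT g|haar. T i n g * cnj (T' k n (matrix_inv h ** g))) =
        (LINT g|haar. (\<Sum>s = - int l'..int l'. T' s k h * (T i n g * cnj (T' s n g))))"
      by (rule haar_integral_cong)
        (simp add: T'.mult[OF SO3_inv[OF h]] T'.inv[OF h] sum_distrib_left ac_simps)
    also have "\<dots> = (\<Sum>s = - int l'..int l'. T' s k h * A i s)"
      unfolding A_def using haar_integrable[OF c]
      by (subst Bochner_Integration.integral_sum) auto
    also have "\<dots> = (\<Sum>s = - int l'..int l'. if s = i then T' i k h * \<sigma> i else 0)"
      by (intro sum.cong) (auto simp: A_def off \<sigma>_def)
    also have "\<dots> = T' i k h * \<sigma> i"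
      using T'.outside[of i k] by auto
    finally have 2: "(LINT g|haar. T i n g * cnj (T' k n (matrix_inv h ** g))) = T' i k h * \<sigma> i" .
    have "(LINT g|haar. T i n g * cnj (T' k n (matrix_inv h ** g))) =
       (LINT g|haar. T i n (h ** g) * cnj (T' k n (matrix_inv h ** (h ** g))))"
      by (rule haar_integral_left[OF h, symmetric])
        (intro continuous_intros T.cont continuous_on_SO3_translate T'.cont SO3_inv h)
    also have "\<dots> = (LINT g|haar. T i n (h ** g) * cnj (T' k n g))"
      using h by (simp add: matrix_mul_assoc)
    finally show ?thesis using 1 2 by (simp add: mult.commute)
  qed
qed

lemma (in irrep) schur_orthogonality:
  assumes n: "\<bar>n\<bar> \<le> int l"
  shows "(LINT g|haar. T i n g * cnj (T k n g)) =
    (if i = k \<and> \<bar>i\<bar> \<le> int l then 1 / (2 * of_nat l + 1) else 0)"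
proof -
  define \<sigma> where "\<sigma> i = (LINT g|haar. T i n g * cnj (T i n g))" for i
  note * = haar_matrix_coefficients[OF irrep_axioms irrep_axioms, where n=n, folded \<sigma>_def]
  have const: "\<sigma> m = \<sigma> n" if "\<bar>m\<bar> \<le> int l" for m
  proof -
    \<comment> \<open>The intertwining relation says that T m k times the difference of
      \<open>\<sigma> k\<close> and \<open>\<sigma> m\<close> is zero, so T does not connect
      different eigenvalues.\<close>
    have "T m k g = 0" if "g \<in> SO3" "\<sigma> m \<noteq> \<sigma> n" "\<not> \<sigma> k \<noteq> \<sigma> n" for m k g
      using *(2)[OF that(1), of m k] that(2,3) by (simp add: mult.commute)
    from coordinate_subspace_trivial[of "\<lambda>m. \<sigma> m \<noteq> \<sigma> n", OF this n _ that] show ?thesis by simp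
  qed
  \<comment> \<open>The trace of the intertwiner is the integrated square norm of column n, which is
    1; it is shared equally by the 2 l + 1 diagonal entries.\<close>
  have "(\<Sum>s = - int l..int l. \<sigma> s) = (LINT g|haar. (\<Sum>s = - int l..int l. T s n g * cnj (T s n g)))"
    unfolding \<sigma>_def
    by (intro Bochner_Integration.integral_sum[symmetric] haar_integrable continuous_intros cont)
  also have "\<dots> = (LINT g|haar. 1)"
    by (rule haar_integral_cong) (simp add: columns_normalized n)
  also have "\<dots> = 1" by simp
  also have "(\<Sum>s = - int l..int l. \<sigma> s) = (\<Sum>s = - int l..int l. \<sigma> n)"
    by (intro sum.cong refl const) auto
  finally have "of_nat (2 * l + 1) * \<sigma> n = 1"
    by (simp add: nat_add_distrib)
  then have n': "\<sigma> n = 1 / (2 * of_nat l + 1)"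
    using double_plus_1_neq_0[of l] by (simp add: field_simps)
  consider "i \<noteq> k" | "i = k" "\<bar>i\<bar> \<le> int l" | "i = k" "\<not> \<bar>i\<bar> \<le> int l" by blast
  then show ?thesis
  proof cases
    case 2
    then show ?thesis using const[of i] n' by (simp add: \<sigma>_def)
  qed (simp_all add: *(1) outside)
qed

text \<open>For l < l' the extension of T by zero makes the eigenvalue at index l' vanish. The
  kernel of the intertwiner in the larger representation is thus nonzero, hence everything. The
  other order follows by conjugation.\<close>

lemma schur_orthogonality_distinct:
  assumes "irrep l T" "irrep l' T'" "l \<noteq> l'"
  shows "(LINT g|haar. T i n g * cnj (T' k n g)) = 0"
proof -
  have *: "(LINT g|haar. T i n g * cnj (T' i n g)) = 0"
    if T: "irrep l T" "irrep l' T'" and "l < l'" for l l' T T' i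
  proof -
    interpret T: irrep l T by fact
    interpret T': irrep l' T' by fact
    define \<sigma> where "\<sigma> i = (LINT g|haar. T i n g * cnj (T' i n g))" for i
    note * = haar_matrix_coefficients[OF T, where n=n, folded \<sigma>_def]
    have "T' m k g = 0" if "g \<in> SO3" "\<sigma> m \<noteq> 0" "\<not> \<sigma> k \<noteq> 0" for m k g
      using *(2)[OF that(1), of m k] that(2,3) by simp
    moreover have "\<sigma> (int l') = 0"
      using \<open>l < l'\<close> by (simp add: \<sigma>_def T.outside)
    ultimately have "\<sigma> i = 0" if "\<bar>i\<bar> \<le> int l'"
      using T'.coordinate_subspace_trivial[of "\<lambda>m. \<sigma> m \<noteq> 0" "int l'" i] that by simp
    then show ?thesis
      by (cases "\<bar>i\<bar> \<le> int l'") (auto simp: \<sigma>_def T'.outside)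
  qed
  show ?thesis
  proof (cases "i = k")
    case True
    show ?thesis
    proof (cases "l < l'")
      case False
      then have "(LINT g|haar. T' i n g * cnj (T i n g)) = 0"
        using *[OF assms(2,1)] assms(3) by simp
      then have "cnj (LINT g|haar. T' i n g * cnj (T i n g)) = 0" by simp
      then have "(LINT g|haar. cnj (T' i n g * cnj (T i n g))) = 0"
        by (simp only: Bochner_Integration.integral_cnj)
      then show ?thesis using True by (simp add: mult.commute)
    qed (use * assms True in auto)
  qed (use haar_matrix_coefficients(1)[OF assms(1,2)] in auto)
qed

section \<open>Zonal functions\<close>

text \<open>Chebyshev polynomials, from cos ((k + 2) t) = 2 cos t cos ((k + 1) t) - cos (k
  t).\<close>

lemma cos_multiple_poly: "\<exists>p::real poly. degree p \<le> k \<and> (\<forall>t. cos (of_nat k * t) = poly p (cos t))"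
proof (induction k rule: induct_nat_012)
  case 0
  show ?case by (rule exI[of _ 1]) simp
next
  case 1
  show ?case by (rule exI[of _ "[:0, 1:]"]) simp
next
  case (ge2 k)
  then obtain p q :: "real poly" where p: "degree p \<le> k" "\<And>t. cos (of_nat k * t) = poly p (cos t)"
    and q: "degree q \<le> Suc k" "\<And>t. cos (of_nat (Suc k) * t) = poly q (cos t)" by blast
  have "degree ([:0, 2:] * q - p) \<le> Suc (Suc k)"
    using p(1) q(1) degree_mult_le[of "[:0, 2:]" q]
    by (intro degree_diff_le) auto
  moreover have "cos (of_nat (Suc (Suc k)) * t) = poly ([:0, 2:] * q - p) (cos t)" for t
    using cos_add[of "of_nat (Suc k) * t" t] cos_diff[of "of_nat (Suc k) * t" t]
    by (simp add: p(2)[symmetric] q(2)[symmetric] algebra_simps)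
  ultimately show ?case by blast
qed

context irrep
begin

text \<open>Conjugation by a half turn about the z axis reverses the angle, and on a diagonal entry
  the two half turns contribute cis (- 2 pi n) = 1.\<close>

lemma diagonal_rot_x_even: "T n n (rot_x (- t)) = T n n (rot_x t)"
proof -
  have "cis (- (of_int n * pi)) * cis (- (of_int n * pi)) = 1"
  proof -
    have "cis (- (of_int n * pi)) * cis (- (of_int n * pi)) = cis (2 * pi * of_int (- n))"
      by (simp add: cis_mult mult.assoc)
    then show ?thesis using cis_multiple_2pi[of "of_int (- n)"] by simp
  qed
  then show ?thesis
    unfolding rot_z_pi_rot_x[symmetric]
    by (simp add: rot_z_mult_left rot_z_mult_right SO3_mult ac_simps)
qed

lemma diagonal_rot_x_pi:
  assumes "n \<noteq> 0" shows "T n n (rot_x pi) = 0"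
proof -
  \<comment> \<open>With n a = pi / 2 the commutation relation multiplies the same entry by - i on
    one side and by i on the other.\<close>
  define a where "a = pi / (2 * of_int n)"
  have a: "of_int n * a = pi / 2" using assms by (simp add: a_def)
  have "T n n (rot_x pi ** rot_z a) = T n n (rot_z (- a) ** rot_x pi)"
    by (simp add: rot_x_pi_rot_z)
  then have "T n n (rot_x pi) * cis (- (pi / 2)) = cis (pi / 2) * T n n (rot_x pi)"
    by (simp add: rot_z_mult_left rot_z_mult_right a)
  then show ?thesis by (simp add: complex_eq_iff)
qed

text \<open>The cyclic permutation q of the axes carries z to x and so conjugates
  \<open>rot_z t\<close> into \<open>rot_x t\<close>. The diagonal entry becomes a trigonometric
  polynomial with coefficients |T n k q|^2 and frequencies at most l; evenness leaves its
  cosines.\<close>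

lemma diagonal_rot_x_poly:
  "\<exists>p. degree p \<le> l \<and> (\<forall>t. T n n (rot_x t) = of_real (poly p (cos t)))"
proof -
  define q :: "real^3^3" where "q = vector [vector [0, 0, 1], vector [1, 0, 0], vector [0, 1, 0]]"
  have q: "q \<in> SO3"
    unfolding SO3_iff by (simp add: q_def matrix_3_simps det_3)
  have rx: "rot_x t = q ** (rot_z t ** matrix_inv q)" for t
    unfolding SO3_matrix_inv[OF q] by (simp add: q_def matrix_3_simps rot_x_nth rot_z_nth)
  have sum: "T n n (rot_x t) = (\<Sum>k = - int l..int l. of_real ((cmod (T n k q))\<^sup>2) * cis (- (of_int k * t)))" for t
    unfolding rx using q
    by (subst mult) (auto intro!: sum.cong simp: rot_z_mult_left inv[OF q] SO3_inv
        complex_norm_square[unfolded of_real_power])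
  have "T n n (rot_x t) = (\<Sum>k = - int l..int l. of_real ((cmod (T n k q))\<^sup>2 * cos (of_nat (nat \<bar>k\<bar>) * t)))" for t
  proof -
    have "2 * T n n (rot_x t) = T n n (rot_x t) + T n n (rot_x (- t))"
      by (simp add: diagonal_rot_x_even)
    also have "\<dots> = (\<Sum>k = - int l..int l. of_real ((cmod (T n k q))\<^sup>2) * (cis (- (of_int k * t)) + cis (of_int k * t)))"
      unfolding sum by (simp add: sum.distrib distrib_left)
    also have "\<dots> = (\<Sum>k = - int l..int l. 2 * of_real ((cmod (T n k q))\<^sup>2 * cos (of_nat (nat \<bar>k\<bar>) * t)))"
      by (intro sum.cong refl) (auto simp: complex_eq_iff abs_if)
    finally show ?thesis by (simp flip: sum_distrib_left)
  qed
  moreover obtain c :: "nat \<Rightarrow> real poly"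
    where c: "\<And>k. degree (c k) \<le> k" "\<And>k t. cos (of_nat k * t) = poly (c k) (cos t)"
    using cos_multiple_poly by metis
  define p where "p = (\<Sum>k = - int l..int l. smult ((cmod (T n k q))\<^sup>2) (c (nat \<bar>k\<bar>)))"
  have "degree p \<le> l"
    unfolding p_def
  proof (intro degree_sum_le)
    fix k assume "k \<in> {- int l..int l}"
    then have "degree (c (nat \<bar>k\<bar>)) \<le> l" using c(1)[of "nat \<bar>k\<bar>"] by auto
    then show "degree (smult ((cmod (T n k q))\<^sup>2) (c (nat \<bar>k\<bar>))) \<le> l"
      using degree_smult_le order_trans by blast
  qed simp
  ultimately show ?thesis
    by (intro exI[of _ p]) (simp add: p_def poly_sum flip: c(2))
qed

end

text \<open>The bound on n matters for the span of the zonal functions: in general T l n n (rot_x t)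
  vanishes at cos t = -1 to order |n|, which for |n| at most 1 is no more than the vanishing that
  equivariance forces on a continuous function.\<close>

locale irreps =
  fixes T :: "nat \<Rightarrow> int \<Rightarrow> int \<Rightarrow> real^3^3 \<Rightarrow> complex" and n :: int
  assumes irrep: "\<And>l. irrep l (T l)" and n: "\<bar>n\<bar> \<le> 1"
begin

sublocale T: irrep l "T l" for l
  by (rule irrep)

lemma haar_orthogonality:
  "(LINT g|haar. T l i n g * cnj (T l' k n g)) =
    (if l = l' \<and> i = k \<and> \<bar>i\<bar> \<le> int l \<and> \<bar>n\<bar> \<le> int l then 1 / (2 * of_nat l + 1) else 0)"
proof (cases "l = l'")
  case True
  then show ?thesis
    by (cases "\<bar>n\<bar> \<le> int l") (auto simp: T.schur_orthogonality T.outside)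
qed (simp add: schur_orthogonality_distinct[OF irrep irrep])

definition zonal :: "nat \<Rightarrow> real poly" where
  "zonal l = (SOME p. degree p \<le> l \<and> (\<forall>t. T l n n (rot_x t) = of_real (poly p (cos t))))"

lemma degree_zonal: "degree (zonal l) \<le> l"
  and zonal: "T l n n (rot_x t) = of_real (poly (zonal l) (cos t))"
  using someI_ex[OF T.diagonal_rot_x_poly[of l n]] unfolding zonal_def by blast+

lemma zonal_minus_1: "n \<noteq> 0 \<Longrightarrow> poly (zonal l) (-1) = 0"
  using zonal[of l pi] T.diagonal_rot_x_pi[of n l] by simp

lemma diagonal_euler: "T l n n (euler a t b) = cis (- (of_int n * a)) * of_real (poly (zonal l) (cos t)) * cis (- (of_int n * b))"
  by (simp add: T.euler zonal)

text \<open>The degree bound is phrased by coefficients so that L = 0 means q = 0, the empty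
  combination. Each step removes the leading coefficient with \<open>zonal L\<close>, provided that
  this has exact degree L.\<close>

lemma zonal_span:
  assumes "\<And>i. L \<le> i \<Longrightarrow> coeff q i = 0" "n \<noteq> 0 \<Longrightarrow> poly q (-1) = 0"
  shows "\<exists>a. q = (\<Sum>l<L. smult (a l) (zonal l))"
  using assms
proof (induction L arbitrary: q)
  case 0
  then show ?case by (simp add: poly_eq_iff)
next
  case (Suc L)
  show ?case
  proof (cases "coeff (zonal L) L = 0")
    case False
    define c where "c = coeff q L / coeff (zonal L) L"
    have "\<exists>a. q - smult c (zonal L) = (\<Sum>l<L. smult (a l) (zonal l))"
    proof (rule Suc.IH)
      show "coeff (q - smult c (zonal L)) i = 0" if "L \<le> i" for i
      proof (cases "i = L")
        case False
        then have "Suc L \<le> i" "degree (zonal L) < i" using that degree_zonal[of L] by auto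
        then show ?thesis using Suc.prems(1)[of i] by (simp add: coeff_eq_0)
      qed (use False in \<open>simp add: c_def\<close>)
    qed (use Suc.prems(2) zonal_minus_1 in simp)
    then obtain a where a: "q - smult c (zonal L) = (\<Sum>l<L. smult (a l) (zonal l))" by blast
    have "q = (\<Sum>l<Suc L. smult ((a(L := c)) l) (zonal l))"
      using a by (simp add: algebra_simps)
    then show ?thesis by blast
  next
    case True
    \<comment> \<open>If \<open>zonal L\<close> had no term of degree L, it would by induction be a
      combination of the earlier ones, and T L n n would be orthogonal to itself.\<close>
    have "\<exists>a. zonal L = (\<Sum>l<L. smult (a l) (zonal l))"
    proof (rule Suc.IH)
      show "coeff (zonal L) i = 0" if "L \<le> i" for i
        using True that degree_zonal[of L] by (cases "i = L") (auto simp: coeff_eq_0)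
    qed (rule zonal_minus_1)
    then obtain a where a: "zonal L = (\<Sum>l<L. smult (a l) (zonal l))" by blast
    have "T L n n g = (\<Sum>l<L. of_real (a l) * T l n n g)" if g: "g \<in> SO3" for g
    proof -
      obtain x t y where "g = euler x t y" using SO3_euler[OF g] by metis
      moreover have "poly (zonal L) (cos t) = (\<Sum>l<L. a l * poly (zonal l) (cos t))"
        by (subst a) (simp add: poly_sum)
      ultimately show ?thesis
        by (simp add: diagonal_euler sum_distrib_left sum_distrib_right ac_simps)
    qed
    then have "(LINT g|haar. T L n n g * cnj (T L n n g)) =
        (LINT g|haar. (\<Sum>l<L. of_real (a l) * (T l n n g * cnj (T L n n g))))"
      by (intro haar_integral_cong) (simp add: sum_distrib_right mult.assoc)
    also have "\<dots> = (\<Sum>l<L. of_real (a l) * (LINT g|haar. T l n n g * cnj (T L n n g)))"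
      by (subst Bochner_Integration.integral_sum)
        (auto intro!: haar_integrable continuous_intros T.cont)
    also have "\<dots> = 0"
      by (intro sum.neutral) (simp add: haar_orthogonality)
    finally have "\<not> \<bar>n\<bar> \<le> int L"
      using double_plus_1_neq_0[of L] by (auto simp: haar_orthogonality)
    \<comment> \<open>The one case without contradiction: n = 1 or -1 and L = 0, where
      \<open>zonal 0\<close> is zero. There q is a constant vanishing at -1.\<close>
    then have "L = 0" "n \<noteq> 0" using n by auto
    then have "q = [:coeff q 0:]" "poly q (-1) = 0"
      using Suc.prems by (auto simp: poly_eq_iff coeff_pCons split: nat.splits)
    moreover have "poly [:coeff q 0:] (-1) = coeff q 0" by simp
    ultimately have "q = 0" by (metis pCons_0_0)
    then show ?thesis by (intro exI[of _ "\<lambda>_. 0"]) simp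
  qed
qed

end

section \<open>Completeness of the diagonal matrix coefficients\<close>

lemma real_poly_approximation:
  fixes f :: "real \<Rightarrow> real"
  assumes "continuous_on {-1..1} f" "0 < e"
  obtains p where "\<And>x. x \<in> {-1..1} \<Longrightarrow> \<bar>f x - poly p x\<bar> < e"
proof -
  obtain g where g: "real_polynomial_function g" "\<And>x. x \<in> {-1..1} \<Longrightarrow> \<bar>f x - g x\<bar> < e"
    using Stone_Weierstrass_real_polynomial_function[OF _ assms] by auto
  then obtain a N where "g = (\<lambda>x. \<Sum>i\<le>N. a i * x ^ i)"
    unfolding real_polynomial_function_iff_sum by blast
  then have "g x = poly (\<Sum>i\<le>N. monom (a i) i) x" for x
    by (simp add: poly_sum poly_monom)
  with g(2) that show ?thesis by metis
qed

context irreps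
begin

text \<open>Up to phases D is a function d of cos t, and d vanishes at -1 if n is nonzero. Its real
  and imaginary parts are uniform limits of combinations of zonal functions, and all of these are
  orthogonal to D.\<close>

lemma diagonal_complete:
  assumes D: "continuous_on SO3 D"
    and left: "\<And>a g. g \<in> SO3 \<Longrightarrow> D (rot_z a ** g) = cis (- (of_int n * a)) * D g"
    and right: "\<And>a g. g \<in> SO3 \<Longrightarrow> D (g ** rot_z a) = D g * cis (- (of_int n * a))"
    and orth: "\<And>l. (LINT g|haar. D g * cnj (T l n n g)) = 0"
    and g: "g \<in> SO3"
  shows "D g = 0"
proof -
  have D_euler: "D (euler a t b) = cis (- (of_int n * a)) * D (rot_x t) * cis (- (of_int n * b))" for a t b
    unfolding euler_def by (simp add: left right SO3_mult)
  define d where "d x = D (rot_x (arccos x))" for x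
  have d: "continuous_on {-1..1} d"
    unfolding d_def
    by (intro continuous_on_compose2[OF D] continuous_intros) auto
  have d1: "d (-1) = 0" if "n \<noteq> 0"
  proof -
    define a where "a = pi / (2 * of_int n)"
    have a: "of_int n * a = pi / 2" using that by (simp add: a_def)
    have "D (rot_x pi ** rot_z a) = D (rot_z (- a) ** rot_x pi)"
      by (simp add: rot_x_pi_rot_z)
    then have "D (rot_x pi) * cis (- (pi / 2)) = cis (pi / 2) * D (rot_x pi)"
      by (simp add: left right a)
    then show ?thesis by (simp add: complex_eq_iff d_def)
  qed
  obtain B where B: "\<And>g. g \<in> SO3 \<Longrightarrow> cmod (D g) \<le> B"
    using compact_imp_bounded[OF compact_continuous_image[OF D compact_SO3]]
    by (auto simp: bounded_iff)
  have B0: "0 \<le> B" using B[OF SO3_one] norm_ge_zero order_trans by blast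
  have approx: "\<exists>p L a. (\<forall>x\<in>{-1..1}. \<bar>f x - poly p x\<bar> < e) \<and> p = (\<Sum>l<(L::nat). smult (a l) (zonal l))"
    if f: "continuous_on {-1..1} f" "n \<noteq> 0 \<Longrightarrow> f (-1) = 0" and e: "0 < e" for f :: "real \<Rightarrow> real" and e
  proof -
    obtain p where p: "\<And>x. x \<in> {-1..1} \<Longrightarrow> \<bar>f x - poly p x\<bar> < e / 2"
      using real_poly_approximation[OF f(1), of "e / 2"] e by auto
    \<comment> \<open>Subtracting the value at -1 restores membership in the span; since f is zero
      there, it adds less than e / 2 to the error.\<close>
    define q where "q = (if n = 0 then p else p - [:poly p (-1):])"
    have "\<exists>a. q = (\<Sum>l<Suc (degree q). smult (a l) (zonal l))"
      by (rule zonal_span) (auto simp: q_def coeff_eq_0)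
    moreover have "\<bar>f x - poly q x\<bar> < e" if x: "x \<in> {-1..1}" for x
    proof (cases "n = 0")
      case True
      then show ?thesis using p[OF x] e by (simp add: q_def)
    next
      case False
      then have "\<bar>poly p (-1)\<bar> < e / 2" using p[of "-1"] f(2) by simp
      moreover have "poly q x = poly p x - poly p (-1)" using False by (simp add: q_def)
      ultimately show ?thesis using p[OF x] by linarith
    qed
    ultimately show ?thesis by blast
  qed
  have small: "(LINT g|haar. (cmod (D g))\<^sup>2) \<le> B * (2 * e)" if e: "0 < e" for e
  proof -
    obtain p L a where p: "\<And>x. x \<in> {-1..1} \<Longrightarrow> \<bar>Re (d x) - poly p x\<bar> < e" "p = (\<Sum>l<(L::nat). smult (a l) (zonal l))"
      using approx[OF continuous_on_Re[OF d] _ e] d1 by fastforce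
    obtain q K b where q: "\<And>x. x \<in> {-1..1} \<Longrightarrow> \<bar>Im (d x) - poly q x\<bar> < e" "q = (\<Sum>l<(K::nat). smult (b l) (zonal l))"
      using approx[OF continuous_on_Im[OF d] _ e] d1 by fastforce
    define Q where "Q g = (\<Sum>l<L. of_real (a l) * T l n n g) + \<i> * (\<Sum>l<K. of_real (b l) * T l n n g)" for g
    have Qc: "continuous_on SO3 Q"
      unfolding Q_def by (intro continuous_intros T.cont)
    have DQ: "cmod (D g - Q g) \<le> 2 * e" if g: "g \<in> SO3" for g
    proof -
      obtain x t y where t: "0 \<le> t" "t \<le> pi" and g_eq: "g = euler x t y" using SO3_euler[OF g] by metis
      define z where "z = cis (- (of_int n * x)) * cis (- (of_int n * y))"
      have "D g - Q g = z * (d (cos t) - (of_real (poly p (cos t)) + \<i> * of_real (poly q (cos t))))"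
        using t unfolding g_eq D_euler Q_def diagonal_euler d_def z_def p(2) q(2)
        by (simp add: poly_sum arccos_cos sum_distrib_left algebra_simps)
      also have "cmod \<dots> = cmod (d (cos t) - (of_real (poly p (cos t)) + \<i> * of_real (poly q (cos t))))"
        by (simp add: z_def norm_mult)
      also have "\<dots> \<le> \<bar>Re (d (cos t)) - poly p (cos t)\<bar> + \<bar>Im (d (cos t)) - poly q (cos t)\<bar>"
        using cmod_le[of "d (cos t) - (of_real (poly p (cos t)) + \<i> * of_real (poly q (cos t)))"] by simp
      also have "\<dots> \<le> 2 * e"
        using p(1)[of "cos t"] q(1)[of "cos t"] by simp
      finally show ?thesis .
    qed
    have "(LINT g|haar. D g * cnj (Q g)) =
      (LINT g|haar. (\<Sum>l<L. of_real (a l) * (D g * cnj (T l n n g))) - \<i> * (\<Sum>l<K. of_real (b l) * (D g * cnj (T l n n g))))"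
      by (rule haar_integral_cong) (simp add: Q_def sum_distrib_left sum_negf algebra_simps)
    also have "\<dots> = (\<Sum>l<L. of_real (a l) * (LINT g|haar. D g * cnj (T l n n g))) -
        \<i> * (\<Sum>l<K. of_real (b l) * (LINT g|haar. D g * cnj (T l n n g)))"
      by (subst Bochner_Integration.integral_diff Bochner_Integration.integral_mult_right
            Bochner_Integration.integral_sum | intro haar_integrable continuous_intros D T.cont)+
        simp
    also have "\<dots> = 0" by (simp add: orth)
    finally have DQ0: "(LINT g|haar. D g * cnj (Q g)) = 0" .
    \<comment> \<open>Orthogonality to Q allows one factor D to be replaced by the uniformly small D
      - Q.\<close>
    have "complex_of_real (LINT g|haar. (cmod (D g))\<^sup>2) = (LINT g|haar. D g * cnj (D g))"
      unfolding integral_complex_of_real[symmetric] by (rule haar_integral_cong) (simp only: complex_norm_square)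
    also have "\<dots> = (LINT g|haar. D g * cnj (D g - Q g))"
    proof -
      have "(LINT g|haar. D g * cnj (D g - Q g)) = (LINT g|haar. D g * cnj (D g) - D g * cnj (Q g))"
        by (simp add: right_diff_distrib)
      also have "\<dots> = (LINT g|haar. D g * cnj (D g)) - (LINT g|haar. D g * cnj (Q g))"
        by (intro Bochner_Integration.integral_diff haar_integrable continuous_intros D Qc)
      finally show ?thesis using DQ0 by simp
    qed
    finally have eq: "complex_of_real (LINT g|haar. (cmod (D g))\<^sup>2) = (LINT g|haar. D g * cnj (D g - Q g))" .
    have "(LINT g|haar. (cmod (D g))\<^sup>2) = cmod (complex_of_real (LINT g|haar. (cmod (D g))\<^sup>2))"
      by (simp add: integral_nonneg_AE)
    also have "\<dots> \<le> (LINT g|haar. cmod (D g * cnj (D g - Q g)))"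
      unfolding eq by (rule integral_norm_bound)
    also have "\<dots> \<le> (LINT g|haar. B * (2 * e))"
    proof (rule integral_mono)
      fix g assume "g \<in> space haar"
      then show "cmod (D g * cnj (D g - Q g)) \<le> B * (2 * e)"
        using mult_mono[OF B[of g] DQ[of g] B0] by (simp add: norm_mult flip: complex_cnj_diff)
    qed (intro haar_integrable continuous_intros D Qc)+
    finally show ?thesis by simp
  qed
  have "(LINT g|haar. (cmod (D g))\<^sup>2) \<le> 0"
  proof (rule ccontr)
    define I where "I = (LINT g|haar. (cmod (D g))\<^sup>2)"
    assume "\<not> (LINT g|haar. (cmod (D g))\<^sup>2) \<le> 0"
    then have "0 < I" by (simp add: I_def)
    \<comment> \<open>This choice of e gives I at most I / 2; B + 1 avoids a division by zero when B
      = 0.\<close>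
    moreover have "I \<le> B * (2 * (I / (4 * (B + 1))))"
      unfolding I_def using \<open>0 < I\<close> B0 by (intro small) (simp add: I_def)
    ultimately show False using B0 by (simp add: field_simps) (smt (verit) mult_nonneg_nonneg)
  qed
  then have "(LINT g|haar. (cmod (D g))\<^sup>2) = 0"
    by (intro antisym) (simp_all add: integral_nonneg_AE)
  then have "(cmod (D g))\<^sup>2 = 0"
    by (intro haar_integral_eq_0[OF _ _ _ g, of "\<lambda>g. (cmod (D g))\<^sup>2"] continuous_intros D) auto
  then show ?thesis by simp
qed

end

section \<open>Expansion of an isotropic random function\<close>

text \<open>\<open>L2_norm\<close> is only a seminorm on functions. Norm zero means almost sure
  equality, which inner products do not distinguish from equality.\<close>

lemma L2_inner_cong_norm:
  assumes "L2_var M Y" "L2_var M Y'" "L2_var M V" "L2_norm M (\<lambda>\<omega>. Y \<omega> - Y' \<omega>) = 0"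
  shows "L2_inner M Y V = L2_inner M Y' V"
  using L2_Cauchy_Schwarz[OF L2_var_diff[OF assms(1,2)] assms(3)] assms
  by (simp add: L2_inner_diff_left)

lemma mean_square_continuous_tendsto:
  assumes "mean_square_continuous M X" "g \<in> SO3"
  shows "((\<lambda>h. L2_norm M (\<lambda>\<omega>. X h \<omega> - X g \<omega>)) \<longlongrightarrow> 0) (at g within SO3)"
proof -
  have "((\<lambda>h. LINT \<omega>|M. (cmod (X h \<omega> - X g \<omega>))\<^sup>2) \<longlongrightarrow> 0) (at g within SO3)"
    using assms by (simp add: mean_square_continuous_def)
  from tendsto_real_sqrt[OF this] show ?thesis by (simp add: L2_norm_def)
qed

text \<open>X carries the phase cis (n a) under right translation by \<open>rot_z a\<close>, and T l
  m n the inverse phase, so their product, whose Haar integral gives the Fourier coefficients, does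
  not change in mean square.\<close>

locale isotropic_function = irreps T n
  for T :: "nat \<Rightarrow> int \<Rightarrow> int \<Rightarrow> real^3^3 \<Rightarrow> complex" and n :: int +
  fixes M :: "'w measure" and X :: "real^3^3 \<Rightarrow> 'w \<Rightarrow> complex"
  assumes isotropic: "weakly_isotropic M X" and ms_continuous: "mean_square_continuous M X"
    and equivariant: "\<And>a g. g \<in> SO3 \<Longrightarrow>
      L2_norm M (\<lambda>\<omega>. X (g ** rot_z a) \<omega> - cis (of_int n * a) * X g \<omega>) = 0"
begin

lemma X_L2: "g \<in> SO3 \<Longrightarrow> L2_var M (X g)"
  using isotropic by (simp add: weakly_isotropic_def)

lemmas X_tendsto = mean_square_continuous_tendsto[OF ms_continuous]

section \<open>The covariance as a function of one rotation\<close>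

definition \<rho> :: "real^3^3 \<Rightarrow> complex" where
  "\<rho> g = L2_inner M (X (mat 1)) (X g)"

lemma covariance:
  assumes "g1 \<in> SO3" "g2 \<in> SO3"
  shows "L2_inner M (X g1) (X g2) = \<rho> (matrix_inv g1 ** g2)"
proof -
  have "L2_inner M (X (matrix_inv g1 ** g1)) (X (matrix_inv g1 ** g2)) = L2_inner M (X g1) (X g2)"
    using isotropic assms SO3_inv[OF assms(1)] unfolding weakly_isotropic_def by blast
  then show ?thesis using assms by (simp add: \<rho>_def)
qed

lemma \<rho>_cont: "continuous_on SO3 \<rho>"
  unfolding \<rho>_def by (intro L2_inner_continuous_on X_L2 X_tendsto) auto

lemma inner_rot_z:
  assumes "g \<in> SO3" "L2_var M V"
  shows "L2_inner M (X (g ** rot_z a)) V = cis (of_int n * a) * L2_inner M (X g) V"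
  using L2_inner_cong_norm[OF X_L2 L2_var_cmult[OF X_L2] assms(2) equivariant, of g a] assms(1)
  by (simp add: L2_inner_cmult_left SO3_mult)

lemma \<rho>_left:
  assumes "g \<in> SO3"
  shows "\<rho> (rot_z a ** g) = cis (- (of_int n * a)) * \<rho> g"
proof -
  have "\<rho> (rot_z a ** g) = L2_inner M (X (mat 1 ** rot_z (- a))) (X g)"
    using covariance[OF rot_z_SO3 assms, of "- a"] by simp
  also have "\<dots> = cis (- (of_int n * a)) * \<rho> g"
    using inner_rot_z[OF SO3_one X_L2[OF assms], of "- a"] by (simp add: \<rho>_def)
  finally show ?thesis .
qed

lemma \<rho>_right:
  assumes "g \<in> SO3"
  shows "\<rho> (g ** rot_z a) = \<rho> g * cis (- (of_int n * a))"
proof -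
  have "\<rho> (g ** rot_z a) = cnj (L2_inner M (X (g ** rot_z a)) (X (mat 1)))"
    unfolding \<rho>_def by (rule L2_inner_commute)
  also have "\<dots> = \<rho> g * cis (- (of_int n * a))"
    unfolding inner_rot_z[OF assms X_L2[OF SO3_one]] \<rho>_def L2_inner_commute[of M "X (mat 1)"]
    by (simp add: cis_cnj)
  finally show ?thesis .
qed

definition c :: "nat \<Rightarrow> complex" where
  "c l = (2 * of_nat l + 1) * (LINT g|haar. \<rho> g * cnj (T l n n g))"

lemma \<rho>_coefficient:
  "(LINT g|haar. \<rho> g * cnj (T l s n g)) = (if s = n then c l / (2 * of_nat l + 1) else 0)"
proof (cases "s = n")
  case True
  then show ?thesis using double_plus_1_neq_0[of l] by (simp add: c_def)
next
  case False
  \<comment> \<open>Again the angle for which left translation multiplies the integrand by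
    -1.\<close>
  define a where "a = - pi / of_int (n - s)"
  have c: "continuous_on SO3 (\<lambda>g. \<rho> g * cnj (T l s n g))"
    by (intro continuous_intros \<rho>_cont T.cont)
  have "(LINT g|haar. \<rho> g * cnj (T l s n g)) =
      (LINT g|haar. \<rho> (rot_z a ** g) * cnj (T l s n (rot_z a ** g)))"
    using haar_integral_left[OF rot_z_SO3 c] by simp
  also have "\<dots> = (LINT g|haar. cis (- (of_int (n - s) * a)) * (\<rho> g * cnj (T l s n g)))"
  proof (rule haar_integral_cong)
    fix g assume g: "g \<in> SO3"
    have "cis (- (of_int (n - s) * a)) = cis (- (of_int n * a)) * cis (of_int s * a)"
      by (simp add: cis_mult algebra_simps)
    then show "\<rho> (rot_z a ** g) * cnj (T l s n (rot_z a ** g)) =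
        cis (- (of_int (n - s) * a)) * (\<rho> g * cnj (T l s n g))"
      by (simp add: \<rho>_left[OF g] T.rot_z_mult_left[OF g] cis_cnj)
  qed
  also have "\<dots> = - (LINT g|haar. \<rho> g * cnj (T l s n g))"
    using False by (simp add: a_def)
  finally show ?thesis using False by simp
qed

lemma c_eq_0: "int l < \<bar>n\<bar> \<Longrightarrow> c l = 0"
  by (simp add: c_def T.outside)

section \<open>Random Fourier coefficients and their covariances\<close>

lemma ex_Fourier_coefficient:
  "\<exists>Z. L2_var M Z \<and> (\<forall>V. L2_var M V \<longrightarrow>
    L2_inner M V Z = (2 * of_nat l + 1) * (LINT g|haar. cnj (T l m n g) * L2_inner M V (X g)))"
proof -
  define Y where "Y g = (\<lambda>\<omega>. (2 * of_nat l + 1) * T l m n g * X g \<omega>)" for g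
  have Y: "L2_var M (Y g)" if "g \<in> SO3" for g
    unfolding Y_def using X_L2[OF that] by (rule L2_var_cmult)
  have norm_cmult: "L2_norm M (\<lambda>\<omega>. b * V \<omega>) = cmod b * L2_norm M V" for b V
    by (simp add: L2_norm_def norm_mult power_mult_distrib real_sqrt_mult)
  have "((\<lambda>h. L2_norm M (\<lambda>\<omega>. Y h \<omega> - Y g \<omega>)) \<longlongrightarrow> 0) (at g within SO3)" if g: "g \<in> SO3" for g
  proof (rule Lim_null_comparison)
    let ?f = "\<lambda>h. (2 * of_nat l + 1) * T l m n h"
    have f: "(?f \<longlongrightarrow> ?f g) (at g within SO3)"
      using T.cont[of l m n] g by (intro tendsto_intros) (auto simp: continuous_on_def)
    have "((\<lambda>h. cmod (?f h) * L2_norm M (\<lambda>\<omega>. X h \<omega> - X g \<omega>) + cmod (?f h - ?f g) * L2_norm M (X g))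
        \<longlongrightarrow> cmod (?f g) * 0 + cmod (?f g - ?f g) * L2_norm M (X g)) (at g within SO3)"
      by (intro tendsto_intros f X_tendsto g)
    then show "((\<lambda>h. cmod (?f h) * L2_norm M (\<lambda>\<omega>. X h \<omega> - X g \<omega>) + cmod (?f h - ?f g) * L2_norm M (X g))
        \<longlongrightarrow> 0) (at g within SO3)" by simp
    have "norm (L2_norm M (\<lambda>\<omega>. Y h \<omega> - Y g \<omega>)) \<le>
        cmod (?f h) * L2_norm M (\<lambda>\<omega>. X h \<omega> - X g \<omega>) + cmod (?f h - ?f g) * L2_norm M (X g)"
      if h: "h \<in> SO3" for h
    proof -
      have "L2_norm M (\<lambda>\<omega>. Y h \<omega> - Y g \<omega>) =
          L2_norm M (\<lambda>\<omega>. ?f h * (X h \<omega> - X g \<omega>) - - (?f h - ?f g) * X g \<omega>)"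
        by (simp add: Y_def algebra_simps)
      also have "\<dots> \<le> L2_norm M (\<lambda>\<omega>. ?f h * (X h \<omega> - X g \<omega>)) + L2_norm M (\<lambda>\<omega>. - (?f h - ?f g) * X g \<omega>)"
        using g h by (intro L2_norm_triangle_diff L2_var_cmult L2_var_diff X_L2)
      finally show ?thesis by (simp only: norm_cmult norm_minus_cancel real_norm_def abs_of_nonneg L2_norm_nonneg)
    qed
    then show "\<forall>\<^sub>F h in at g within SO3. norm (L2_norm M (\<lambda>\<omega>. Y h \<omega> - Y g \<omega>)) \<le>
        cmod (?f h) * L2_norm M (\<lambda>\<omega>. X h \<omega> - X g \<omega>) + cmod (?f h - ?f g) * L2_norm M (X g)"
      unfolding eventually_at_topological by (intro exI[of _ UNIV]) auto
  qed
  from L2_weak_integral[OF prob_space_haar sets_haar space_haar compact_SO3 Y this]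
  obtain Z where Z: "L2_var M Z" "\<And>V. L2_var M V \<Longrightarrow> L2_inner M V Z = (LINT g|haar. L2_inner M V (Y g))"
    by blast
  have "L2_inner M V (Y g) = (2 * of_nat l + 1) * (cnj (T l m n g) * L2_inner M V (X g))" for V g
    unfolding Y_def L2_inner_cmult_right by (simp add: mult.assoc)
  with Z show ?thesis by (intro exI[of _ Z]) simp
qed

text \<open>The factor 2 l + 1 cancels Schur's constant, so that c l appears without a factor both
  in the covariance with X and, conjugated, in the variance.\<close>

definition Z0 :: "nat \<Rightarrow> int \<Rightarrow> 'w \<Rightarrow> complex" where
  "Z0 l m = (SOME Z. L2_var M Z \<and> (\<forall>V. L2_var M V \<longrightarrow>
    L2_inner M V Z = (2 * of_nat l + 1) * (LINT g|haar. cnj (T l m n g) * L2_inner M V (X g))))"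

lemma Z0_L2: "L2_var M (Z0 l m)"
  and inner_Z0: "L2_var M V \<Longrightarrow>
    L2_inner M V (Z0 l m) = (2 * of_nat l + 1) * (LINT g|haar. cnj (T l m n g) * L2_inner M V (X g))"
  using someI_ex[OF ex_Fourier_coefficient[of l m]] unfolding Z0_def by blast+

lemma inner_X_Z0:
  assumes g: "g \<in> SO3"
  shows "L2_inner M (X g) (Z0 l m) = c l * cnj (T l m n g)"
proof -
  have "(LINT h|haar. cnj (T l m n h) * L2_inner M (X g) (X h)) =
      (LINT h|haar. cnj (T l m n h) * \<rho> (matrix_inv g ** h))"
    by (rule haar_integral_cong) (simp add: covariance g)
  also have "\<dots> = (LINT h|haar. cnj (T l m n (g ** h)) * \<rho> (matrix_inv g ** (g ** h)))"
    by (rule haar_integral_left[OF g, symmetric])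
      (intro continuous_intros T.cont continuous_on_SO3_translate \<rho>_cont SO3_inv g)
  also have "\<dots> = (LINT h|haar. (\<Sum>s = - int l..int l. cnj (T l m s g) * (\<rho> h * cnj (T l s n h))))"
    by (rule haar_integral_cong)
      (simp add: g T.mult matrix_mul_assoc sum_distrib_left sum_distrib_right ac_simps)
  also have "\<dots> = (\<Sum>s = - int l..int l. cnj (T l m s g) * (LINT h|haar. \<rho> h * cnj (T l s n h)))"
    by (subst Bochner_Integration.integral_sum)
      (auto intro!: haar_integrable continuous_intros \<rho>_cont T.cont)
  also have "\<dots> = (\<Sum>s = - int l..int l. if s = n then cnj (T l m n g) * (c l / (2 * of_nat l + 1)) else 0)"
    by (intro sum.cong) (auto simp: \<rho>_coefficient)
  also have "\<dots> = cnj (T l m n g) * (c l / (2 * of_nat l + 1))"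
    by (auto simp: T.outside)
  finally show ?thesis
    unfolding inner_Z0[OF X_L2[OF g]] using double_plus_1_neq_0[of l] by simp
qed

lemma inner_Z0_Z0:
  "L2_inner M (Z0 l' m') (Z0 l m) =
    (if l = l' \<and> m = m' \<and> \<bar>m\<bar> \<le> int l then cnj (c l) else 0)"
proof -
  have "(LINT g|haar. cnj (T l m n g) * L2_inner M (Z0 l' m') (X g)) =
      (LINT g|haar. cnj (c l') * (T l' m' n g * cnj (T l m n g)))"
    by (rule haar_integral_cong) (simp add: L2_inner_commute[of M "Z0 l' m'"] inner_X_Z0)
  also have "\<dots> = cnj (c l') * (LINT g|haar. T l' m' n g * cnj (T l m n g))"
    by simp
  finally show ?thesis
    unfolding inner_Z0[OF Z0_L2] haar_orthogonality using double_plus_1_neq_0[of l] c_eq_0[of l]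
    by (auto simp: not_le)
qed

lemma c_real: "c l = of_real (Re (c l))" and c_nonneg: "0 \<le> Re (c l)"
proof -
  \<comment> \<open>The index m = 0 is in range for every l, so each c l is a variance.\<close>
  have "cnj (c l) = of_real ((L2_norm M (Z0 l 0))\<^sup>2)"
    using inner_Z0_Z0[of l 0 l 0] by (simp add: L2_inner_self)
  then have "c l = of_real ((L2_norm M (Z0 l 0))\<^sup>2)"
    by (metis complex_cnj_cnj complex_cnj_complex_of_real)
  then show "c l = of_real (Re (c l))" "0 \<le> Re (c l)" by simp_all
qed

text \<open>Coefficients of norm zero are only almost surely zero; they are replaced by zero.\<close>

definition Z :: "nat \<Rightarrow> int \<Rightarrow> 'w \<Rightarrow> complex" where
  "Z l m = (if c l = 0 then (\<lambda>_. 0) else Z0 l m)"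

lemma Z_L2: "L2_var M (Z l m)"
  by (simp add: Z_def Z0_L2)

lemma L2_inner_0 [simp]: "L2_inner M (\<lambda>_. 0) V = 0" "L2_inner M V (\<lambda>_. 0) = 0"
  by (simp_all add: L2_inner_def)

lemma inner_X_Z: "g \<in> SO3 \<Longrightarrow> L2_inner M (X g) (Z l m) = c l * cnj (T l m n g)"
  by (simp add: Z_def inner_X_Z0)

lemma inner_Z_Z:
  "L2_inner M (Z l' m') (Z l m) =
    (if l = l' \<and> m = m' \<and> \<bar>m\<bar> \<le> int l then of_real (Re (c l)) else 0)"
proof -
  have "cnj (c l) = of_real (Re (c l))"
    by (subst (1) c_real) simp
  then show ?thesis by (auto simp: Z_def inner_Z0_Z0)
qed

section \<open>Bessel's inequality and convergence\<close>

definition partial_sum :: "nat \<Rightarrow> real^3^3 \<Rightarrow> 'w \<Rightarrow> complex" where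
  "partial_sum L g \<omega> = (\<Sum>l<L. \<Sum>m = - int l..int l. T l n m (matrix_inv g) * Z l m \<omega>)"

lemma partial_sum_L2: "L2_var M (partial_sum L g)"
  unfolding partial_sum_def[abs_def] by (intro L2_var_sum L2_var_cmult Z_L2)

lemma row_norm:
  assumes g: "g \<in> SO3"
  shows "c l * (\<Sum>m = - int l..int l. T l m n g * cnj (T l m n g)) = c l"
  using T.columns_normalized[OF g, of n l] c_eq_0[of l] by (cases "\<bar>n\<bar> \<le> int l") auto

text \<open>Column n of a unitary matrix has norm 1, hence the right-hand side is free of g.
  Nonnegativity gives Bessel's inequality, and convergence at the identity will be convergence at
  every g.\<close>

lemma residual_norm:
  assumes g: "g \<in> SO3"
  shows "(L2_norm M (\<lambda>\<omega>. X g \<omega> - partial_sum L g \<omega>))\<^sup>2 = Re (\<rho> (mat 1)) - (\<Sum>l<L. Re (c l))"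
proof -
  have XS: "L2_inner M (X g) (partial_sum L g) = (\<Sum>l<L. c l)"
  proof -
    have "L2_inner M (X g) (partial_sum L g) =
        (\<Sum>l<L. \<Sum>m = - int l..int l. c l * (T l m n g * cnj (T l m n g)))"
      unfolding partial_sum_def[abs_def]
      by (simp add: L2_inner_sum_right L2_var_sum L2_var_cmult Z_L2 X_L2 g L2_inner_cmult_right
          inner_X_Z T.inv[OF g] ac_simps)
    then show ?thesis
      by (simp add: row_norm[OF g] flip: sum_distrib_left)
  qed
  have ZS: "L2_inner M (Z l' m') (partial_sum L g) = c l' * cnj (T l' n m' (matrix_inv g))"
    if "l' < L" "\<bar>m'\<bar> \<le> int l'" for l' m'
  proof -
    have "L2_inner M (Z l' m') (partial_sum L g) =
        (\<Sum>l<L. \<Sum>m = - int l..int l. cnj (T l n m (matrix_inv g)) * L2_inner M (Z l' m') (Z l m))"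
      unfolding partial_sum_def[abs_def]
      by (simp add: L2_inner_sum_right L2_var_sum L2_var_cmult Z_L2 L2_inner_cmult_right)
    also have "\<dots> = (\<Sum>l<L. if l = l' then c l' * cnj (T l' n m' (matrix_inv g)) else 0)"
    proof (intro sum.cong refl)
      fix l
      have "(\<Sum>m = - int l..int l. cnj (T l n m (matrix_inv g)) * L2_inner M (Z l' m') (Z l m)) =
        (\<Sum>m = - int l..int l. if m = m' then (if l = l' then c l' * cnj (T l' n m' (matrix_inv g)) else 0) else 0)"
        using that by (intro sum.cong) (auto simp: inner_Z_Z c_real[of l', symmetric])
      then show "(\<Sum>m = - int l..int l. cnj (T l n m (matrix_inv g)) * L2_inner M (Z l' m') (Z l m)) =
        (if l = l' then c l' * cnj (T l' n m' (matrix_inv g)) else 0)"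
        using that by auto
    qed
    finally show ?thesis using that by simp
  qed
  have SS: "L2_inner M (partial_sum L g) (partial_sum L g) = (\<Sum>l<L. c l)"
  proof -
    have "L2_inner M (partial_sum L g) (partial_sum L g) =
        (\<Sum>l<L. \<Sum>m = - int l..int l. T l n m (matrix_inv g) * L2_inner M (Z l m) (partial_sum L g))"
      by (subst partial_sum_def[abs_def])
        (simp add: L2_inner_sum_left L2_var_sum L2_var_cmult Z_L2 L2_inner_cmult_left partial_sum_L2)
    also have "\<dots> = (\<Sum>l<L. \<Sum>m = - int l..int l. c l * (T l m n g * cnj (T l m n g)))"
      by (intro sum.cong refl) (auto simp: ZS T.inv[OF g])
    finally show ?thesis
      by (simp add: row_norm[OF g] flip: sum_distrib_left)
  qed
  have XX: "L2_inner M (X g) (X g) = \<rho> (mat 1)"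
    using covariance[OF g g] g by simp
  have "(L2_norm M (X g))\<^sup>2 = Re (\<rho> (mat 1))" "(L2_norm M (partial_sum L g))\<^sup>2 = (\<Sum>l<L. Re (c l))"
    using arg_cong[OF XX, of Re] arg_cong[OF SS, of Re] by (simp_all add: L2_inner_self)
  then show ?thesis
    unfolding L2_norm_diff_square[OF X_L2[OF g] partial_sum_L2] XS by simp
qed

lemma summable_c: "summable (\<lambda>l. Re (c l))"
proof (rule summableI_nonneg_bounded)
  show "(\<Sum>l<L. Re (c l)) \<le> Re (\<rho> (mat 1))" for L
    using residual_norm[OF SO3_one, of L] zero_le_power2[of "L2_norm M (\<lambda>\<omega>. X (mat 1) \<omega> - partial_sum L (mat 1) \<omega>)"]
    by linarith
qed (rule c_nonneg)

lemma norm_term_le: "g \<in> SO3 \<Longrightarrow> norm (of_real (Re (c l)) * T l n n g) \<le> Re (c l)"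
  using T.norm_le_1[of g l n n] c_nonneg[of l] by (simp add: norm_mult mult_left_le)

text \<open>By Bessel the c l form a summable majorant, so the series is continuous and may be
  integrated term by term. Its coefficients are those of \<open>\<rho>\<close>, and
  \<open>diagonal_complete\<close> applies to the difference.\<close>

lemma \<rho>_expansion:
  assumes g: "g \<in> SO3"
  shows "(\<lambda>l. of_real (Re (c l)) * T l n n g) sums \<rho> g"
proof -
  define S where "S g = (\<Sum>l. of_real (Re (c l)) * T l n n g)" for g
  have summ: "summable (\<lambda>l. of_real (Re (c l)) * T l n n g)" if "g \<in> SO3" for g
    by (rule summable_comparison_test'[OF summable_c, of 0]) (use norm_term_le[OF that] in auto)
  have S_cont: "continuous_on SO3 S"
    unfolding S_def
  proof (rule uniform_limit_theorem[OF _ Weierstrass_m_test[OF _ summable_c]])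
    show "\<forall>\<^sub>F L in sequentially. continuous_on SO3 (\<lambda>g. \<Sum>l<L. of_real (Re (c l)) * T l n n g)"
      by (intro always_eventually allI continuous_intros T.cont)
  qed (use norm_term_le in auto)
  have S_coeff: "(LINT g|haar. S g * cnj (T l n n g)) = c l / (2 * of_nat l + 1)" for l
  proof -
    have "(\<lambda>k. LINT g|haar. of_real (Re (c k)) * T k n n g * cnj (T l n n g)) sums
        (LINT g|haar. (\<Sum>k. of_real (Re (c k)) * T k n n g * cnj (T l n n g)))"
    proof (rule sums_integral)
      show "integrable haar (\<lambda>g. of_real (Re (c k)) * T k n n g * cnj (T l n n g))" for k
        by (intro haar_integrable continuous_intros T.cont)
      have le: "norm (of_real (Re (c k)) * T k n n g * cnj (T l n n g)) \<le> Re (c k)" if "g \<in> SO3" for k g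
        using mult_mono[OF norm_term_le[OF that, of k] T.norm_le_1[OF that, of l n n] c_nonneg]
        by (simp add: norm_mult)
      show "AE g in haar. summable (\<lambda>k. norm (of_real (Re (c k)) * T k n n g * cnj (T l n n g)))"
        by (rule AE_I2, rule summable_comparison_test'[OF summable_c, of 0]) (use le in auto)
      show "summable (\<lambda>k. LINT g|haar. norm (of_real (Re (c k)) * T k n n g * cnj (T l n n g)))"
      proof (rule summable_comparison_test'[OF summable_c, of 0])
        fix k
        have "(LINT g|haar. norm (of_real (Re (c k)) * T k n n g * cnj (T l n n g))) \<le> (LINT g|haar. Re (c k))"
          by (rule integral_mono) (use le in \<open>auto intro!: haar_integrable continuous_intros T.cont\<close>)
        then show "norm (LINT g|haar. norm (of_real (Re (c k)) * T k n n g * cnj (T l n n g))) \<le> Re (c k)"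
          by (simp add: integral_nonneg_AE)
      qed
    qed
    moreover have "(LINT g|haar. of_real (Re (c k)) * T k n n g * cnj (T l n n g)) =
        (if k = l then c l / (2 * of_nat l + 1) else 0)" for k
      unfolding mult.assoc Bochner_Integration.integral_mult_right_zero haar_orthogonality
      using c_eq_0[of l] c_real[of l] by (auto simp: not_le)
    moreover have "(LINT g|haar. (\<Sum>k. of_real (Re (c k)) * T k n n g * cnj (T l n n g))) =
        (LINT g|haar. S g * cnj (T l n n g))"
      by (rule haar_integral_cong) (simp add: S_def suminf_mult2[OF summ])
    ultimately have "(\<lambda>k. if k = l then c l / (2 * of_nat l + 1) else 0) sums (LINT g|haar. S g * cnj (T l n n g))"
      by simp
    from sums_unique2[OF this sums_single[of l "\<lambda>_. c l / (2 * of_nat l + 1)"]]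
    show ?thesis .
  qed
  have "\<rho> g - S g = 0"
  proof (rule diagonal_complete[OF _ _ _ _ g])
    show "continuous_on SO3 (\<lambda>g. \<rho> g - S g)"
      by (intro continuous_intros \<rho>_cont S_cont)
    show "(LINT g|haar. (\<rho> g - S g) * cnj (T l n n g)) = 0" for l
    proof -
      have "(LINT g|haar. (\<rho> g - S g) * cnj (T l n n g)) =
          (LINT g|haar. \<rho> g * cnj (T l n n g) - S g * cnj (T l n n g))"
        by (simp add: left_diff_distrib)
      also have "\<dots> = (LINT g|haar. \<rho> g * cnj (T l n n g)) - (LINT g|haar. S g * cnj (T l n n g))"
        by (intro Bochner_Integration.integral_diff haar_integrable continuous_intros \<rho>_cont S_cont T.cont)
      finally show ?thesis by (simp add: \<rho>_coefficient S_coeff)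
    qed
    fix a g assume g: "g \<in> SO3"
    have "S (rot_z a ** g) = cis (- (of_int n * a)) * S g"
      unfolding S_def suminf_mult[OF summ[OF g], symmetric]
      by (simp add: T.rot_z_mult_left g mult.left_commute)
    then show "\<rho> (rot_z a ** g) - S (rot_z a ** g) = cis (- (of_int n * a)) * (\<rho> g - S g)"
      by (simp add: \<rho>_left g right_diff_distrib)
    have "S (g ** rot_z a) = S g * cis (- (of_int n * a))"
      unfolding S_def suminf_mult2[OF summ[OF g]]
      by (simp add: T.rot_z_mult_right g mult.assoc)
    then show "\<rho> (g ** rot_z a) - S (g ** rot_z a) = (\<rho> g - S g) * cis (- (of_int n * a))"
      by (simp add: \<rho>_right g left_diff_distrib)
  qed
  then show ?thesis
    using summable_sums[OF summ[OF g]] by (simp add: S_def)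
qed

lemma expansion:
  assumes g: "g \<in> SO3"
  shows "(\<lambda>L. L2_norm M (\<lambda>\<omega>. X g \<omega> - partial_sum L g \<omega>)) \<longlonglongrightarrow> 0"
proof -
  \<comment> \<open>The diagonal entry at the identity is 1 unless |n| > l, and then c l is zero.
    The expansion of \<open>\<rho>\<close> at the identity is thus Parseval's equality.\<close>
  have "of_real (Re (c l)) * T l n n (mat 1) = of_real (Re (c l))" for l
    using c_eq_0[of l] by (auto simp: T.one not_le)
  then have "(\<lambda>l. of_real (Re (c l)) :: complex) sums \<rho> (mat 1)"
    using \<rho>_expansion[OF SO3_one] by (simp only:)
  then have "(\<lambda>l. Re (c l)) sums Re (\<rho> (mat 1))"
    using sums_Re by fastforce
  then have "(\<lambda>L. Re (\<rho> (mat 1)) - (\<Sum>l<L. Re (c l))) \<longlonglongrightarrow> Re (\<rho> (mat 1)) - Re (\<rho> (mat 1))"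
    unfolding sums_def by (intro tendsto_intros)
  then have "(\<lambda>L. sqrt ((L2_norm M (\<lambda>\<omega>. X g \<omega> - partial_sum L g \<omega>))\<^sup>2)) \<longlonglongrightarrow> sqrt 0"
    unfolding residual_norm[OF g] by (intro tendsto_intros) simp
  then show ?thesis by simp
qed

lemma covariance_expansion:
  assumes "g1 \<in> SO3" "g2 \<in> SO3"
  shows "(\<lambda>l. of_real (Re (c l)) * T l n n (matrix_inv g1 ** g2)) sums L2_inner M (X g1) (X g2)"
  unfolding covariance[OF assms] by (rule \<rho>_expansion) (use assms in auto)

end

section \<open>Associated Legendre functions as matrix coefficients\<close>

lemma higher_pderiv_eq_0: "degree p < k \<Longrightarrow> (pderiv ^^ k) p = 0" for p :: "real poly"
proof (induction k arbitrary: p)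
  case (Suc k)
  have 0: "(pderiv ^^ k) 0 = (0 :: real poly)" for k by (induction k) simp_all
  show ?case
  proof (cases "degree p = 0")
    case True
    then have "pderiv p = 0" by (simp add: pderiv_eq_0_iff)
    then show ?thesis using 0 by (simp add: funpow_Suc_right del: funpow.simps)
  next
    case False
    then show ?thesis
      using Suc by (simp add: funpow_Suc_right degree_pderiv del: funpow.simps)
  qed
qed simp

lemma poly_taylor:
  fixes p :: "real poly"
  assumes "degree p < k"
  shows "poly p (u + h) = (\<Sum>j<k. poly ((pderiv ^^ j) p) u / fact j * h ^ j)"
proof -
  have "\<exists>t. \<bar>t\<bar> \<le> \<bar>h\<bar> \<and> poly p (u + h) =
      (\<Sum>j<k. poly ((pderiv ^^ j) p) (u + 0) / fact j * h ^ j) + poly ((pderiv ^^ k) p) (u + t) / fact k * h ^ k"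
  proof (rule Maclaurin_all_le[of "\<lambda>j x. poly ((pderiv ^^ j) p) (u + x)"])
    show "\<forall>m x. ((\<lambda>x. poly ((pderiv ^^ m) p) (u + x)) has_real_derivative poly ((pderiv ^^ Suc m) p) (u + x)) (at x)"
      by (auto intro!: derivative_eq_intros poly_DERIV[THEN DERIV_chain2])
  qed simp
  then show ?thesis using higher_pderiv_eq_0[OF assms] by auto
qed

text \<open>\<open>cos_power_coeff j m\<close> is the Fourier coefficient of \<open>\<lambda>a. cos a ^ j\<close> at frequency \<open>m\<close>.\<close>

primrec cos_power_coeff :: "nat \<Rightarrow> int \<Rightarrow> real" where
  "cos_power_coeff 0 m = (if m = 0 then 1 else 0)"
| "cos_power_coeff (Suc j) m = (cos_power_coeff j (m + 1) + cos_power_coeff j (m - 1)) / 2"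

lemma cos_power_coeff_minus: "cos_power_coeff j (- m) = cos_power_coeff j m"
proof (induction j arbitrary: m)
  case (Suc j)
  have "- m + 1 = - (m - 1)" "- m - 1 = - (m + 1)" by simp_all
  then show ?case by (simp only: cos_power_coeff.simps Suc) simp
qed simp

lemma cos_power_coeff_eq_0: "int j < \<bar>m\<bar> \<Longrightarrow> cos_power_coeff j m = 0"
  by (induction j arbitrary: m) auto

lemma cos_power_coeff_odd: "odd (int j + m) \<Longrightarrow> cos_power_coeff j m = 0"
  by (induction j arbitrary: m) auto

lemma cos_power_coeff_top: "cos_power_coeff k (int k) = 1 / 2 ^ k"
  by (induction k) (simp_all add: cos_power_coeff_eq_0 add.commute)

lemma cis_eq_1_iff_multiple:
  assumes "0 < N" "\<bar>k\<bar> < int N" "cis (2 * pi * of_int k / of_nat N) = 1"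
  shows "k = 0"
proof -
  have "cos (2 * pi * of_int k / of_nat N) = 1"
    using assms(3) by (simp add: complex_eq_iff)
  then obtain i :: int where "2 * pi * of_int k / of_nat N = of_int i * 2 * pi"
    by (auto simp: cos_one_2pi_int)
  then have "of_int k = (of_int i * of_nat N :: real)"
    using assms(1) by (simp add: field_simps)
  then have "k = i * int N"
    by (metis of_int_eq_iff of_int_mult of_int_of_nat_eq)
  then show ?thesis
    using assms(1,2) by (cases "i = 0") (auto simp: abs_mult)
qed

text \<open>Averaging over N equally spaced angles reads off Fourier coefficients of trigonometric
  polynomials exactly, without integration, as long as the frequencies stay below N.\<close>

lemma sum_cis_roots_of_unity:
  assumes "0 < N" "\<bar>k\<bar> < int N"
  shows "(\<Sum>i<N. cis (of_int k * (2 * pi * of_nat i / of_nat N))) = (if k = 0 then of_nat N else 0)"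
proof (cases "k = 0")
  case False
  define z where "z = cis (2 * pi * of_int k / of_nat N)"
  have "z \<noteq> 1" using cis_eq_1_iff_multiple[OF assms] False by (auto simp: z_def)
  have "z ^ N = cis (of_nat N * (2 * pi * of_int k / of_nat N))"
    unfolding z_def by (rule Complex.DeMoivre)
  then have "z ^ N = cis (2 * pi * of_int k)"
    using assms(1) by simp
  then have "z ^ N = 1" using cis_multiple_2pi[of "of_int k"] by simp
  have "(\<Sum>i<N. cis (of_int k * (2 * pi * of_nat i / of_nat N))) = (\<Sum>i<N. z ^ i)"
    by (intro sum.cong) (simp_all add: z_def Complex.DeMoivre field_simps)
  also have "\<dots> = 0"
    using \<open>z \<noteq> 1\<close> \<open>z ^ N = 1\<close> by (simp add: geometric_sum)
  finally show ?thesis using False by simp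
qed simp

text \<open>The j-th power of cos has frequencies up to j; the bound keeps them below N after the
  shift by m and so excludes aliasing.\<close>

lemma cos_power_coeff_sum:
  assumes "\<bar>m\<bar> + int j < int N"
  shows "(\<Sum>i<N. cis (of_int m * (2 * pi * of_nat i / of_nat N)) * of_real (cos (2 * pi * of_nat i / of_nat N) ^ j)) =
    of_nat N * of_real (cos_power_coeff j m)"
  using assms
proof (induction j arbitrary: m)
  case 0
  then show ?case using sum_cis_roots_of_unity[of N m] by simp
next
  case (Suc j)
  let ?a = "\<lambda>i. 2 * pi * of_nat i / of_nat N"
  have "cis (of_int m * a) * of_real (cos a ^ Suc j) =
      (cis (of_int (m + 1) * a) * of_real (cos a ^ j) + cis (of_int (m - 1) * a) * of_real (cos a ^ j)) / 2" for a
  proof -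
    have "cis (of_int (m + 1) * a) = cis (of_int m * a) * cis a" "cis (of_int (m - 1) * a) = cis (of_int m * a) * cis (- a)"
      by (simp_all add: cis_mult algebra_simps)
    moreover have "cis a + cis (- a) = 2 * of_real (cos a)"
      by (simp add: complex_eq_iff)
    ultimately have "cis (of_int (m + 1) * a) + cis (of_int (m - 1) * a) = cis (of_int m * a) * (2 * of_real (cos a))"
      by (simp add: distrib_left[symmetric])
    then show ?thesis
      by (simp add: distrib_right[symmetric] add_divide_distrib[symmetric] del: of_int_add of_int_diff)
  qed
  then have "(\<Sum>i<N. cis (of_int m * ?a i) * of_real (cos (?a i) ^ Suc j)) =
      (\<Sum>i<N. (cis (of_int (m + 1) * ?a i) * of_real (cos (?a i) ^ j) + cis (of_int (m - 1) * ?a i) * of_real (cos (?a i) ^ j)) / 2)"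
    by (simp only:)
  also have "\<dots> = ((\<Sum>i<N. cis (of_int (m + 1) * ?a i) * of_real (cos (?a i) ^ j)) +
      (\<Sum>i<N. cis (of_int (m - 1) * ?a i) * of_real (cos (?a i) ^ j))) / 2"
    by (simp only: sum_divide_distrib[symmetric] sum.distrib)
  also have "\<dots> = of_nat N * of_real (cos_power_coeff (Suc j) m)"
    using Suc.prems by (subst (1 2) Suc.IH) (auto simp: algebra_simps add_divide_distrib)
  finally show ?case .
qed

text \<open>Only the term in which all l derivatives fall on the l-fold zero survives at a.\<close>

lemma higher_pderiv_linear_power:
  fixes q :: "real poly"
  shows "poly ((pderiv ^^ l) ([:- a, 1:] ^ l * q)) a = fact l * poly q a"
proof (induction l arbitrary: q)
  case (Suc l)
  have "pderiv ([:- a, 1:] ^ Suc l * q) = [:- a, 1:] ^ l * (smult (of_nat (Suc l)) q + [:- a, 1:] * pderiv q)"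
    by (simp add: pderiv_mult pderiv_power_Suc pderiv_pCons algebra_simps del: power_Suc)
      (simp add: algebra_simps)
  then show ?case
    using Suc by (simp add: funpow_swap1[symmetric] funpow_Suc_right del: funpow.simps)
qed simp

section \<open>Legendre polynomials and their derivatives at 1\<close>

definition rodrigues :: "nat \<Rightarrow> real poly" where
  "rodrigues l = smult (1 / (2 ^ l * fact l)) ((pderiv ^^ l) ([:-1, 0, 1:] ^ l))"

lemma higher_pderiv_smult: "(pderiv ^^ k) (smult c p) = smult c ((pderiv ^^ k) p)" for p :: "real poly"
  by (induction k) (simp_all add: pderiv_smult)

lemma rodrigues_1: "poly (rodrigues l) 1 = 1"
proof -
  have "[:-1, 0, 1:] = [:- 1, 1:] * [:1, 1 :: real:]" by simp
  then have "[:-1, 0, 1:] ^ l = [:- 1, 1:] ^ l * [:1, 1 :: real:] ^ l"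
    by (simp only: power_mult_distrib)
  then show ?thesis
    unfolding rodrigues_def by (simp only: poly_smult higher_pderiv_linear_power) (simp add: poly_power)
qed

text \<open>W = (x^2 - 1)^l satisfies (x^2 - 1) W' = 2 l x W. Differentiate this l + k + 1 times and
  put x = 1, where the term of highest order drops out.\<close>

lemma rodrigues_recursion:
  "2 * (of_nat k + 1) * poly ((pderiv ^^ Suc k) (rodrigues l)) 1 =
    (of_nat l - of_nat k) * (of_nat l + of_nat k + 1) * poly ((pderiv ^^ k) (rodrigues l)) 1"
proof -
  define W :: "real poly" where "W = [:-1, 0, 1:] ^ l"
  have base: "[:-1, 0, 1:] * pderiv W = smult (2 * of_nat l) ([:0, 1:] * W)"
  proof (cases l)
    case (Suc j)
    show ?thesis
      unfolding W_def Suc pderiv_power_Suc poly_eq_poly_eq_iff[symmetric]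
      by (simp add: fun_eq_iff pderiv_pCons algebra_simps)
  qed (simp add: W_def)
  have W: "[:-1, 0, 1:] * (pderiv ^^ (k + 2)) W + smult (2 * (of_nat k + 1)) ([:0, 1:] * (pderiv ^^ (k + 1)) W)
      + smult (of_nat k * (of_nat k + 1)) ((pderiv ^^ k) W) =
      smult (2 * of_nat l) ([:0, 1:] * (pderiv ^^ (k + 1)) W) + smult (2 * of_nat l * (of_nat k + 1)) ((pderiv ^^ k) W)" for k
  proof (induction k)
    case 0
    show ?case
      using arg_cong[OF base, of pderiv] by (simp add: poly_eq_poly_eq_iff[symmetric] fun_eq_iff pderiv_mult pderiv_smult pderiv_add pderiv_diff pderiv_pCons algebra_simps)
  next
    case (Suc k)
    have "pderiv ([:-1, 0, 1:] * (pderiv ^^ (k + 2)) W + smult (2 * (of_nat k + 1)) ([:0, 1:] * (pderiv ^^ (k + 1)) W)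
      + smult (of_nat k * (of_nat k + 1)) ((pderiv ^^ k) W)) =
      pderiv (smult (2 * of_nat l) ([:0, 1:] * (pderiv ^^ (k + 1)) W) + smult (2 * of_nat l * (of_nat k + 1)) ((pderiv ^^ k) W))"
      by (simp only: Suc)
    then show ?case
      by (simp add: poly_eq_poly_eq_iff[symmetric] fun_eq_iff pderiv_add pderiv_diff pderiv_minus pderiv_mult pderiv_smult
          pderiv_pCons algebra_simps)
  qed
  have "poly (smult (2 * of_nat l) ([:0, 1:] * (pderiv ^^ (l + k + 1)) W) + smult (2 * of_nat l * (of_nat (l + k) + 1)) ((pderiv ^^ (l + k)) W)) 1
    = poly ([:-1, 0, 1:] * (pderiv ^^ (l + k + 2)) W + smult (2 * (of_nat (l + k) + 1)) ([:0, 1:] * (pderiv ^^ (l + k + 1)) W)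
      + smult (of_nat (l + k) * (of_nat (l + k) + 1)) ((pderiv ^^ (l + k)) W)) 1"
    by (simp only: W)
  then have "2 * (of_nat k + 1) * poly ((pderiv ^^ (l + k + 1)) W) 1 =
      (of_nat l - of_nat k) * (of_nat l + of_nat k + 1) * poly ((pderiv ^^ (l + k)) W) 1"
    by (simp add: algebra_simps)
  from arg_cong[OF this, of "\<lambda>t. 1 / (2 ^ l * fact l) * t"]
  have "2 * (of_nat k + 1) * (1 / (2 ^ l * fact l) * poly ((pderiv ^^ (l + Suc k)) W) 1) =
      (of_nat l - of_nat k) * (of_nat l + of_nat k + 1) * (1 / (2 ^ l * fact l) * poly ((pderiv ^^ (l + k)) W) 1)"
    by (simp only: ac_simps add_Suc_right Suc_eq_plus1)
  moreover have "(pderiv ^^ j) (rodrigues l) = smult (1 / (2 ^ l * fact l)) ((pderiv ^^ (l + j)) W)" for j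
    unfolding rodrigues_def higher_pderiv_smult W_def by (simp add: funpow_add add.commute[of l j])
  ultimately show ?thesis
    by (simp only: poly_smult)
qed

text \<open>Legendre's equation in the form in which the addition formula produces it.\<close>

lemma legendre_equation_unique:
  fixes p :: "real poly"
  assumes "degree p = l" "poly p 1 = 1"
    and ode: "\<And>x. x \<in> {-1..1} \<Longrightarrow>
      poly (pderiv p) 1 * poly p x = x * poly (pderiv p) x - (1 - x\<^sup>2) * poly (pderiv (pderiv p)) x / 2"
  shows "p = rodrigues l"
proof -
  define c where "c = poly (pderiv p) 1"
  have "poly (smult c p) x = poly ([:0, 1:] * pderiv p - smult (1/2) ([:1, 0, -1:] * pderiv (pderiv p))) x" if "x \<in> {-1..1}" for x
    using ode[OF that] by (simp add: c_def power2_eq_square field_simps)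
  then have "{-1..1} \<subseteq> {x. poly (smult c p - ([:0, 1:] * pderiv p - smult (1/2) ([:1, 0, -1:] * pderiv (pderiv p)))) x = 0}"
    by (auto simp del: poly_smult)
  moreover have "infinite {-1..1::real}" by (simp add: infinite_Icc_iff)
  ultimately have eq: "smult c p = [:0, 1:] * pderiv p - smult (1/2) ([:1, 0, -1:] * pderiv (pderiv p))"
    using poly_roots_finite finite_subset by (metis eq_iff_diff_eq_0)
  \<comment> \<open>The constant c = p'(1) is not prescribed. Comparison of the coefficients of x^l
    yields l (l + 1) / 2.\<close>
  have "coeff p l \<noteq> 0" using assms by (metis leading_coeff_0_iff poly_0 zero_neq_one)
  moreover have "coeff (smult c p) l = coeff p l * (of_nat l * (of_nat l + 1) / 2)"
  proof (cases "l = 0")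
    case True
    then have "pderiv p = 0" using assms(1) by (simp add: pderiv_eq_0_iff)
    then show ?thesis using True unfolding eq by simp
  next
    case False
    have d: "degree (pderiv p) \<le> l - 1" "degree (pderiv (pderiv p)) \<le> l - 2"
      using assms(1) by (auto simp: degree_pderiv)
    have "coeff ([:0, 1:] * pderiv p) l = of_nat l * coeff p l"
      using False by (cases l) (simp_all add: coeff_pderiv)
    moreover have "coeff ([:1, 0, -1:] * pderiv (pderiv p)) l = - (of_nat l * (of_nat l - 1) * coeff p l)"
    proof (cases "l = 1")
      case True
      then have "pderiv (pderiv p) = 0" using assms(1) by (simp add: pderiv_eq_0_iff degree_pderiv)
      then show ?thesis using True by simp
    next
      case False
      then obtain k where k: "l = Suc (Suc k)" using \<open>l \<noteq> 0\<close> by (metis One_nat_def not0_implies_Suc)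
      then have "coeff (pderiv (pderiv p)) l = 0" using d by (intro coeff_eq_0) linarith
      then show ?thesis by (simp add: k coeff_pderiv algebra_simps)
    qed
    ultimately show ?thesis unfolding eq by (simp add: algebra_simps add_divide_distrib)
  qed
  ultimately have c: "c = of_nat l * (of_nat l + 1) / 2" by simp
  \<comment> \<open>The k-th derivative of the equation, at 1, is the recursion that
    \<open>rodrigues l\<close> satisfies. With equal values at 1, all derivatives there agree, and
    Taylor's formula gives the polynomial.\<close>
  have high: "smult c ((pderiv ^^ k) p) = smult (of_nat k + 1) ([:0, 1:] * (pderiv ^^ (k + 1)) p)
      - smult (1/2) ([:1, 0, -1:] * (pderiv ^^ (k + 2)) p) + smult (of_nat k * (of_nat k + 1) / 2) ((pderiv ^^ k) p)" for k
  proof (induction k)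
    case 0
    then show ?case using eq by simp
  next
    case (Suc k)
    have "pderiv (smult c ((pderiv ^^ k) p)) = pderiv (smult (of_nat k + 1) ([:0, 1:] * (pderiv ^^ (k + 1)) p)
      - smult (1/2) ([:1, 0, -1:] * (pderiv ^^ (k + 2)) p) + smult (of_nat k * (of_nat k + 1) / 2) ((pderiv ^^ k) p))"
      by (simp only: Suc)
    then show ?case
      by (simp add: poly_eq_poly_eq_iff[symmetric] fun_eq_iff pderiv_add pderiv_diff pderiv_minus pderiv_mult pderiv_smult
          pderiv_pCons field_simps)
  qed
  have rec: "2 * (of_nat k + 1) * poly ((pderiv ^^ Suc k) p) 1 =
    (of_nat l - of_nat k) * (of_nat l + of_nat k + 1) * poly ((pderiv ^^ k) p) 1" for k
    using arg_cong[OF high[of k], of "\<lambda>q. poly q 1"] by (simp add: c field_simps)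
  have same: "poly ((pderiv ^^ k) p) 1 = poly ((pderiv ^^ k) (rodrigues l)) 1" for k
  proof (induction k)
    case 0
    show ?case using assms(2) rodrigues_1 by simp
  next
    case (Suc k)
    have "2 * (of_nat k + 1) * poly ((pderiv ^^ Suc k) p) 1 = 2 * (of_nat k + 1) * poly ((pderiv ^^ Suc k) (rodrigues l)) 1"
      unfolding rec rodrigues_recursion Suc ..
    then show ?case by (simp only: mult_cancel_left) (auto simp: add_nonneg_eq_0_iff)
  qed
  have "poly p x = poly (rodrigues l) x" for x
    using poly_taylor[of p "Suc (max (degree p) (degree (rodrigues l)))" 1 "x - 1"]
      poly_taylor[of "rodrigues l" "Suc (max (degree p) (degree (rodrigues l)))" 1 "x - 1"]
    by (simp add: same less_Suc_eq_le)
  then show ?thesis by (simp add: poly_eq_poly_eq_iff[symmetric] fun_eq_iff)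
qed

text \<open>These values are the source of the factorials in the normalization of the spherical
  harmonics.\<close>

lemma rodrigues_deriv_1:
  "k \<le> l \<Longrightarrow> poly ((pderiv ^^ k) (rodrigues l)) 1 = fact (l + k) / (2 ^ k * fact k * fact (l - k))"
proof (induction k)
  case 0
  then show ?case using rodrigues_1 by simp
next
  case (Suc k)
  then have lk: "l - k = Suc (l - Suc k)" by simp
  have "2 * (of_nat k + 1) * poly ((pderiv ^^ Suc k) (rodrigues l)) 1 =
      (of_nat l - of_nat k) * (of_nat l + of_nat k + 1) * (fact (l + k) / (2 ^ k * fact k * fact (l - k)))"
    using Suc unfolding rodrigues_recursion by simp
  also have "fact (l - k) = (of_nat l - of_nat k :: real) * fact (l - Suc k)"
    using Suc.prems unfolding lk by (simp add: of_nat_diff)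
  also have "(of_nat l - of_nat k) * (of_nat l + of_nat k + 1) *
      (fact (l + k) / (2 ^ k * fact k * ((of_nat l - of_nat k) * fact (l - Suc k)))) =
      (of_nat l + of_nat k + 1) * (fact (l + k) / (2 ^ k * fact k * fact (l - Suc k)) :: real)"
  proof -
    have "d * e * (f / (a * (d * g))) = e * (f / (a * g))" if "d \<noteq> 0" for a d e f g :: real
      using that by simp
    then show ?thesis using Suc.prems by simp
  qed
  finally have "2 * (of_nat k + 1) * poly ((pderiv ^^ Suc k) (rodrigues l)) 1 =
      (of_nat l + of_nat k + 1) * (fact (l + k) / (2 ^ k * fact k * fact (l - Suc k)))" .
  then have "poly ((pderiv ^^ Suc k) (rodrigues l)) 1 =
      (of_nat l + of_nat k + 1) * (fact (l + k) / (2 ^ k * fact k * fact (l - Suc k))) / (2 * (of_nat k + 1))"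
  proof (intro eq_divide_imp)
    have "0 < 2 * (real k + 1)" by simp
    then show "2 * (real k + 1) \<noteq> 0" by (rule less_imp_neq[symmetric])
  qed (simp only: mult.commute)
  also have "\<dots> = ((of_nat l + of_nat k + 1) * fact (l + k)) / ((2 * 2 ^ k) * ((of_nat k + 1) * fact k) * fact (l - Suc k))"
    by (simp add: ac_simps)
  also have "(of_nat l + of_nat k + 1) * fact (l + k) = (fact (l + Suc k) :: real)"
    by (simp add: algebra_simps)
  also have "(of_nat k + 1) * fact k = (fact (Suc k) :: real)"
    by (simp add: algebra_simps)
  finally show ?case by simp
qed

lemma assoc_legendre_rodrigues:
  "assoc_legendre l k x = (-1) ^ k * sqrt (1 - x\<^sup>2) ^ k * poly ((pderiv ^^ k) (rodrigues l)) x"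
  unfolding assoc_legendre_def rodrigues_def higher_pderiv_smult
  by (simp add: funpow_add add.commute[of l k])

context irrep
begin

section \<open>The addition formula and the zero column\<close>

definition legendre :: "real poly" where
  "legendre = (SOME p. degree p \<le> l \<and> (\<forall>t. T 0 0 (rot_x t) = of_real (poly p (cos t))))"

lemma degree_legendre: "degree legendre \<le> l"
  and T_0_0_rot_x: "T 0 0 (rot_x t) = of_real (poly legendre (cos t))"
  using someI_ex[OF diagonal_rot_x_poly[of 0]] unfolding legendre_def by blast+

lemma legendre_1: "poly legendre 1 = 1"
  using T_0_0_rot_x[of 0] by (simp add: one)

lemma T_0_0: "g \<in> SO3 \<Longrightarrow> T 0 0 g = of_real (poly legendre (g $ 3 $ 3))"
  by (erule SO3_euler)
    (simp add: euler T_0_0_rot_x, simp add: euler_def matrix_matrix_mult_def sum_3 rot_x_nth rot_z_nth)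

text \<open>Both sides of \<open>addition\<close> are \<open>T 0 0 (rot_x (- b) ** rot_z a ** rot_x t)\<close>.\<close>

lemma addition:
  "of_real (poly legendre (cos b * cos t + sin b * sin t * cos a)) =
    (\<Sum>m = - int l..int l. cnj (T m 0 (rot_x b)) * T m 0 (rot_x t) * cis (- (of_int m * a)))"
proof -
  have "of_real (poly legendre (cos b * cos t + sin b * sin t * cos a)) = T 0 0 (rot_x (- b) ** (rot_z a ** rot_x t))"
    by (subst T_0_0, intro SO3_mult rot_x_SO3 rot_z_SO3)
      (simp add: matrix_matrix_mult_def sum_3 rot_x_nth rot_z_nth algebra_simps)
  also have "\<dots> = (\<Sum>m = - int l..int l. cnj (T m 0 (rot_x b)) * T m 0 (rot_x t) * cis (- (of_int m * a)))"
    using inv[OF rot_x_SO3, of 0 _ b]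
    by (subst mult) (auto simp: rot_z_mult_left intro!: sum.cong)
  finally show ?thesis .
qed

text \<open>With x = cos b and y = cos t, this is the Fourier coefficient of the addition formula at
  frequency k, freed of the factor (sin b sin t)^k. Only j with the parity of k and j at least k
  contribute, so the remaining power of the sines is even and the kernel is a polynomial in x and y.
  The range \<open>l + 4\<close> exceeds the degree and always contains the terms j < 4 used for the
  derivative at 1.\<close>

definition kernel :: "nat \<Rightarrow> real \<Rightarrow> real \<Rightarrow> real" where
  "kernel k x y = (\<Sum>j<l + 4. poly ((pderiv ^^ j) legendre) (x * y) / fact j *
    ((1 - x\<^sup>2) * (1 - y\<^sup>2)) ^ ((j - k) div 2) * cos_power_coeff j (int k))"

lemma product_kernel:
  assumes "\<bar>m\<bar> \<le> int l"
  shows "cnj (T m 0 (rot_x b)) * T m 0 (rot_x t) =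
    of_real ((sin b * sin t) ^ nat \<bar>m\<bar> * kernel (nat \<bar>m\<bar>) (cos b) (cos t))"
proof -
  \<comment> \<open>Large enough for both sums: |m - n| is at most 2 l, and |m| + j at most 2 l +
    3.\<close>
  define N where "N = 3 * l + 5"
  define k where "k = nat \<bar>m\<bar>"
  let ?a = "\<lambda>i. 2 * pi * of_nat i / of_nat N"
  let ?u = "cos b * cos t" and ?s = "sin b * sin t"
  let ?P = "\<lambda>j. poly ((pderiv ^^ j) legendre) ?u / fact j * ?s ^ j"
  have "(\<Sum>i<N. cis (of_int m * ?a i) * of_real (poly legendre (?u + ?s * cos (?a i)))) =
      (\<Sum>i<N. \<Sum>n = - int l..int l. cnj (T n 0 (rot_x b)) * T n 0 (rot_x t) * cis (of_int (m - n) * ?a i))"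
    unfolding addition sum_distrib_left
  proof (intro sum.cong refl)
    fix i n
    have "cis (of_int (m - n) * ?a i) = cis (of_int m * ?a i) * cis (- (of_int n * ?a i))"
      unfolding cis_mult of_int_diff left_diff_distrib by simp
    then show "cis (of_int m * ?a i) * (cnj (T n 0 (rot_x b)) * T n 0 (rot_x t) * cis (- (of_int n * ?a i))) =
        cnj (T n 0 (rot_x b)) * T n 0 (rot_x t) * cis (of_int (m - n) * ?a i)"
      by (simp only: ac_simps)
  qed
  also have "\<dots> = (\<Sum>n = - int l..int l. cnj (T n 0 (rot_x b)) * T n 0 (rot_x t) * (\<Sum>i<N. cis (of_int (m - n) * ?a i)))"
    unfolding sum_distrib_left by (rule sum.swap)
  also have "\<dots> = (\<Sum>n = - int l..int l. if n = m then cnj (T m 0 (rot_x b)) * T m 0 (rot_x t) * of_nat N else 0)"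
  proof (intro sum.cong refl)
    fix n assume "n \<in> {- int l..int l}"
    then have "\<bar>m - n\<bar> < int N" "0 < N" using assms by (auto simp: N_def)
    then show "cnj (T n 0 (rot_x b)) * T n 0 (rot_x t) * (\<Sum>i<N. cis (of_int (m - n) * ?a i)) =
        (if n = m then cnj (T m 0 (rot_x b)) * T m 0 (rot_x t) * of_nat N else 0)"
      by (simp only: sum_cis_roots_of_unity) simp
  qed
  also have "\<dots> = cnj (T m 0 (rot_x b)) * T m 0 (rot_x t) * of_nat N"
    using assms by auto
  finally have 1: "(\<Sum>i<N. cis (of_int m * ?a i) * of_real (poly legendre (?u + ?s * cos (?a i)))) =
    cnj (T m 0 (rot_x b)) * T m 0 (rot_x t) * of_nat N" .
  have "(\<Sum>i<N. cis (of_int m * ?a i) * of_real (poly legendre (?u + ?s * cos (?a i)))) =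
      (\<Sum>i<N. \<Sum>j<l + 4. of_real (?P j) * (cis (of_int m * ?a i) * of_real (cos (?a i) ^ j)))"
    using degree_legendre
    by (intro sum.cong refl, subst poly_taylor[of _ "l + 4"])
      (simp_all add: sum_distrib_left power_mult_distrib ac_simps)
  also have "\<dots> = (\<Sum>j<l + 4. of_real (?P j) * (\<Sum>i<N. cis (of_int m * ?a i) * of_real (cos (?a i) ^ j)))"
    unfolding sum_distrib_left by (rule sum.swap)
  also have "\<dots> = (\<Sum>j<l + 4. of_real (?P j) * (of_nat N * of_real (cos_power_coeff j m)))"
    using assms by (intro sum.cong refl) (subst cos_power_coeff_sum, auto simp: N_def)
  also have "\<dots> = of_nat N * of_real (\<Sum>j<l + 4. ?P j * cos_power_coeff j m)"
    by (simp add: sum_distrib_left ac_simps)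
  also have "(\<Sum>j<l + 4. ?P j * cos_power_coeff j m) = ?s ^ k * kernel k (cos b) (cos t)"
    unfolding kernel_def sum_distrib_left
  proof (intro sum.cong refl)
    fix j
    have mk: "cos_power_coeff j m = cos_power_coeff j (int k)"
      using cos_power_coeff_minus[of j m] by (cases "0 \<le> m") (simp_all add: k_def)
    show "?P j * cos_power_coeff j m = ?s ^ k * (poly ((pderiv ^^ j) legendre) ?u / fact j *
      ((1 - (cos b)\<^sup>2) * (1 - (cos t)\<^sup>2)) ^ ((j - k) div 2) * cos_power_coeff j (int k))"
    proof (cases "j < k \<or> odd (j + k)")
      case True
      then have "cos_power_coeff j (int k) = 0"
        using cos_power_coeff_eq_0[of j "int k"] cos_power_coeff_odd[of j "int k"] by auto
      then show ?thesis by (simp add: mk)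
    next
      case False
      then have j: "j = k + 2 * ((j - k) div 2)" by auto
      have "?s ^ j = ?s ^ k * (?s\<^sup>2) ^ ((j - k) div 2)"
        by (subst j) (simp add: power_add power_mult)
      also have "?s\<^sup>2 = (1 - (cos b)\<^sup>2) * (1 - (cos t)\<^sup>2)"
        by (simp add: power_mult_distrib sin_squared_eq)
      finally show ?thesis by (simp add: mk ac_simps)
    qed
  qed
  finally have "of_nat N * (cnj (T m 0 (rot_x b)) * T m 0 (rot_x t)) = of_nat N * of_real (?s ^ k * kernel k (cos b) (cos t))"
    using 1 by (metis mult.commute)
  then show ?thesis
    unfolding k_def mult_cancel_left by (simp add: N_def del: of_nat_add of_nat_mult of_nat_numeral)
qed

lemma kernel_at_1:
  assumes "k \<le> l"
  shows "kernel k x 1 = poly ((pderiv ^^ k) legendre) x / (2 ^ k * fact k)"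
proof -
  have "kernel k x 1 = (\<Sum>j<l + 4. if j = k then poly ((pderiv ^^ k) legendre) x / (2 ^ k * fact k) else 0)"
    unfolding kernel_def
  proof (intro sum.cong refl)
    fix j
    \<comment> \<open>The factor 1 - y^2 vanishes at y = 1, leaving j at most k + 1. Below k the
      cosine coefficient is zero, and at k + 1 parity kills it.\<close>
    consider "j < k" | "j = k" | "j = Suc k" | "(j - k) div 2 \<noteq> 0" by linarith
    then show "poly ((pderiv ^^ j) legendre) (x * 1) / fact j * ((1 - x\<^sup>2) * (1 - 1\<^sup>2)) ^ ((j - k) div 2) * cos_power_coeff j (int k)
      = (if j = k then poly ((pderiv ^^ k) legendre) x / (2 ^ k * fact k) else 0)"
    proof cases
      case 1
      then show ?thesis by (simp add: cos_power_coeff_eq_0)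
    next
      case 2
      then show ?thesis by (simp add: cos_power_coeff_top mult.commute)
    next
      case 3
      then have "cos_power_coeff j (int k) = 0" by (intro cos_power_coeff_odd) simp
      with 3 show ?thesis by simp
    next
      case 4
      then show ?thesis by (auto simp: power_0_left)
    qed
  qed
  also have "\<dots> = poly ((pderiv ^^ k) legendre) x / (2 ^ k * fact k)"
    using assms by simp
  finally show ?thesis .
qed

lemma kernel_commute: "kernel k x y = kernel k y x"
  by (simp add: kernel_def mult.commute)

lemma continuous_on_kernel [continuous_intros]:
  "continuous_on S f \<Longrightarrow> continuous_on S g \<Longrightarrow> continuous_on S (\<lambda>u. kernel k (f u) (g u))"
  unfolding kernel_def by (intro continuous_intros) auto

text \<open>As a function of b and t the product
  \<open>cnj (T m 0 (rot_x b)) * T m 0 (rot_x t)\<close> has rank one. In the interior the sines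
  cancel from the determinant identity for an auxiliary point u, and continuity permits u = 1, where
  the kernel is a derivative of \<open>legendre\<close>.\<close>

lemma kernel_rank_one:
  assumes k: "k \<le> l" and "x \<in> {-1<..<1}" "y \<in> {-1<..<1}"
  shows "kernel k x y * kernel k 1 1 = kernel k x 1 * kernel k 1 y"
proof -
  have "kernel k x y * kernel k u u = kernel k x u * kernel k u y" if "u \<in> {-1<..<1}" for u
  proof -
    define F where "F b t = complex_of_real ((sin b * sin t) ^ k * kernel k (cos b) (cos t))" for b t
    have F: "F b t = cnj (T (int k) 0 (rot_x b)) * T (int k) 0 (rot_x t)" for b t
      using product_kernel[of "int k" b t] k by (simp add: F_def)
    have "F (arccos x) (arccos y) * F (arccos u) (arccos u) = F (arccos x) (arccos u) * F (arccos u) (arccos y)"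
      by (simp add: F)
    then have "((sin (arccos x) * sin (arccos y)) ^ k * (sin (arccos u) * sin (arccos u)) ^ k) * (kernel k x y * kernel k u u) =
       ((sin (arccos x) * sin (arccos y)) ^ k * (sin (arccos u) * sin (arccos u)) ^ k) * (kernel k x u * kernel k u y)"
      using assms that unfolding F_def of_real_mult[symmetric] of_real_eq_iff
      by (simp add: power_mult_distrib ac_simps)
    moreover have "0 < sin (arccos z)" if "z \<in> {-1<..<1}" for z
      using that by (intro sin_gt_zero arccos_lt_bounded[THEN conjunct1] arccos_lt_bounded[THEN conjunct2]) auto
    ultimately show ?thesis using assms that by (simp add: less_imp_neq[symmetric])
  qed
  then have "{-1<..<1} \<subseteq> {u. kernel k x y * kernel k u u - kernel k x u * kernel k u y = 0}"
    by auto
  moreover have "closed {u. kernel k x y * kernel k u u - kernel k x u * kernel k u y = 0}"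
    by (intro closed_Collect_eq continuous_intros)
  ultimately have "closure {-1<..<1} \<subseteq> {u. kernel k x y * kernel k u u - kernel k x u * kernel k u y = 0}"
    by (rule closure_minimal)
  then have "1 \<in> {u. kernel k x y * kernel k u u - kernel k x u * kernel k u y = 0}"
    by (rule subsetD) (simp add: closure_greaterThanLessThan)
  then show ?thesis by simp
qed

lemma kernel_0: "x \<in> {-1..1} \<Longrightarrow> y \<in> {-1..1} \<Longrightarrow> kernel 0 x y = poly legendre x * poly legendre y"
  using product_kernel[of 0 "arccos x" "arccos y"]
  by (simp add: T_0_0_rot_x flip: of_real_mult)

lemma kernel_0_deriv:
  "((\<lambda>y. kernel 0 x y) has_real_derivative
    x * poly (pderiv legendre) x - (1 - x\<^sup>2) * poly (pderiv (pderiv legendre)) x / 2) (at 1)"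
proof -
  \<comment> \<open>The powers of 0 are those of 1 - y^2 at y = 1. The first summand survives only
    for j < 2 and the second only for j = 2, 3; odd j drop out through
    \<open>cos_power_coeff\<close>.\<close>
  define D where "D j = (x * poly ((pderiv ^^ Suc j) legendre) x * 0 ^ (j div 2) +
      poly ((pderiv ^^ j) legendre) x * (of_nat (j div 2) * 0 ^ (j div 2 - 1) * ((1 - x\<^sup>2) * (-2)))) / fact j * cos_power_coeff j 0" for j
  have "((\<lambda>y. poly ((pderiv ^^ j) legendre) (x * y) / fact j * ((1 - x\<^sup>2) * (1 - y\<^sup>2)) ^ ((j - 0) div 2) * cos_power_coeff j (int 0))
      has_real_derivative D j) (at 1)" for j
    unfolding D_def
    by (auto intro!: derivative_eq_intros poly_DERIV[THEN DERIV_chain2] simp: field_simps)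
  then have "((\<lambda>y. kernel 0 x y) has_real_derivative (\<Sum>j<l + 4. D j)) (at 1)"
    unfolding kernel_def by (intro DERIV_sum) auto
  moreover have "(\<Sum>j<l + 4. D j) = (\<Sum>j<4. D j)"
  proof (rule sum.mono_neutral_right)
    show "\<forall>j\<in>{..<l + 4} - {..<4}. D j = 0"
    proof
      fix j assume "j \<in> {..<l + 4} - {..<4}"
      then have "2 \<le> j div 2" by auto
      then show "D j = 0" by (simp add: D_def power_0_left)
    qed
  qed auto
  moreover have "(\<Sum>j<4. D j) = x * poly (pderiv legendre) x - (1 - x\<^sup>2) * poly (pderiv (pderiv legendre)) x / 2"
    by (simp add: D_def numeral_eq_Suc lessThan_Suc field_simps)
  ultimately show ?thesis by simp
qed

lemma legendre_ode:
  assumes x: "x \<in> {-1..1}"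
  shows "poly (pderiv legendre) 1 * poly legendre x =
    x * poly (pderiv legendre) x - (1 - x\<^sup>2) * poly (pderiv (pderiv legendre)) x / 2"
proof -
  let ?d = "x * poly (pderiv legendre) x - (1 - x\<^sup>2) * poly (pderiv (pderiv legendre)) x / 2"
  \<comment> \<open>The product form of \<open>kernel 0\<close> is known only for arguments that are
    cosines, so the derivatives at 1 are compared from one side.\<close>
  have "((\<lambda>y. kernel 0 x y) has_real_derivative ?d) (at 1 within {-1..1})"
    using kernel_0_deriv has_field_derivative_at_within by blast
  then have "((\<lambda>y. poly legendre x * poly legendre y) has_real_derivative ?d) (at 1 within {-1..1})"
    by (rule has_field_derivative_transform_within[where d=1]) (use x kernel_0 in auto)
  moreover have "((\<lambda>y. poly legendre x * poly legendre y) has_real_derivative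
      poly legendre x * poly (pderiv legendre) 1) (at 1 within {-1..1})"
    by (auto intro!: derivative_eq_intros has_field_derivative_at_within[OF poly_DERIV])
  ultimately have "?d = poly legendre x * poly (pderiv legendre) 1"
    unfolding has_real_derivative_iff_has_vector_derivative
    by (rule vector_derivative_unique_within[rotated]) (simp add: at_within_Icc_at_left)
  then show ?thesis by (simp add: mult.commute)
qed

text \<open>A smaller degree would leave no Fourier mode of frequency l in the addition formula; the
  entry T l 0 would vanish identically, contrary to Schur orthogonality.\<close>

lemma degree_legendre_eq: "degree legendre = l"
proof (rule ccontr)
  assume "degree legendre \<noteq> l"
  then have deg: "degree legendre < l" using degree_legendre by simp
  have "kernel l x y = 0" for x y
    unfolding kernel_def
  proof (intro sum.neutral ballI)
    fix j
    have "j < l \<Longrightarrow> cos_power_coeff j (int l) = 0" "l \<le> j \<Longrightarrow> (pderiv ^^ j) legendre = 0"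
      using deg by (auto intro: cos_power_coeff_eq_0 higher_pderiv_eq_0)
    then show "poly ((pderiv ^^ j) legendre) (x * y) / fact j * ((1 - x\<^sup>2) * (1 - y\<^sup>2)) ^ ((j - l) div 2) *
        cos_power_coeff j (int l) = 0"
      by (cases "j < l") auto
  qed
  then have "T (int l) 0 (rot_x t) = 0" for t
    using product_kernel[of "int l" t t] by simp
  then have "T (int l) 0 g = 0" if "g \<in> SO3" for g
    using SO3_euler[OF that] by (metis euler mult_zero_left mult_zero_right)
  then have "(LINT g|haar. T (int l) 0 g * cnj (T (int l) 0 g)) = (LINT g|haar. 0)"
    by (intro haar_integral_cong) simp
  then show False
    using double_plus_1_neq_0[of l] by (simp add: schur_orthogonality)
qed

lemma legendre_eq: "legendre = rodrigues l"
  by (rule legendre_equation_unique[OF degree_legendre_eq legendre_1 legendre_ode])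

text \<open>The addition formula gives only products of an entry at t with a conjugated entry at b.
  They determine the entry up to the unimodular w, the freedom in the choice of the canonical
  basis.\<close>

lemma zero_column_rot_x:
  assumes m: "\<bar>m\<bar> \<le> int l"
  obtains w where "cmod w = 1"
    "\<And>t. t \<in> {0..pi} \<Longrightarrow> T m 0 (rot_x t) =
      w * of_real (sqrt (fact (l - nat \<bar>m\<bar>) / fact (l + nat \<bar>m\<bar>)) * assoc_legendre l (nat \<bar>m\<bar>) (cos t))"
proof -
  define k where "k = nat \<bar>m\<bar>"
  have k: "k \<le> l" using m by (simp add: k_def)
  define p where "p = (pderiv ^^ k) legendre"
  \<comment> \<open>r is the reciprocal of 2^k k! p(1), the constant in the rank one form of the
    kernel.\<close>
  define r :: real where "r = fact (l - k) / fact (l + k)"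
  have r: "0 < r" by (simp add: r_def)
  have p1: "poly p 1 = 1 / (r * (2 ^ k * fact k))"
    unfolding p_def legendre_eq rodrigues_deriv_1[OF k] by (simp add: r_def)
  have ker: "kernel k x y = r * poly p x * poly p y" if "x \<in> {-1<..<1}" "y \<in> {-1<..<1}" for x y
  proof -
    have "kernel k x y * (poly p 1 / (2 ^ k * fact k)) = (poly p x / (2 ^ k * fact k)) * (poly p y / (2 ^ k * fact k))"
      using kernel_rank_one[OF k that] unfolding kernel_commute[of k 1 y] kernel_at_1[OF k] p_def .
    then show ?thesis
      unfolding p1 using r by (simp add: field_simps)
  qed
  have prod: "cnj (T m 0 (rot_x b)) * T m 0 (rot_x t) =
      of_real (r * (sin b ^ k * poly p (cos b)) * (sin t ^ k * poly p (cos t)))"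
    if bt: "b \<in> {0..pi}" "t \<in> {0..pi}" for b t
  \<comment> \<open>For k > 0 both sides vanish where a sine does. For k = 0 no power of the sine
    takes care of the poles, but T 0 0 is known there.\<close>
  proof (cases "k = 0")
    case True
    then have "m = 0" by (simp add: k_def)
    then show ?thesis using True by (simp add: T_0_0_rot_x p_def r_def)
  next
    case False
    have eq: "cnj (T m 0 (rot_x b)) * T m 0 (rot_x t) = of_real ((sin b * sin t) ^ k * kernel k (cos b) (cos t))"
      using product_kernel[OF m, of b t] by (simp add: k_def)
    show ?thesis
    proof (cases "sin b = 0 \<or> sin t = 0")
      case True
      then show ?thesis using False by (auto simp: eq)
    next
      case nz: False
      have "cos z \<in> {-1<..<1}" if "sin z \<noteq> 0" for z :: real
      proof -
        have "(cos z)\<^sup>2 < 1" using that by (simp add: cos_squared_eq)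
        then show ?thesis by (simp add: abs_square_less_1 abs_less_iff)
      qed
      then show ?thesis using nz by (simp add: eq ker power_mult_distrib)
    qed
  qed
  define A where "A t = sin t ^ k * poly p (cos t)" for t
  obtain b where b: "b \<in> {0..pi}" "A b \<noteq> 0"
  proof -
    have "p \<noteq> 0" using p1 r by auto
    then have "finite {x. poly p x = 0}" by (rule poly_roots_finite)
    moreover have "infinite {-1<..<1::real}" by (simp add: infinite_Ioo)
    ultimately have "\<not> {-1<..<1::real} \<subseteq> {x. poly p x = 0}"
      using finite_subset by metis
    then obtain x where x: "x \<in> {-1<..<1}" "poly p x \<noteq> 0" by blast
    have "0 < sin (arccos x)"
      using x by (intro sin_gt_zero arccos_lt_bounded[THEN conjunct1] arccos_lt_bounded[THEN conjunct2]) auto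
    then show ?thesis
      using x by (intro that[of "arccos x"]) (auto simp: A_def arccos_lbound arccos_ubound)
  qed
  define w where "w = of_real (sqrt r * A b) / cnj (T m 0 (rot_x b))"
  have "complex_of_real ((cmod (T m 0 (rot_x b)))\<^sup>2) = of_real (r * (A b)\<^sup>2)"
    using prod[OF b(1) b(1)] complex_norm_square[of "T m 0 (rot_x b)"]
    by (simp add: A_def power2_eq_square ac_simps)
  then have nb: "(cmod (T m 0 (rot_x b)))\<^sup>2 = r * (A b)\<^sup>2"
    using of_real_eq_iff by blast
  then have Tb: "T m 0 (rot_x b) \<noteq> 0" using b r by auto
  have "cmod w = 1"
  proof -
    have "(cmod w)\<^sup>2 = 1"
      using nb Tb b r by (simp add: w_def norm_divide power_divide power_mult_distrib norm_mult)
    then show ?thesis by (simp add: power2_eq_1_iff) (smt (verit) norm_ge_zero)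
  qed
  moreover have "T m 0 (rot_x t) = w * of_real (sqrt r * A t)" if t: "t \<in> {0..pi}" for t
  proof -
    have "cnj (T m 0 (rot_x b)) * T m 0 (rot_x t) = of_real (sqrt r * A b) * of_real (sqrt r * A t)"
      using prod[OF b(1) t] r by (simp add: A_def ac_simps flip: of_real_mult)
    then show ?thesis using Tb by (simp add: w_def field_simps)
  qed
  moreover have "assoc_legendre l k (cos t) = (-1) ^ k * A t" if "t \<in> {0..pi}" for t
  proof -
    have "sqrt (1 - (cos t)\<^sup>2) = sin t"
      using that by (simp add: sin_squared_eq[symmetric] sin_ge_zero)
    then show ?thesis by (simp add: assoc_legendre_rodrigues A_def p_def legendre_eq)
  qed
  ultimately show ?thesis
    \<comment> \<open>The sign (-1)^k compensates for the Condon-Shortley phase in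
      \<open>assoc_legendre\<close>.\<close>
    by (intro that[of "(-1) ^ k * w"])
      (simp_all add: norm_mult norm_power k_def[symmetric] r_def[symmetric] power_mult_distrib[symmetric] flip: mult.assoc)
qed

end

section \<open>The enlarged probability space\<close>

lemma prob_space_unit_interval: "prob_space (uniform_measure lborel {0..1::real})"
  by (rule prob_space_uniform_measure) simp_all

context prob_space
begin

lemma pair_unit_interval: "pair_prob_space M (uniform_measure lborel {0..1::real})"
  using prob_space_unit_interval prob_space_axioms
  by (simp add: pair_prob_space_def pair_sigma_finite_def prob_space_imp_sigma_finite)

lemma distr_enlarged_fst: "distr (enlarged M) M fst = M"
  unfolding enlarged_def by (rule prob_space.distr_pair_fst[OF prob_space_unit_interval])

lemma distr_enlarged_snd:
  "distr (enlarged M) (uniform_measure lborel {0..1}) snd = uniform_measure lborel {0..1}"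
proof (rule measure_eqI)
  fix A assume "A \<in> sets (distr (enlarged M) (uniform_measure lborel {0..1}) snd)"
  then have A: "A \<in> sets (uniform_measure lborel {0..1::real})" by simp
  interpret U: prob_space "uniform_measure lborel {0..1::real}" by (rule prob_space_unit_interval)
  have "snd -` A \<inter> space (enlarged M) = space M \<times> A"
    using sets.sets_into_space[OF A] by (auto simp: enlarged_def space_pair_measure)
  then show "emeasure (distr (enlarged M) (uniform_measure lborel {0..1}) snd) A =
      emeasure (uniform_measure lborel {0..1}) A"
    using A by (simp add: emeasure_distr enlarged_def U.emeasure_pair_measure_Times emeasure_space_1)
qed simp

lemma enlarged_fst_measurable: "fst \<in> enlarged M \<rightarrow>\<^sub>M M"
  unfolding enlarged_def by (rule measurable_fst)

lemma enlarged_snd_measurable: "snd \<in> enlarged M \<rightarrow>\<^sub>M uniform_measure lborel {0..1}"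
  unfolding enlarged_def by (rule measurable_snd)

lemma integral_enlarged_fst:
  fixes f :: "'a \<Rightarrow> 'b::{banach, second_countable_topology}"
  assumes "f \<in> borel_measurable M"
  shows "(LINT \<omega>|enlarged M. f (fst \<omega>)) = (LINT \<omega>|M. f \<omega>)"
  using integral_distr[OF enlarged_fst_measurable assms] distr_enlarged_fst by simp

lemma L2_var_enlarged_fst: "L2_var M Y \<Longrightarrow> L2_var (enlarged M) (\<lambda>\<omega>. Y (fst \<omega>))"
  using integrable_distr[OF enlarged_fst_measurable, of "\<lambda>\<omega>. (cmod (Y \<omega>))\<^sup>2"]
    measurable_compose[OF enlarged_fst_measurable, of Y borel]
  by (simp add: L2_var_def distr_enlarged_fst)

lemma L2_inner_enlarged_fst:
  "L2_var M Y \<Longrightarrow> L2_var M Y' \<Longrightarrow>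
    L2_inner (enlarged M) (\<lambda>\<omega>. Y (fst \<omega>)) (\<lambda>\<omega>. Y' (fst \<omega>)) = L2_inner M Y Y'"
  unfolding L2_inner_def
  by (rule integral_enlarged_fst) (rule borel_measurable_integrable[OF L2_var_mult_integrable])

lemma L2_norm_enlarged_fst:
  assumes "L2_var M Y"
  shows "L2_norm (enlarged M) (\<lambda>\<omega>. Y (fst \<omega>)) = L2_norm M Y"
  using assms integral_enlarged_fst[OF borel_measurable_integrable, of "\<lambda>\<omega>. (cmod (Y \<omega>))\<^sup>2"]
  by (simp add: L2_norm_def L2_var_def)

end

section \<open>Fourier modes of the auxiliary uniform variable\<close>

lemma integral_unit_interval_cis:
  "(LINT u|uniform_measure lborel {0..1}. cis (2 * pi * of_int k * u)) = (if k = 0 then 1 else 0)"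
proof -
  have "(LINT u|uniform_measure lborel {0..1}. cis (2 * pi * of_int k * u)) =
      (LINT u|lborel. indicator {0..1} u *\<^sub>R cis (2 * pi * of_int k * u))"
  proof -
    have *: "uniform_measure lborel {0..1::real} = density lborel (\<lambda>u. ennreal (indicator {0..1} u))"
      by (simp add: uniform_measure_def ennreal_indicator divide_ennreal_def)
    have [measurable]: "(\<lambda>u. cis (2 * pi * of_int k * u)) \<in> borel_measurable borel"
      unfolding cis_conv_exp by (intro borel_measurable_continuous_onI continuous_intros)
    show ?thesis
      unfolding * by (subst integral_density) auto
  qed
  also have "\<dots> = (if k = 0 then 1 else 0)"
  proof (cases "k = 0")
    case True
    then show ?thesis
      using integral_FTC_Icc[of 0 1 "\<lambda>x. of_real x :: complex" "\<lambda>_. 1"]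
      by (simp add: has_vector_derivative_of_real continuous_on_const)
  next
    case False
    define c where "c = 2 * pi * of_int k * \<i>"
    have c: "c \<noteq> 0" using False by (simp add: c_def)
    have e: "cis (2 * pi * of_int k * u) = exp (c * of_real u)" for u
      by (simp add: cis_conv_exp c_def ac_simps)
    have "(LINT u|lborel. indicator {0..1} u *\<^sub>R exp (c * of_real u)) = exp (c * of_real 1) / c - exp (c * of_real 0) / c"
    proof (rule integral_FTC_Icc)
      show "((\<lambda>u. exp (c * of_real u) / c) has_vector_derivative exp (c * of_real x)) (at x within {0..1})" for x
        using c by (auto intro!: derivative_eq_intros has_vector_derivative_real_field)
    qed (auto intro!: continuous_intros)
    also have "exp (c * of_real 1) = 1"
      using cis_multiple_2pi[of "of_int k"] e[of 1] by simp
    finally show ?thesis using False by (simp add: e)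
  qed
  finally show ?thesis .
qed

text \<open>The frequencies start at 1: a mode of mean zero that is independent of the given space
  is orthogonal to every random variable on it.\<close>

definition fourier_mode :: "nat \<Rightarrow> 'w \<times> real \<Rightarrow> complex" where
  "fourier_mode k \<omega> = cis (2 * pi * of_int (1 + int k) * snd \<omega>)"

context prob_space
begin

lemma fourier_mode_L2: "L2_var (enlarged M) (fourier_mode k)"
proof -
  have "(\<lambda>u. cis (2 * pi * of_int (1 + int k) * u)) \<in> uniform_measure lborel {0..1} \<rightarrow>\<^sub>M borel"
    unfolding cis_conv_exp
    by (simp cong: measurable_cong_sets)
  from measurable_compose[OF enlarged_snd_measurable this]
  have "fourier_mode k \<in> borel_measurable (enlarged M)"
    by (simp add: fourier_mode_def[abs_def])
  moreover have "finite_measure (enlarged M)"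
    unfolding enlarged_def using pair_unit_interval
    by (simp add: pair_prob_space.axioms prob_space_pair prob_space_unit_interval prob_space_axioms prob_space.finite_measure)
  ultimately show ?thesis
    by (simp add: L2_var_def fourier_mode_def finite_measure.integrable_const)
qed

lemma fourier_mode_orthonormal:
  "L2_inner (enlarged M) (fourier_mode j) (fourier_mode k) = (if j = k then 1 else 0)"
proof -
  have "L2_inner (enlarged M) (fourier_mode j) (fourier_mode k) =
      (LINT \<omega>|enlarged M. cis (2 * pi * of_int (int j - int k) * snd \<omega>))"
    unfolding L2_inner_def fourier_mode_def by (simp add: cis_cnj cis_mult algebra_simps)
  also have "\<dots> = (LINT u|uniform_measure lborel {0..1}. cis (2 * pi * of_int (int j - int k) * u))"
  proof -
    have "(\<lambda>u. cis (2 * pi * of_int (int j - int k) * u)) \<in> uniform_measure lborel {0..1} \<rightarrow>\<^sub>M borel"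
      unfolding cis_conv_exp
      by (simp cong: measurable_cong_sets)
    from integral_distr[OF enlarged_snd_measurable this] show ?thesis
      by (simp add: distr_enlarged_snd)
  qed
  finally show ?thesis unfolding integral_unit_interval_cis by simp
qed

lemma fourier_mode_orthogonal_fst:
  assumes "L2_var M Y"
  shows "L2_inner (enlarged M) (\<lambda>\<omega>. Y (fst \<omega>)) (fourier_mode k) = 0"
proof -
  interpret P: pair_prob_space M "uniform_measure lborel {0..1::real}" by (rule pair_unit_interval)
  have "integrable (enlarged M) (\<lambda>\<omega>. Y (fst \<omega>) * cnj (fourier_mode k \<omega>))"
    by (intro L2_var_mult_integrable L2_var_enlarged_fst assms fourier_mode_L2)
  from P.integral_fst'[OF this[unfolded enlarged_def]]
  have "L2_inner (enlarged M) (\<lambda>\<omega>. Y (fst \<omega>)) (fourier_mode k) =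
     (LINT x|M. LINT u|uniform_measure lborel {0..1}. Y x * cnj (cis (2 * pi * of_int (1 + int k) * u)))"
    by (simp add: L2_inner_def enlarged_def fourier_mode_def)
  also have "(\<lambda>x. LINT u|uniform_measure lborel {0..1}. Y x * cnj (cis (2 * pi * of_int (1 + int k) * u))) =
      (\<lambda>x. 0)"
    using integral_unit_interval_cis[of "1 + int k"]
    by (simp only: integral_mult_right_zero Bochner_Integration.integral_cnj) simp
  finally show ?thesis by simp
qed

end

lemma L2_sums_cong:
  assumes "\<And>\<omega>. \<omega> \<in> space M \<Longrightarrow> Y \<omega> = Y' \<omega>" "\<And>l \<omega>. \<omega> \<in> space M \<Longrightarrow> f l \<omega> = f' l \<omega>"
  shows "L2_sums M f Y \<longleftrightarrow> L2_sums M f' Y'"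
proof -
  have "(f l \<in> borel_measurable M) = (f' l \<in> borel_measurable M)" for l
    by (rule measurable_cong) (rule assms)
  moreover have "(Y \<in> borel_measurable M) = (Y' \<in> borel_measurable M)"
    by (rule measurable_cong) (rule assms)
  ultimately show ?thesis
    unfolding L2_sums_def L2_var_def
    using assms by (simp cong: Bochner_Integration.integral_cong Bochner_Integration.integrable_cong)
qed

section \<open>Normalized expansions\<close>

context isotropic_function
begin

definition F :: "nat \<Rightarrow> complex" where
  "F l = of_real (sqrt (Re (c l)))"

text \<open>Where c l = 0 there is nothing to normalize and a mode fills the gap. The encoding of
  pairs gives each (l, m) its own frequency; adding l makes the second index nonnegative.\<close>

definition normalized_Z :: "nat \<Rightarrow> int \<Rightarrow> 'w \<times> real \<Rightarrow> complex" where
  "normalized_Z l m = (if c l = 0 then fourier_mode (prod_encode (l, nat (m + int l)))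
     else (\<lambda>\<omega>. inverse (F l) * Z l m (fst \<omega>)))"

lemma F_eq_0_iff: "F l = 0 \<longleftrightarrow> c l = 0"
  using c_real[of l] c_nonneg[of l] by (auto simp: F_def)

lemma cmod_F: "(cmod (F l))\<^sup>2 = Re (c l)"
  using c_nonneg[of l] by (simp add: F_def)

lemma covariance_expansion_F:
  assumes "g1 \<in> SO3" "g2 \<in> SO3"
  shows "(\<lambda>l. of_real ((cmod (F l))\<^sup>2) * T l n n (matrix_inv g1 ** g2)) sums L2_inner M (X g1) (X g2)"
  using covariance_expansion[OF assms] by (simp add: cmod_F)

lemma normalized_Z_on_original_space: "on_original_space M F normalized_Z"
  unfolding on_original_space_def normalized_Z_def F_eq_0_iff
  by (auto intro!: exI[of _ "\<lambda>\<omega>. inverse (F _) * Z _ _ \<omega>"] Z_L2)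

context
  assumes M: "prob_space M"
begin

interpretation M: prob_space M by (rule M)

lemma normalized_Z_L2: "L2_var (enlarged M) (normalized_Z l m)"
  by (auto simp: normalized_Z_def M.fourier_mode_L2 intro!: M.L2_var_enlarged_fst[OF Z_L2])

lemma normalized_Z_orthonormal: "orthonormal_family (enlarged M) normalized_Z"
  unfolding orthonormal_family_def
proof (intro conjI allI ballI)
  fix l l' m m' assume m: "m \<in> {- int l..int l}" "m' \<in> {- int l'..int l'}"
  have mode_Z: "L2_inner (enlarged M) (\<lambda>\<omega>. b * Z l m (fst \<omega>)) (fourier_mode k) = 0"
    "L2_inner (enlarged M) (fourier_mode k) (\<lambda>\<omega>. b * Z l m (fst \<omega>)) = 0" for b l m k
  proof -
    show 0: "L2_inner (enlarged M) (\<lambda>\<omega>. b * Z l m (fst \<omega>)) (fourier_mode k) = 0"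
      by (rule M.fourier_mode_orthogonal_fst[OF L2_var_cmult[OF Z_L2]])
    show "L2_inner (enlarged M) (fourier_mode k) (\<lambda>\<omega>. b * Z l m (fst \<omega>)) = 0"
      using L2_inner_commute[of "enlarged M" "fourier_mode k" "\<lambda>\<omega>. b * Z l m (fst \<omega>)"] 0 by simp
  qed
  consider "c l = 0" "c l' = 0" | "c l = 0" "c l' \<noteq> 0" | "c l \<noteq> 0" "c l' = 0" | "c l \<noteq> 0" "c l' \<noteq> 0" by blast
  then show "L2_inner (enlarged M) (normalized_Z l m) (normalized_Z l' m') = (if l = l' \<and> m = m' then 1 else 0)"
  proof cases
    case 1
    then show ?thesis using m by (auto simp: normalized_Z_def M.fourier_mode_orthonormal prod_encode_eq)
  next
    case 2
    then show ?thesis by (auto simp: normalized_Z_def mode_Z)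
  next
    case 3
    then show ?thesis by (auto simp: normalized_Z_def mode_Z)
  next
    case 4
    have "L2_inner (enlarged M) (normalized_Z l m) (normalized_Z l' m') =
        inverse (F l) * cnj (inverse (F l')) * L2_inner M (Z l m) (Z l' m')"
      using 4 by (simp add: normalized_Z_def L2_inner_cmult_left L2_inner_cmult_right
          M.L2_inner_enlarged_fst[OF Z_L2 Z_L2])
    also have "\<dots> = (if l = l' \<and> m = m' then 1 else 0)"
    proof -
      have "F l * F l = of_real (Re (c l))" "cnj (F l) = F l"
        using c_nonneg[of l] by (simp_all add: F_def flip: of_real_mult)
      moreover have "F l \<noteq> 0" using 4 F_eq_0_iff by simp
      ultimately show ?thesis using m by (auto simp: inner_Z_Z field_simps)
    qed
    finally show ?thesis .
  qed
qed (rule normalized_Z_L2)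

lemma normalized_expansion:
  assumes g: "g \<in> SO3"
  shows "L2_sums (enlarged M)
    (\<lambda>l \<omega>. \<Sum>m = - int l..int l. F l * T l n m (matrix_inv g) * normalized_Z l m \<omega>)
    (\<lambda>\<omega>. X g (fst \<omega>))"
  unfolding L2_sums_def
proof (intro conjI allI)
  show "L2_var (enlarged M) (\<lambda>\<omega>. \<Sum>m = - int l..int l. F l * T l n m (matrix_inv g) * normalized_Z l m \<omega>)" for l
    by (intro L2_var_sum L2_var_cmult normalized_Z_L2)
  show "L2_var (enlarged M) (\<lambda>\<omega>. X g (fst \<omega>))"
    by (rule M.L2_var_enlarged_fst[OF X_L2[OF g]])
  \<comment> \<open>An equality at every point: for c l = 0 both F l and \<open>Z l m\<close> are
    exactly zero, so the filling modes never enter the sum.\<close>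
  have summand: "F l * T l n m (matrix_inv g) * normalized_Z l m \<omega> = T l n m (matrix_inv g) * Z l m (fst \<omega>)" for l m \<omega>
    using F_eq_0_iff[of l] by (cases "c l = 0") (simp_all add: normalized_Z_def Z_def)
  have "(LINT \<omega>|enlarged M. (cmod (X g (fst \<omega>) - (\<Sum>l<L. \<Sum>m = - int l..int l. F l * T l n m (matrix_inv g) * normalized_Z l m \<omega>)))\<^sup>2)
      = (L2_norm M (\<lambda>\<omega>. X g \<omega> - partial_sum L g \<omega>))\<^sup>2" for L
    using M.L2_norm_enlarged_fst[OF L2_var_diff[OF X_L2[OF g] partial_sum_L2[of L g]]]
    by (simp add: L2_norm_square[symmetric] summand partial_sum_def)
  then show "(\<lambda>L. LINT \<omega>|enlarged M. (cmod (X g (fst \<omega>) - (\<Sum>l<L. \<Sum>m = - int l..int l. F l * T l n m (matrix_inv g) * normalized_Z l m \<omega>)))\<^sup>2)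
      \<longlonglongrightarrow> 0"
    using tendsto_power[OF expansion[OF g], of 2] by simp
qed

end

end

text \<open>Equivariance extends from the generic points to the poles by continuity in mean square.\<close>

lemma equivariant_poles:
  assumes ms: "mean_square_continuous M X"
    and eq: "\<And>a t b s. 0 < t \<Longrightarrow> t < pi \<Longrightarrow>
      L2_norm M (\<lambda>\<omega>. X (euler a t b ** rot_z s) \<omega> - z s * X (euler a t b) \<omega>) = 0"
    and g: "g \<in> SO3"
  shows "L2_norm M (\<lambda>\<omega>. X (g ** rot_z s) \<omega> - z s * X g \<omega>) = 0"
proof -
  have L2: "L2_var M (X h)" if "h \<in> SO3" for h
    using ms that by (simp add: mean_square_continuous_def)
  obtain a t b where t: "0 \<le> t" "t \<le> pi" and g_eq: "g = euler a t b" by (rule SO3_euler[OF g])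
  \<comment> \<open>Convex combinations of t with pi / 2: strictly between 0 and pi even if t is an
    endpoint, and tending to t.\<close>
  define r where "r k = (1 - inverse (real (Suc (Suc k)))) * t + inverse (real (Suc (Suc k))) * (pi / 2)" for k
  have r: "0 < r k" "r k < pi" for k
  proof -
    have i: "0 < inverse (real (Suc (Suc k)))" "inverse (real (Suc (Suc k))) < 1" by (simp_all add: inverse_less_1_iff)
    show "0 < r k" unfolding r_def using i t by (intro add_nonneg_pos) auto
    have "r k < (1 - inverse (real (Suc (Suc k)))) * pi + inverse (real (Suc (Suc k))) * pi"
      unfolding r_def using i t by (intro add_le_less_mono mult_left_mono mult_strict_left_mono) auto
    then show "r k < pi" by (simp add: algebra_simps)
  qed
  have "(\<lambda>k. inverse (real (Suc (Suc k)))) \<longlonglongrightarrow> 0"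
    by (rule LIMSEQ_Suc[OF LIMSEQ_inverse_real_of_nat])
  then have "r \<longlonglongrightarrow> (1 - 0) * t + 0 * (pi / 2)"
    unfolding r_def[abs_def] by (intro tendsto_intros)
  then have r_lim: "r \<longlonglongrightarrow> t" by simp
  have cont: "continuous_on UNIV (\<lambda>t. euler a t b')" for b'
    unfolding euler_def matrix_matrix_mult_def by (intro continuous_intros)
  have lim: "(\<lambda>k. L2_norm M (\<lambda>\<omega>. X (euler a (r k) b') \<omega> - X (euler a t b') \<omega>)) \<longlonglongrightarrow> 0" for b'
  proof -
    have "(\<lambda>k. euler a (r k) b') \<longlonglongrightarrow> euler a t b'"
      using continuous_on_tendsto_compose[OF cont r_lim] by simp
    moreover have "continuous (at (euler a t b') within SO3) (\<lambda>h. L2_norm M (\<lambda>\<omega>. X h \<omega> - X (euler a t b') \<omega>))"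
    proof -
      have "((\<lambda>h. L2_norm M (\<lambda>\<omega>. X h \<omega> - X (euler a t b') \<omega>)) \<longlongrightarrow> 0) (at (euler a t b') within SO3)"
        by (rule mean_square_continuous_tendsto[OF ms euler_SO3])
      then show ?thesis by (simp add: continuous_within L2_norm_def)
    qed
    ultimately have "(\<lambda>k. L2_norm M (\<lambda>\<omega>. X (euler a (r k) b') \<omega> - X (euler a t b') \<omega>)) \<longlonglongrightarrow>
        L2_norm M (\<lambda>\<omega>. X (euler a t b') \<omega> - X (euler a t b') \<omega>)"
      unfolding continuous_within_sequentially comp_def by auto
    then show ?thesis by (simp add: L2_norm_def)
  qed
  have eul: "euler a t b ** rot_z s = euler a t (b + s)" for t
    by (simp add: euler_def rot_z_add matrix_mul_assoc)
  have scale: "L2_norm M (\<lambda>\<omega>. w * V \<omega>) = cmod w * L2_norm M V" for w V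
    by (simp add: L2_norm_def norm_mult power_mult_distrib real_sqrt_mult)
  have "L2_norm M (\<lambda>\<omega>. X (g ** rot_z s) \<omega> - z s * X g \<omega>) \<le>
      L2_norm M (\<lambda>\<omega>. X (euler a (r k) (b + s)) \<omega> - X (euler a t (b + s)) \<omega>) +
      cmod (z s) * L2_norm M (\<lambda>\<omega>. X (euler a (r k) b) \<omega> - X (euler a t b) \<omega>)" for k
  proof -
    let ?A = "\<lambda>\<omega>. X (euler a (r k) (b + s)) \<omega> - X (euler a t (b + s)) \<omega>"
    let ?B = "\<lambda>\<omega>. z s * (X (euler a (r k) b) \<omega> - X (euler a t b) \<omega>)"
    let ?C = "\<lambda>\<omega>. X (euler a (r k) (b + s)) \<omega> - z s * X (euler a (r k) b) \<omega>"
    have vars: "L2_var M ?A" "L2_var M ?B" "L2_var M ?C"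
      by (intro L2_var_diff L2_var_cmult L2 euler_SO3)+
    \<comment> \<open>The defect of equivariance at g is B - A + C, where C is the defect at the
      nearby generic point and has norm zero.\<close>
    have "L2_norm M (\<lambda>\<omega>. X (g ** rot_z s) \<omega> - z s * X g \<omega>) = L2_norm M (\<lambda>\<omega>. (?B \<omega> - ?A \<omega>) - - ?C \<omega>)"
      unfolding g_eq eul by (simp add: algebra_simps)
    also have "\<dots> \<le> L2_norm M (\<lambda>\<omega>. ?B \<omega> - ?A \<omega>) + L2_norm M (\<lambda>\<omega>. - ?C \<omega>)"
      by (intro L2_norm_triangle_diff L2_var_diff L2_var_uminus L2_var_cmult L2 euler_SO3)
    also have "L2_norm M (\<lambda>\<omega>. - ?C \<omega>) = 0"
    proof -
      have "L2_norm M (\<lambda>\<omega>. - ?C \<omega>) = L2_norm M ?C"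
        unfolding L2_norm_def by (simp only: norm_minus_cancel)
      then show ?thesis using eq[of "r k" a b s] r[of k] by (simp add: eul)
    qed
    also have "L2_norm M (\<lambda>\<omega>. ?B \<omega> - ?A \<omega>) \<le> L2_norm M ?B + L2_norm M ?A"
      using vars by (intro L2_norm_triangle_diff)
    finally show ?thesis by (simp add: scale)
  qed
  moreover have "(\<lambda>k. L2_norm M (\<lambda>\<omega>. X (euler a (r k) (b + s)) \<omega> - X (euler a t (b + s)) \<omega>) +
      cmod (z s) * L2_norm M (\<lambda>\<omega>. X (euler a (r k) b) \<omega> - X (euler a t b) \<omega>)) \<longlonglongrightarrow> 0 + cmod (z s) * 0"
    by (intro tendsto_intros lim)
  ultimately have "L2_norm M (\<lambda>\<omega>. X (g ** rot_z s) \<omega> - z s * X g \<omega>) \<le> 0 + cmod (z s) * 0"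
    by (intro LIMSEQ_le_const[of _ _ "L2_norm M (\<lambda>\<omega>. X (g ** rot_z s) \<omega> - z s * X g \<omega>)"]) auto
  then show ?thesis using L2_norm_nonneg[of M] by (simp add: order_antisym)
qed

section \<open>Application to the components of the vector field\<close>

lemma isotropic_functionI:
  assumes "\<And>l. canonical_irrep l (T l)" "\<bar>n\<bar> \<le> 1" "weakly_isotropic M X" "mean_square_continuous M X"
    and eq: "\<And>a t b s \<omega>. 0 < t \<Longrightarrow> t < pi \<Longrightarrow> \<omega> \<in> space M \<Longrightarrow>
      X (euler a t (b + s)) \<omega> = cis (of_int n * s) * X (euler a t b) \<omega>"
  shows "isotropic_function T n M X"
proof
  show "canonical_irrep l (T l)" for l by fact
  fix s g assume "g \<in> SO3"
  show "L2_norm M (\<lambda>\<omega>. X (g ** rot_z s) \<omega> - cis (of_int n * s) * X g \<omega>) = 0"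
  proof (rule equivariant_poles[OF assms(4) _ \<open>g \<in> SO3\<close>, where z = "\<lambda>s. cis (of_int n * s)"])
    fix a t b s :: real assume t: "0 < t" "t < pi"
    have "euler a t b ** rot_z s = euler a t (b + s)"
      by (simp add: euler_def rot_z_add matrix_mul_assoc)
    then have "L2_norm M (\<lambda>\<omega>. X (euler a t b ** rot_z s) \<omega> - cis (of_int n * s) * X (euler a t b) \<omega>) =
        L2_norm M (\<lambda>_. 0)"
      unfolding L2_norm_def using t
      by (intro arg_cong[where f=sqrt] Bochner_Integration.integral_cong) (simp_all add: eq)
    then show "L2_norm M (\<lambda>\<omega>. X (euler a t b ** rot_z s) \<omega> - cis (of_int n * s) * X (euler a t b) \<omega>) = 0"
      by (simp add: L2_norm_def)
  qed
qed (use assms in auto)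

text \<open>Inversion conjugates the column entry, so the dependence on the azimuth is cis (- m
  times azimuth), that of the harmonic of order - m. The shift of the azimuth by pi / 2, the basis
  phase w and the sign convention for negative orders do not depend on the point and are collected
  in v.\<close>

lemma (in irrep) zero_row_sph_harmonic:
  assumes m: "\<bar>m\<bar> \<le> int l"
  obtains v where "cmod v = 1"
    "\<And>\<theta> \<phi>. \<theta> \<in> {0..pi} \<Longrightarrow> T 0 m (matrix_inv (euler (pi / 2 - \<phi>) \<theta> 0)) =
      v * of_real (sqrt (4 * pi / (2 * real l + 1))) * sph_harmonic l (- m) \<theta> \<phi>"
proof -
  define k where "k = nat \<bar>m\<bar>"
  obtain w where w: "cmod w = 1" "\<And>t. t \<in> {0..pi} \<Longrightarrow> T m 0 (rot_x t) =
      w * of_real (sqrt (fact (l - k) / fact (l + k)) * assoc_legendre l k (cos t))"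
    using zero_column_rot_x[OF m] unfolding k_def by metis
  define s :: complex where "s = (if - m < 0 then (-1) ^ k else 1)"
  have s: "s * s = 1" "cmod s = 1" by (auto simp: s_def norm_power simp flip: power_mult_distrib)
  define v where "v = cis (of_int m * (pi / 2)) * cnj w * s"
  have "T 0 m (matrix_inv (euler (pi / 2 - \<phi>) \<theta> 0)) =
      v * of_real (sqrt (4 * pi / (2 * real l + 1))) * sph_harmonic l (- m) \<theta> \<phi>"
    if \<theta>: "\<theta> \<in> {0..pi}" for \<theta> \<phi>
  proof -
    have "T 0 m (matrix_inv (euler (pi / 2 - \<phi>) \<theta> 0)) =
        cis (of_int m * (pi / 2)) * cis (- (of_int m * \<phi>)) * cnj w *
          of_real (sqrt (fact (l - k) / fact (l + k)) * assoc_legendre l k (cos \<theta>))"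
      unfolding inv[OF euler_SO3] euler w(2)[OF \<theta>]
      by (simp add: cis_cnj cis_mult algebra_simps)
    moreover have "sph_harmonic l (- m) \<theta> \<phi> = s * of_real (sqrt ((2 * real l + 1) / (4 * pi) * (fact (l - k) / fact (l + k)))
         * assoc_legendre l k (cos \<theta>)) * cis (- (of_int m * \<phi>))"
      by (simp add: sph_harmonic_def Let_def k_def s_def)
    moreover have "sqrt (4 * pi / (2 * real l + 1)) * sqrt ((2 * real l + 1) / (4 * pi) * (fact (l - k) / fact (l + k))) =
        sqrt (fact (l - k) / fact (l + k))"
    proof -
      have "4 * pi / (2 * real l + 1) * ((2 * real l + 1) / (4 * pi) * x) = x" for x :: real
      proof -
        have "0 < 4 * pi / (2 * real l + 1)" by simp
        then show ?thesis by (simp add: divide_simps)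
      qed
      then show ?thesis unfolding real_sqrt_mult[symmetric] by simp
    qed
    then have "complex_of_real (sqrt (4 * pi / (2 * real l + 1))) * of_real (sqrt ((2 * real l + 1) / (4 * pi) * (fact (l - k) / fact (l + k)))) =
        of_real (sqrt (fact (l - k) / fact (l + k)))"
      by (metis of_real_mult)
    ultimately show ?thesis
      using s(1) unfolding v_def of_real_mult by (simp only:) algebra
  qed
  moreover have "cmod v = 1" by (simp add: v_def norm_mult w s)
  ultimately show ?thesis by (rule that[rotated])
qed

theorem theorem1:
  fixes M :: "'w measure"
    and X :: "real^3 \<Rightarrow> 'w \<Rightarrow> complex^3"
    and X_plus X_minus X_normal :: "real^3^3 \<Rightarrow> 'w \<Rightarrow> complex"
    and T :: "nat \<Rightarrow> int \<Rightarrow> int \<Rightarrow> real^3^3 \<Rightarrow> complex"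
  assumes "prob_space M"
    and "\<And>l. canonical_irrep l (T l)"
    and "zero_mean_field M X"
    and "\<And>\<phi>1 \<theta> \<phi>2 \<omega>. 0 < \<theta> \<Longrightarrow> \<theta> < pi \<Longrightarrow> \<omega> \<in> space M \<Longrightarrow>
      X_plus (euler \<phi>1 \<theta> \<phi>2) \<omega> =
        cis \<phi>2 * (- field_\<phi> X \<theta> (pi / 2 - \<phi>1) \<omega> + \<i> * field_\<theta> X \<theta> (pi / 2 - \<phi>1) \<omega>)"
    and "\<And>\<phi>1 \<theta> \<phi>2 \<omega>. 0 < \<theta> \<Longrightarrow> \<theta> < pi \<Longrightarrow> \<omega> \<in> space M \<Longrightarrow>
      X_minus (euler \<phi>1 \<theta> \<phi>2) \<omega> =
        cis (- \<phi>2) * (- field_\<phi> X \<theta> (pi / 2 - \<phi>1) \<omega> - \<i> * field_\<theta> X \<theta> (pi / 2 - \<phi>1) \<omega>)"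
    and "\<And>\<phi>1 \<theta> \<phi>2 \<omega>. 0 \<le> \<theta> \<Longrightarrow> \<theta> \<le> pi \<Longrightarrow> \<omega> \<in> space M \<Longrightarrow>
      X_normal (euler \<phi>1 \<theta> \<phi>2) \<omega> = field_r X \<theta> (pi / 2 - \<phi>1) \<omega>"
    and "weakly_isotropic M X_plus" and "mean_square_continuous M X_plus"
    and "weakly_isotropic M X_minus" and "mean_square_continuous M X_minus"
    and "weakly_isotropic M X_normal" and "mean_square_continuous M X_normal"
  shows "\<exists>(F_plus :: nat \<Rightarrow> complex) (F_minus :: nat \<Rightarrow> complex) (F :: nat \<Rightarrow> complex)
      (Z_plus :: nat \<Rightarrow> int \<Rightarrow> 'w \<times> real \<Rightarrow> complex)
      (Z_minus :: nat \<Rightarrow> int \<Rightarrow> 'w \<times> real \<Rightarrow> complex)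
      (Z :: nat \<Rightarrow> int \<Rightarrow> 'w \<times> real \<Rightarrow> complex).
      orthonormal_family (enlarged M) Z_plus \<and> on_original_space M F_plus Z_plus \<and>
      orthonormal_family (enlarged M) Z_minus \<and> on_original_space M F_minus Z_minus \<and>
      orthonormal_family (enlarged M) Z \<and> on_original_space M F Z \<and>
      (\<forall>g\<in>SO3. L2_sums (enlarged M)
        (\<lambda>l \<omega>. \<Sum>m = - int l..int l. F_plus l * T l 1 m (matrix_inv g) * Z_plus l m \<omega>)
        (\<lambda>\<omega>. X_plus g (fst \<omega>))) \<and>
      (\<forall>g\<in>SO3. L2_sums (enlarged M)
        (\<lambda>l \<omega>. \<Sum>m = - int l..int l. F_minus l * T l (-1) m (matrix_inv g) * Z_minus l m \<omega>)
        (\<lambda>\<omega>. X_minus g (fst \<omega>))) \<and>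
      (\<forall>g1\<in>SO3. \<forall>g2\<in>SO3.
        (\<lambda>l. complex_of_real ((cmod (F_plus l))\<^sup>2) * T l 1 1 (matrix_inv g1 ** g2))
          sums L2_inner M (X_plus g1) (X_plus g2)) \<and>
      (\<forall>g1\<in>SO3. \<forall>g2\<in>SO3.
        (\<lambda>l. complex_of_real ((cmod (F_minus l))\<^sup>2) * T l (-1) (-1) (matrix_inv g1 ** g2))
          sums L2_inner M (X_minus g1) (X_minus g2)) \<and>
      (\<forall>\<theta>\<in>{0..pi}. \<forall>\<phi>. L2_sums (enlarged M)
        (\<lambda>l \<omega>. \<Sum>m = - int l..int l. F l * sph_harmonic l m \<theta> \<phi> * Z l m \<omega>)
        (\<lambda>\<omega>. field_r X \<theta> \<phi> (fst \<omega>)))"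
proof -
  interpret M: prob_space M by fact
  have cis_add: "cis (x + y) = cis y * cis x" for x y by (simp add: cis_mult add.commute)
  \<comment> \<open>The prefactors cis of the third Euler angle, its conjugate and 1 give n = 1, n =
    -1 and n = 0 for the three components.\<close>
  interpret P: isotropic_function T 1 M X_plus
    by (rule isotropic_functionI) (use assms cis_add in \<open>simp_all\<close>)
  interpret N: isotropic_function T "-1" M X_minus
    by (rule isotropic_functionI) (use assms cis_add[of "- b" "- s" for b s] in \<open>simp_all\<close>)
  interpret R: isotropic_function T 0 M X_normal
    by (rule isotropic_functionI) (use assms in \<open>simp_all\<close>)
  have "\<exists>v. cmod v = 1 \<and> (\<forall>\<theta>\<in>{0..pi}. \<forall>\<phi>. T l 0 m (matrix_inv (euler (pi / 2 - \<phi>) \<theta> 0)) =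
      v * of_real (sqrt (4 * pi / (2 * real l + 1))) * sph_harmonic l (- m) \<theta> \<phi>)" if "\<bar>m\<bar> \<le> int l" for l m
    using irrep.zero_row_sph_harmonic[OF irrep.intro[OF assms(2)] that] by metis
  note ex_v = this
  define v where "v l m = (SOME v. cmod v = 1 \<and> (\<forall>\<theta>\<in>{0..pi}. \<forall>\<phi>. T l 0 m (matrix_inv (euler (pi / 2 - \<phi>) \<theta> 0)) =
      v * of_real (sqrt (4 * pi / (2 * real l + 1))) * sph_harmonic l (- m) \<theta> \<phi>))" for l m
  have v: "cmod (v l m) = 1"
    "\<And>\<theta> \<phi>. \<theta> \<in> {0..pi} \<Longrightarrow> T l 0 m (matrix_inv (euler (pi / 2 - \<phi>) \<theta> 0)) =
      v l m * of_real (sqrt (4 * pi / (2 * real l + 1))) * sph_harmonic l (- m) \<theta> \<phi>" if "\<bar>m\<bar> \<le> int l" for l m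
    using someI_ex[OF ex_v[OF that]] unfolding v_def by blast+
  \<comment> \<open>The normalizing constant depends on l alone and goes into F; the phase, which
    depends also on m, goes into Z without disturbing orthonormality.\<close>
  define F where "F l = R.F l * of_real (sqrt (4 * pi / (2 * real l + 1)))" for l
  define Z where "Z l m \<omega> = v l (- m) * R.normalized_Z l (- m) \<omega>" for l m \<omega>
  have Z_orth: "orthonormal_family (enlarged M) Z"
    unfolding orthonormal_family_def
  proof (intro conjI allI ballI)
    show "L2_var (enlarged M) (Z l m)" for l m
      unfolding Z_def[abs_def] by (intro L2_var_cmult R.normalized_Z_L2 assms(1))
    fix l l' m m' assume m: "m \<in> {- int l..int l}" "m' \<in> {- int l'..int l'}"
    have "L2_inner (enlarged M) (R.normalized_Z l (- m)) (R.normalized_Z l' (- m')) = (if l = l' \<and> m = m' then 1 else 0)"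
      using R.normalized_Z_orthonormal[OF assms(1)] m unfolding orthonormal_family_def by auto
    moreover have "v l (- m) * cnj (v l (- m)) = 1"
      using v(1)[of "- m" l] m complex_norm_square[of "v l (- m)"] by auto
    ultimately show "L2_inner (enlarged M) (Z l m) (Z l' m') = (if l = l' \<and> m = m' then 1 else 0)"
      unfolding Z_def[abs_def] L2_inner_cmult_left L2_inner_cmult_right by auto
  qed
  have Z_orig: "on_original_space M F Z"
    unfolding on_original_space_def
  proof (intro allI ballI impI)
    fix l m assume m: "m \<in> {- int l..int l}" and "F l \<noteq> 0"
    then have "R.F l \<noteq> 0" "- m \<in> {- int l..int l}" by (auto simp: F_def)
    then obtain W where "L2_var M W" "\<And>\<omega>. R.normalized_Z l (- m) \<omega> = W (fst \<omega>)"
      using R.normalized_Z_on_original_space unfolding on_original_space_def by metis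
    then show "\<exists>W. L2_var M W \<and> (\<forall>\<omega>. Z l m \<omega> = W (fst \<omega>))"
      by (intro exI[of _ "\<lambda>\<omega>. v l (- m) * W \<omega>"]) (auto simp: Z_def)
  qed
  have Z_sums: "L2_sums (enlarged M) (\<lambda>l \<omega>. \<Sum>m = - int l..int l. F l * sph_harmonic l m \<theta> \<phi> * Z l m \<omega>)
        (\<lambda>\<omega>. field_r X \<theta> \<phi> (fst \<omega>))" if \<theta>: "\<theta> \<in> {0..pi}" for \<theta> \<phi>
  proof -
    let ?g = "euler (pi / 2 - \<phi>) \<theta> 0"
    have terms: "(\<Sum>m = - int l..int l. R.F l * T l 0 m (matrix_inv ?g) * R.normalized_Z l m \<omega>) =
        (\<Sum>m = - int l..int l. F l * sph_harmonic l m \<theta> \<phi> * Z l m \<omega>)" for l \<omega>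
    \<comment> \<open>The reflection of m matches the row index m with the harmonic of order -
      m.\<close>
    proof (rule sum.reindex_bij_witness[of _ uminus uminus])
      fix m assume "m \<in> {- int l..int l}"
      then have "\<bar>m\<bar> \<le> int l" by auto
      then show "F l * sph_harmonic l (- m) \<theta> \<phi> * Z l (- m) \<omega> = R.F l * T l 0 m (matrix_inv ?g) * R.normalized_Z l m \<omega>"
        by (simp add: v(2)[OF _ \<theta>] F_def Z_def)
    qed auto
    have normal: "X_normal ?g (fst \<omega>) = field_r X \<theta> \<phi> (fst \<omega>)" if "\<omega> \<in> space (enlarged M)" for \<omega>
      using assms(6)[of \<theta> "fst \<omega>" "pi / 2 - \<phi>" 0] that \<theta> by (auto simp: enlarged_def space_pair_measure)
    have "L2_sums (enlarged M) (\<lambda>l \<omega>. \<Sum>m = - int l..int l. R.F l * T l 0 m (matrix_inv ?g) * R.normalized_Z l m \<omega>)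
        (\<lambda>\<omega>. X_normal ?g (fst \<omega>)) \<longleftrightarrow>
      L2_sums (enlarged M) (\<lambda>l \<omega>. \<Sum>m = - int l..int l. F l * sph_harmonic l m \<theta> \<phi> * Z l m \<omega>)
        (\<lambda>\<omega>. field_r X \<theta> \<phi> (fst \<omega>))"
      by (rule L2_sums_cong) (rule normal terms, assumption?)+
    then show ?thesis using R.normalized_expansion[OF assms(1) euler_SO3] by blast
  qed
  show ?thesis
    by (rule exI[of _ P.F], rule exI[of _ N.F], rule exI[of _ F], rule exI[of _ P.normalized_Z],
        rule exI[of _ N.normalized_Z], rule exI[of _ Z],
        intro conjI ballI allI P.normalized_Z_orthonormal[OF assms(1)] P.normalized_Z_on_original_space
          N.normalized_Z_orthonormal[OF assms(1)] N.normalized_Z_on_original_space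
          P.normalized_expansion[OF assms(1)] N.normalized_expansion[OF assms(1)]
          P.covariance_expansion_F N.covariance_expansion_F Z_orth Z_orig Z_sums;
        assumption)
qed

end
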